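(* Let $p$ be a prime, $m$ a positive integer not divisible by $p$, and $0<i<m$. Then for every $\sigma\in G_{\mathbb{Q}(\mu_m)}$, \[ K(\xi_m^{-i})(\sigma)+\iota\big(K(\xi_m^{i})(\sigma)\big)=E_{1,\chi(\sigma)}+\mu_{\chi(\sigma)}\big(\tfrac{i}{m}\big) \] as measures on $\mathbb{Z}_p$.
   Context: $\xi_r:=\exp(2\pi\sqrt{-1}/r)$. For $n\ge0$, $V_n:=\mathbb{P}^1_{\bar{\mathbb{Q}}}\setminus(\{0,\infty\}\cup\mu_{p^n})$ ($V_0=\mathbb{P}^1_{\bar{\mathbb{Q}}}\setminus\{0,1,\infty\}$); $\overrightarrow{01}$ is the tangential base point at $0$ pointing to $1$. Paths are pro-$p$ étale paths (isomorphisms of fibre functors); $\gamma\cdot\delta$ means $\delta$ followed by $\gamma$. $\pi_1(V_n,\overrightarrow{01})$ is the pro-$p$ étale fundamental group, free on $x_n$ (loop around $0$) and $y_{n,k}$, $0\le k<p^n$ (loops around $\xi_{p^n}^k$); $x=x_0$. The Galois group acts on paths. Paths on $V_0$ starting at $\overrightarrow{01}$ lift uniquely to $V_n$ starting at $\overrightarrow{01}$ via $z\mapsto z^{p^n}$. For $0<j<m$, $\alpha_j$ is the path on $V_0$ from $\overrightarrow{01}$ to $\xi_m^j$: an arc in the positive sense in an infinitesimal neighbourhood of $0$ from $\overrightarrow{01}$ to the tangent vector at $0$ pointing to $\xi_m^j$, followed by the straight segment from $0$ to $\xi_m^j$; $\beta_j:=\alpha_j\cdot x^{-j/m}$ ($j/m\in\mathbb{Z}_p$),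 and $\tilde\beta_j^n$ is its lift to $V_n$ starting at $\overrightarrow{01}$; it ends at $\xi_m^{[jp^{-n}]_m}$, a point fixed by $G_{\mathbb{Q}(\mu_m)}$. Hence for $\sigma\in G_{\mathbb{Q}(\mu_m)}$, $(\tilde\beta_j^n)^{-1}\cdot\sigma(\tilde\beta_j^n)\in\pi_1(V_n,\overrightarrow{01})$; writing its image in the abelianization additively as $a\,x_n+\sum_{k=0}^{p^n-1}K^{(n)}(\xi_m^j)(\sigma)(k)\,y_{n,k}$ ($a$ and the coefficients in $\mathbb{Z}_p$), the rule $K(\xi_m^j)(\sigma)(k+p^n\mathbb{Z}_p):=K^{(n)}(\xi_m^j)(\sigma)(k)$ defines a $\mathbb{Z}_p$-valued measure $K(\xi_m^j)(\sigma)$ on $\mathbb{Z}_p$. We write $K(\xi_m^{-i})(\sigma):=K(\xi_m^{m-i})(\sigma)$ (built from $\beta_{m-i}$). $\chi:G_{\mathbb{Q}(\mu_m)}\to\mathbb{Z}_p^\times$ is the $p$-adic cyclotomic character. For a measure $\nu$, $\iota(\nu)$ is the measure $U\mapsto-\nu(-U)$, and for $c\in\mathbb{Z}_p^\times$, $\nu\circ c^{-1}$ is $U\mapsto\nu(c^{-1}U)$. $E_1$ is the measure with $E_1(k+p^n\mathbb{Z}_p)=k/p^n-1/2$ for $0\le k<p^n$, and $E_{1,c}:=E_1-c\,E_1\circ c^{-1}$. For a nonzero rational $r=a/b$ ($\gcd(b,m)=1$), $[r]_m$ is the unique integer with $0\le[r]_m<m$, $b[r]_m\equiv a\pmod m$.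 Define integers $k_\alpha(i)$ by $p\,[ip^{-r}]_m=[ip^{-(r-1)}]_m+k_{r-1}(i)\,m$ ($r\ge1$); for $0\le a<p^n$ let $\delta_n(a)=-1$ if $a\ge1+\sum_{\alpha=0}^{n-1}(p-1-k_\alpha(i))p^\alpha$ and $0$ otherwise; $\mu(\frac{i}{m})$ is the measure with $\mu(\frac{i}{m})(a+p^n\mathbb{Z}_p)=\frac{[ip^{-n}]_m}{m}+\delta_n(a)$, and $\mu_c(\frac{i}{m}):=\mu(\frac{i}{m})-c\,\mu(\frac{i}{m})\circ c^{-1}$. *)

theory Defs
  imports
    "HOL-Complex_Analysis.Complex_Analysis"
    "HOL-Computational_Algebra.Fraction_Field"
    "HOL-Algebra.Generated_Groups"
    "Berlekamp_Zassenhaus.Finite_Field"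
begin

section \<open>The \<open>p\<close>-adic integers and numbers, \<open>p = CARD('p)\<close>\<close>

text \<open>
  A \<open>p\<close>-adic integer is the sequence of its residues modulo \<open>p ^ n\<close>. The prime is
  \<open>CARD('p)\<close> for a type of class \<^class>\<open>prime_card\<close>. The field of \<open>p\<close>-adic numbers is
  the fraction field \<open>'p zp fract\<close>.
\<close>

typedef (overloaded) ('p :: prime_card) zp =
  "{x :: nat \<Rightarrow> int. \<forall>n. x n mod int CARD('p) ^ n = x n \<and> x (Suc n) mod int CARD('p) ^ n = x n}"
  morphisms zp_mod Abs_zp
  by (rule exI[of _ "\<lambda>_. 0"]) simp

setup_lifting type_definition_zp

lemma zp_mod_mod: "zp_mod x n mod int CARD('p) ^ n = zp_mod x n"
  for x :: "'p::prime_card zp"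
  using zp_mod[of x] by simp

lemma zp_mod_Suc: "zp_mod x (Suc n) mod int CARD('p) ^ n = zp_mod x n"
  for x :: "'p::prime_card zp"
  using zp_mod[of x] by simp

lemma mod_power_Suc_mod: "(a :: int) mod q ^ Suc n mod q ^ n = a mod q ^ n"
  by (rule mod_mod_cancel) simp

instantiation zp :: (prime_card) comm_ring_1
begin

lift_definition zero_zp :: "'a zp" is "\<lambda>_. 0" by simp
lift_definition one_zp :: "'a zp" is "\<lambda>n. 1 mod int CARD('a) ^ n"
  by (simp only: mod_power_Suc_mod mod_mod_trivial)
lift_definition plus_zp :: "'a zp \<Rightarrow> 'a zp \<Rightarrow> 'a zp"
  is "\<lambda>x y n. (x n + y n) mod int CARD('a) ^ n"
  by (simp only: mod_power_Suc_mod mod_mod_trivial) (metis mod_add_eq)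
lift_definition uminus_zp :: "'a zp \<Rightarrow> 'a zp"
  is "\<lambda>x n. (- x n) mod int CARD('a) ^ n"
  by (simp only: mod_power_Suc_mod mod_mod_trivial) (metis mod_minus_eq)
lift_definition minus_zp :: "'a zp \<Rightarrow> 'a zp \<Rightarrow> 'a zp"
  is "\<lambda>x y n. (x n - y n) mod int CARD('a) ^ n"
  by (simp only: mod_power_Suc_mod mod_mod_trivial) (metis mod_diff_eq)
lift_definition times_zp :: "'a zp \<Rightarrow> 'a zp \<Rightarrow> 'a zp"
  is "\<lambda>x y n. (x n * y n) mod int CARD('a) ^ n"
  by (simp only: mod_power_Suc_mod mod_mod_trivial) (metis mod_mult_eq)

instance
proof
  fix a b c :: "'a zp"
  show "a * b * c = a * (b * c)"
    by transfer (simp add: mod_simps mult.assoc)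
  show "a * b = b * a"
    by transfer (simp add: mult.commute)
  show "1 * a = a"
    by transfer (simp add: mod_simps)
  show "a + b + c = a + (b + c)"
    by transfer (simp add: mod_simps add.assoc)
  show "a + b = b + a"
    by transfer (simp add: add.commute)
  show "0 + a = a"
    by transfer simp
  show "- a + a = 0"
    by transfer (simp add: mod_simps)
  show "a - b = a + - b"
    by transfer (simp add: mod_simps)
  show "(a + b) * c = a * c + b * c"
    by transfer (simp add: mod_simps distrib_right)
  show "(0 :: 'a zp) \<noteq> 1"
  proof
    assume "(0 :: 'a zp) = 1"
    then have "zp_mod (0 :: 'a zp) 1 = zp_mod (1 :: 'a zp) 1" by simp
    moreover have "int CARD('a) > 1"
      using prime_card[where 'a = 'a] prime_gt_1_nat by auto
    ultimately show False
      by (simp add: zero_zp.rep_eq one_zp.rep_eq)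
  qed
qed

end

lemma zp_mod_mod_le:
  fixes x :: "'p::prime_card zp"
  shows "n \<le> N \<Longrightarrow> zp_mod x N mod int CARD('p) ^ n = zp_mod x n"
proof (induction N rule: dec_induct)
  case base
  show ?case by (rule zp_mod_mod)
next
  case (step N)
  have "zp_mod x (Suc N) mod int CARD('p) ^ n
      = zp_mod x (Suc N) mod int CARD('p) ^ N mod int CARD('p) ^ n"
    using step.hyps by (simp add: mod_mod_cancel le_imp_power_dvd)
  then show ?case using step.IH by (simp add: zp_mod_Suc)
qed

instance zp :: (prime_card) idom
proof
  fix a b :: "'a zp"
  assume "a \<noteq> 0" "b \<noteq> 0"
  then obtain i j where i: "zp_mod a i \<noteq> 0" and j: "zp_mod b j \<noteq> 0"
    by (metis zero_zp.rep_eq zp_mod_inject ext)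
  let ?q = "int CARD('a)" and ?N = "i + j"
  have q: "prime_elem ?q"
    using prime_card_int[where 'a = 'a] by (rule prime_imp_prime_elem)
  have a: "\<not> ?q ^ i dvd zp_mod a ?N"
    using i zp_mod_mod_le[of i ?N a] by auto
  have b: "\<not> ?q ^ j dvd zp_mod b ?N"
    using j zp_mod_mod_le[of j ?N b] by auto
  have ij: "i > 0" "j > 0"
    using a b by (auto intro: gr0I)
  show "a * b \<noteq> 0"
  proof
    assume "a * b = 0"
    then have "zp_mod (a * b) ?N = 0"
      by (simp add: zero_zp.rep_eq)
    then have "?q ^ ?N dvd zp_mod a ?N * zp_mod b ?N"
      by (simp add: times_zp.rep_eq dvd_eq_mod_eq_0)
    moreover have "i + j = Suc (i + j - 1)"
      using ij by simp
    ultimately show False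
      using prime_elem_power_dvd_cases[OF _ _ q, of "i + j - 1" "zp_mod a ?N" "zp_mod b ?N" i j] a b ij
      by (metis dvd_trans le_imp_power_dvd diff_le_self)
  qed
qed

abbreviation zp_to_qp :: "'p::prime_card zp \<Rightarrow> 'p zp fract" where
  "zp_to_qp x \<equiv> Fract x 1"

text \<open>The residue class \<open>k + p\<^sup>n \<int>\<^sub>p\<close>.\<close>
definition zp_ball :: "nat \<Rightarrow> nat \<Rightarrow> 'p::prime_card zp set" where
  "zp_ball n k = {x. zp_mod x n = int k mod int CARD('p) ^ n}"


section \<open>Measures on the \<open>p\<close>-adic integers\<close>

text \<open>
  A measure is a finitely additive function on the compact open subsets of \<open>\<int>\<^sub>p\<close>, i.e.
  on the finite unions of residue classes modulo some \<open>p\<^sup>n\<close>; its values on other sets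
  are irrelevant.
\<close>

definition of_level :: "nat \<Rightarrow> 'p::prime_card zp set \<Rightarrow> bool" where
  "of_level n U \<longleftrightarrow> (\<forall>x y. zp_mod x n = zp_mod y n \<longrightarrow> (x \<in> U \<longleftrightarrow> y \<in> U))"

definition compact_open :: "'p::prime_card zp set \<Rightarrow> bool" where
  "compact_open U \<longleftrightarrow> (\<exists>n. of_level n U)"

definition zp_measure :: "('p::prime_card zp set \<Rightarrow> 'b::ab_group_add) \<Rightarrow> bool" where
  "zp_measure \<nu> \<longleftrightarrow> (\<forall>U V. compact_open U \<longrightarrow> compact_open V \<longrightarrow> U \<inter> V = {} \<longrightarrow>
     \<nu> (U \<union> V) = \<nu> U + \<nu> V)"

text \<open>
  The measure with prescribed values \<open>w n k\<close> on \<open>k + p\<^sup>n \<int>\<^sub>p\<close>, \<open>0 \<le> k < p\<^sup>n\<close>. When these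
  values satisfy the distribution relation, any level of \<open>U\<close> gives the same sum.
\<close>
definition measure_from_balls ::
  "(nat \<Rightarrow> nat \<Rightarrow> 'b::ab_group_add) \<Rightarrow> 'p::prime_card zp set \<Rightarrow> 'b" where
  "measure_from_balls w U =
     (let n = (LEAST n. of_level n U)
      in \<Sum>k\<in>{k. k < CARD('p) ^ n \<and> (zp_ball n k :: 'p zp set) \<subseteq> U}. w n k)"

definition iota ::
  "('p::prime_card zp set \<Rightarrow> 'b::ab_group_add) \<Rightarrow> 'p zp set \<Rightarrow> 'b" where
  "iota \<nu> U = - \<nu> (uminus ` U)"

text \<open>\<open>\<nu> \<circ> c\<inverse>\<close> for a unit \<open>c\<close>; the set below is \<open>c\<inverse> U\<close>.\<close>
definition comp_inverse ::
  "('p::prime_card zp set \<Rightarrow> 'b) \<Rightarrow> 'p zp \<Rightarrow> 'p zp set \<Rightarrow> 'b" where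
  "comp_inverse \<nu> c U = \<nu> {x. c * x \<in> U}"

text \<open>The passage from \<open>E\<^sub>1\<close> to \<open>E\<^bsub>1,c\<^esub>\<close> and from \<open>\<mu>\<close> to \<open>\<mu>\<^sub>c\<close>.\<close>
definition regularize ::
  "'p zp \<Rightarrow> ('p::prime_card zp set \<Rightarrow> 'p zp fract) \<Rightarrow> 'p zp set \<Rightarrow> 'p zp fract" where
  "regularize c \<nu> U = \<nu> U - zp_to_qp c * comp_inverse \<nu> c U"

definition E1 :: "'p::prime_card zp set \<Rightarrow> 'p zp fract" where
  "E1 = measure_from_balls (\<lambda>n k. of_nat k / of_nat (CARD('p) ^ n) - 1 / 2)"

text \<open>\<open>[a / b]\<^sub>m\<close>\<close>
definition residue_mod :: "nat \<Rightarrow> nat \<Rightarrow> nat \<Rightarrow> nat" where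
  "residue_mod m a b = (THE x. x < m \<and> [b * x = a] (mod m))"

text \<open>\<open>k\<^sub>\<alpha>(i)\<close>, defined by \<open>p [i p^(-\<alpha>-1)]\<^sub>m = [i p^(-\<alpha>)]\<^sub>m + k\<^sub>\<alpha>(i) m\<close>\<close>
definition mu_digit :: "nat \<Rightarrow> nat \<Rightarrow> nat \<Rightarrow> nat \<Rightarrow> int" where
  "mu_digit p m i \<alpha> =
     (THE k. int (p * residue_mod m i (p ^ Suc \<alpha>)) = int (residue_mod m i (p ^ \<alpha>)) + k * int m)"

definition mu_delta :: "nat \<Rightarrow> nat \<Rightarrow> nat \<Rightarrow> nat \<Rightarrow> nat \<Rightarrow> int" where
  "mu_delta p m i n a =
     (if int a \<ge> 1 + (\<Sum>\<alpha><n. (int p - 1 - mu_digit p m i \<alpha>) * int p ^ \<alpha>) then -1 else 0)"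

definition mu :: "nat \<Rightarrow> nat \<Rightarrow> 'p::prime_card zp set \<Rightarrow> 'p zp fract" where
  "mu m i = measure_from_balls (\<lambda>n a.
     of_nat (residue_mod m i (CARD('p) ^ n)) / of_nat m + of_int (mu_delta CARD('p) m i n a))"


section \<open>The Galois group of \<open>\<rat>(\<mu>\<^sub>m)\<close>\<close>

definition root_unity :: "nat \<Rightarrow> complex" where
  "root_unity r = exp (2 * of_real pi * \<i> / of_nat r)"

definition qbar :: "complex set" where
  "qbar = {z. algebraic z}"

text \<open>
  \<open>Gal(Qbar / \<rat>(\<mu>\<^sub>m))\<close>; only the values of the functions on the algebraic numbers matter.
\<close>
definition galois_cyclotomic :: "nat \<Rightarrow> (complex \<Rightarrow> complex) set" where
  "galois_cyclotomic m = {\<sigma>. bij_betw \<sigma> qbar qbar \<and>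
     (\<forall>x\<in>qbar. \<forall>y\<in>qbar. \<sigma> (x + y) = \<sigma> x + \<sigma> y \<and> \<sigma> (x * y) = \<sigma> x * \<sigma> y) \<and>
     \<sigma> (root_unity m) = root_unity m}"

definition cyclotomic_char :: "(complex \<Rightarrow> complex) \<Rightarrow> 'p::prime_card zp" where
  "cyclotomic_char \<sigma> = (THE c. \<forall>n. \<sigma> (root_unity (CARD('p) ^ n))
     = root_unity (CARD('p) ^ n) ^ nat (zp_mod c n))"


section \<open>Pro-\<open>p\<close> covers of \<open>V\<^sub>n\<close> and fibre functors\<close>

text \<open>
  A connected finite etale cover of \<open>V\<^sub>n\<close> is given by its function field, a finite
  extension \<open>L = Qbar(z)[w]/(f)\<close> of \<open>Qbar(z)\<close> that is unramified over \<open>V\<^sub>n\<close>, presented by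
  a primitive element \<open>w\<close> integral over \<open>Qbar[z]\<close>. So a cover is a monic irreducible
  polynomial \<open>f\<close> in \<open>w\<close> with coefficients in \<open>Qbar[z]\<close>. Every connected cover arises in
  this way. (For polynomials over \<open>Qbar\<close>, irreducibility over \<open>Qbar\<close> and over \<open>\<complex>\<close> agree.)

  The points of the cover above a point \<open>v\<close> of \<open>V\<^sub>n\<close> are the \<open>Qbar(z)\<close>-embeddings of \<open>L\<close>
  into \<open>Qbar((z - v))\<close>, i.e. the roots of \<open>f\<close> in \<open>Qbar[[z - v]]\<close>; the fibre functor of the
  tangential base point \<open>01\<close> uses the field of Puiseux series \<open>\<Union>\<^sub>N Qbar((z^(1/N)))\<close>.
\<close>

datatype basepoint = At complex | Tangent01

text \<open>
  Series at \<open>At v\<close> are written in \<open>t = z - v\<close>. Series at the tangential base point of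
  precision \<open>N\<close> are written in \<open>t = z^(1/N)\<close>, where \<open>z^(1/N)\<close> is positive on the positive
  real axis.
\<close>
definition coordinate :: "basepoint \<Rightarrow> nat \<Rightarrow> complex fps" where
  "coordinate b N = (case b of At v \<Rightarrow> fps_const v + fps_X | Tangent01 \<Rightarrow> fps_X ^ N)"

definition expand_coeff :: "basepoint \<Rightarrow> nat \<Rightarrow> complex poly \<Rightarrow> complex fps" where
  "expand_coeff b N c = poly (map_poly fps_const c) (coordinate b N)"

definition expand_eval :: "basepoint \<Rightarrow> nat \<Rightarrow> complex poly poly \<Rightarrow> complex fps \<Rightarrow> complex fps" where
  "expand_eval b N h \<rho> = poly (map_poly (expand_coeff b N) h) \<rho>"

text \<open>Passage from precision \<open>N\<close> to precision \<open>N * M\<close>.\<close>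
definition refine_series :: "basepoint \<Rightarrow> nat \<Rightarrow> complex fps \<Rightarrow> complex fps" where
  "refine_series b M \<rho> = (case b of At v \<Rightarrow> \<rho> | Tangent01 \<Rightarrow> \<rho> oo fps_X ^ M)"

definition poly_qbar :: "complex poly \<Rightarrow> bool" where
  "poly_qbar c \<longleftrightarrow> (\<forall>l. poly.coeff c l \<in> qbar)"

definition poly2_qbar :: "complex poly poly \<Rightarrow> bool" where
  "poly2_qbar h \<longleftrightarrow> (\<forall>l. poly_qbar (poly.coeff h l))"

text \<open>
  For a cover with Galois closure of \<open>p\<close>-power degree, the ramification indices over \<open>0\<close>
  are powers of \<open>p\<close> and divide \<open>degree f\<close>, itself a power of \<open>p\<close>; so the precision
  \<open>degree f\<close> is enough to see all Puiseux roots.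
\<close>
definition fibre :: "basepoint \<Rightarrow> complex poly poly \<Rightarrow> complex fps set" where
  "fibre b f = {\<rho>. (\<forall>l. fps_nth \<rho> l \<in> qbar) \<and> expand_eval b (degree f) f \<rho> = 0}"

definition V_points :: "nat \<Rightarrow> nat \<Rightarrow> complex set" where
  "V_points p n = {v \<in> qbar. v \<noteq> 0 \<and> v ^ (p ^ n) \<noteq> 1}"

text \<open>
  The ring generated over \<open>Qbar[z]\<close> by the roots of \<open>f\<close> at \<open>v\<close>. Its field of fractions is
  the Galois closure of \<open>L\<close>, whose automorphisms over \<open>Qbar(z)\<close> restrict to the ring.
\<close>
inductive_set splitting_ring :: "complex \<Rightarrow> complex poly poly \<Rightarrow> complex fps set"
  for v :: complex and f :: "complex poly poly" where
  "poly_qbar c \<Longrightarrow> expand_coeff (At v) 1 c \<in> splitting_ring v f"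
| "\<rho> \<in> fibre (At v) f \<Longrightarrow> \<rho> \<in> splitting_ring v f"
| "x \<in> splitting_ring v f \<Longrightarrow> y \<in> splitting_ring v f \<Longrightarrow> x + y \<in> splitting_ring v f"
| "x \<in> splitting_ring v f \<Longrightarrow> y \<in> splitting_ring v f \<Longrightarrow> x * y \<in> splitting_ring v f"

definition closure_galois_group ::
  "complex \<Rightarrow> complex poly poly \<Rightarrow> (complex fps \<Rightarrow> complex fps) set" where
  "closure_galois_group v f = {\<phi> \<in> extensional (splitting_ring v f).
     bij_betw \<phi> (splitting_ring v f) (splitting_ring v f) \<and>
     (\<forall>x\<in>splitting_ring v f. \<forall>y\<in>splitting_ring v f.
        \<phi> (x + y) = \<phi> x + \<phi> y \<and> \<phi> (x * y) = \<phi> x * \<phi> y) \<and>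
     (\<forall>c. poly_qbar c \<longrightarrow> \<phi> (expand_coeff (At v) 1 c) = expand_coeff (At v) 1 c)}"

text \<open>
  Connected finite etale covers of \<open>V\<^sub>n\<close> with Galois closure of \<open>p\<close>-power degree.
  Unramified over \<open>v\<close> means that \<open>f\<close> splits completely in \<open>Qbar[[z - v]]\<close>.
\<close>
definition covers :: "nat \<Rightarrow> nat \<Rightarrow> complex poly poly set" where
  "covers p n = {f. poly2_qbar f \<and> lead_coeff f = 1 \<and> irreducible f \<and>
     (\<forall>v\<in>V_points p n. card (fibre (At v) f) = degree f) \<and>
     (\<exists>v\<in>V_points p n. \<exists>e. card (closure_galois_group v f) = p ^ e)}"


section \<open>Pro-\<open>p\<close> etale paths\<close>

text \<open>
  A morphism from the cover \<open>g\<close> to the cover \<open>f\<close> is an embedding of the function field of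
  \<open>f\<close> into that of \<open>g\<close>, sending the primitive element of \<open>f\<close> to \<open>h(z, w) / d(z)\<close>. The
  following says that it maps the point \<open>\<rho>\<close> of \<open>g\<close> to the point \<open>\<rho>'\<close> of \<open>f\<close>, i.e.
  \<open>d(z) \<rho>' = h(z, \<rho>)\<close>; both sides are written with the common precision
  \<open>degree g * degree f\<close>. As \<open>g\<close> is irreducible, if this holds for one \<open>\<rho>\<close> and \<open>\<rho>'\<close> then
  \<open>(d, h)\<close> does define a morphism.
\<close>
definition morphism_maps :: "basepoint \<Rightarrow> complex poly poly \<Rightarrow> complex poly poly \<Rightarrow>
    complex poly \<Rightarrow> complex poly poly \<Rightarrow> complex fps \<Rightarrow> complex fps \<Rightarrow> bool" where
  "morphism_maps b g f d h \<rho> \<rho>' \<longleftrightarrow>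
     expand_coeff b (degree g * degree f) d * refine_series b (degree g) \<rho>'
       = expand_eval b (degree g * degree f) h (refine_series b (degree f) \<rho>)"

type_synonym path_family = "complex poly poly \<Rightarrow> complex fps \<Rightarrow> complex fps"

text \<open>Isomorphisms from the fibre functor at \<open>b\<close> to the fibre functor at \<open>c\<close>.\<close>
definition etale_paths :: "nat \<Rightarrow> nat \<Rightarrow> basepoint \<Rightarrow> basepoint \<Rightarrow> path_family set" where
  "etale_paths p n b c = {\<gamma> \<in> extensional (covers p n).
     (\<forall>f\<in>covers p n. \<gamma> f \<in> extensional (fibre b f) \<and>
        bij_betw (\<gamma> f) (fibre b f) (fibre c f)) \<and>
     (\<forall>f\<in>covers p n. \<forall>g\<in>covers p n. \<forall>d h. d \<noteq> 0 \<longrightarrow> poly_qbar d \<longrightarrow> poly2_qbar h \<longrightarrow>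
        (\<forall>\<rho>\<in>fibre b g. \<forall>\<rho>'\<in>fibre b f.
           morphism_maps b g f d h \<rho> \<rho>' \<longleftrightarrow> morphism_maps c g f d h (\<gamma> g \<rho>) (\<gamma> f \<rho>')))}"

text \<open>\<open>\<gamma> \<cdot> \<delta>\<close>: first \<open>\<delta>\<close>, which starts at \<open>b\<close>, then \<open>\<gamma>\<close>.\<close>
definition path_comp :: "nat \<Rightarrow> nat \<Rightarrow> basepoint \<Rightarrow> path_family \<Rightarrow> path_family \<Rightarrow> path_family" where
  "path_comp p n b \<gamma> \<delta> = (\<lambda>f\<in>covers p n. compose (fibre b f) (\<gamma> f) (\<delta> f))"

definition path_inverse ::
  "nat \<Rightarrow> nat \<Rightarrow> basepoint \<Rightarrow> basepoint \<Rightarrow> path_family \<Rightarrow> path_family" where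
  "path_inverse p n b c \<gamma> =
     (\<lambda>f\<in>covers p n. \<lambda>\<rho>\<in>fibre c f. inv_into (fibre b f) (\<gamma> f) \<rho>)"

definition pi1 :: "nat \<Rightarrow> nat \<Rightarrow> path_family monoid" where
  "pi1 p n = \<lparr>carrier = etale_paths p n Tangent01 Tangent01,
     mult = path_comp p n Tangent01,
     one = (\<lambda>f\<in>covers p n. \<lambda>\<rho>\<in>fibre Tangent01 f. \<rho>)\<rparr>"

text \<open>
  \<open>\<sigma>(\<gamma>) = \<sigma> \<circ> \<gamma> \<circ> \<sigma>\<inverse>\<close> for a path \<open>\<gamma>\<close> between base points fixed by \<open>\<sigma>\<close>. Here \<open>\<sigma>\<close> acts on the
  coefficients of covers and of (Puiseux) series, and fixes \<open>z^(1/N)\<close>.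
\<close>
definition fps_act :: "(complex \<Rightarrow> complex) \<Rightarrow> complex fps \<Rightarrow> complex fps" where
  "fps_act \<sigma> \<rho> = Abs_fps (\<lambda>l. \<sigma> (fps_nth \<rho> l))"

definition galois_act ::
  "nat \<Rightarrow> nat \<Rightarrow> basepoint \<Rightarrow> (complex \<Rightarrow> complex) \<Rightarrow> path_family \<Rightarrow> path_family" where
  "galois_act p n b \<sigma> \<gamma> = (let \<sigma>' = inv_into qbar \<sigma> in
     (\<lambda>f\<in>covers p n. \<lambda>\<rho>\<in>fibre b f.
        fps_act \<sigma> (\<gamma> (map_poly (map_poly \<sigma>') f) (fps_act \<sigma>' \<rho>))))"

text \<open>
  \<open>\<gamma>\<^sup>a\<close> for \<open>\<gamma>\<close> in the fundamental group and a \<open>p\<close>-adic integer \<open>a\<close>: the limit of the powers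
  \<open>\<gamma> ^ (a mod p ^ N)\<close>, which are eventually constant on each cover.
\<close>
definition padic_power ::
  "nat \<Rightarrow> path_family \<Rightarrow> 'p::prime_card zp \<Rightarrow> path_family" where
  "padic_power n \<gamma> a = (\<lambda>f\<in>covers CARD('p) n.
     THE \<phi>. \<exists>N0. \<forall>N\<ge>N0. \<phi> = (\<gamma> [^]\<^bsub>pi1 CARD('p) n\<^esub> nat (zp_mod a N)) f)"

text \<open>Closure for the profinite topology of the fundamental group.\<close>
definition pi1_closure :: "nat \<Rightarrow> nat \<Rightarrow> path_family set \<Rightarrow> path_family set" where
  "pi1_closure p n S = {\<gamma> \<in> carrier (pi1 p n).
     \<forall>F. finite F \<longrightarrow> F \<subseteq> covers p n \<longrightarrow> (\<exists>\<delta>\<in>S. \<forall>f\<in>F. \<gamma> f = \<delta> f)}"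


section \<open>Topological paths\<close>

text \<open>
  The function \<open>\<rho>(z^(1/N))\<close>, continued from \<open>01\<close> along a small arc of angle \<open>\<theta>\<close> around \<open>0\<close> and
  then along the ray of direction \<open>\<theta>\<close>, evaluated at distance \<open>r < 1\<close> from \<open>0\<close>. For \<open>\<rho>\<close> in the
  fibre of a cover of \<open>V\<^sub>n\<close> the power series \<open>\<rho>\<close> converges in the open unit disc, because
  \<open>V\<^sub>n\<close> contains all \<open>z\<close> with \<open>0 < \<bar>z\<bar> < 1\<close>, and so is its own analytic continuation there.
\<close>
definition radial_value :: "nat \<Rightarrow> complex fps \<Rightarrow> real \<Rightarrow> real \<Rightarrow> complex" where
  "radial_value N \<rho> \<theta> r = eval_fps \<rho> (of_real (root N r) * cis (\<theta> / real N))"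

text \<open>The loop \<open>x\<^sub>n\<close> around \<open>0\<close>: \<open>z^(1/N)\<close> becomes \<open>\<xi>\<^sub>N z^(1/N)\<close>.\<close>
definition loop_x :: "nat \<Rightarrow> nat \<Rightarrow> path_family" where
  "loop_x p n = (\<lambda>f\<in>covers p n. \<lambda>\<rho>\<in>fibre Tangent01 f.
     Abs_fps (\<lambda>l. root_unity (degree f) ^ l * fps_nth \<rho> l))"

text \<open>
  The loop \<open>y\<^bsub>n,k\<^esub>\<close>: from \<open>01\<close> by an arc in the positive sense near \<open>0\<close> and then radially to a
  point near \<open>\<zeta> = exp (2 \<pi> \<i> k / p ^ n)\<close>, then once around \<open>\<zeta>\<close> counterclockwise, and back. Near \<open>\<zeta>\<close> we write
  \<open>z = \<zeta> (1 - exp u)\<close>: the radial segment is \<open>u \<in> \<real>\<close>, and going around \<open>\<zeta>\<close> increases \<open>u\<close> by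
  \<open>2 \<pi> \<i>\<close>. The function \<open>G\<close> is the continuation of \<open>\<rho>\<close> to the universal cover of a punctured disc
  of radius \<open>\<epsilon>\<close> around \<open>\<zeta>\<close>.
\<close>
definition loop_y :: "nat \<Rightarrow> nat \<Rightarrow> nat \<Rightarrow> path_family" where
  "loop_y p n k = (\<lambda>f\<in>covers p n. \<lambda>\<rho>\<in>fibre Tangent01 f.
     THE \<rho>'. \<rho>' \<in> fibre Tangent01 f \<and>
       (\<exists>\<epsilon> G. 0 < \<epsilon> \<and> \<epsilon> < 1 \<and> G holomorphic_on {u. Re u < ln \<epsilon>} \<and>
          (\<forall>r. 0 < r \<longrightarrow> r < \<epsilon> \<longrightarrow>
             radial_value (degree f) \<rho> (2 * pi * real k / real (p ^ n)) (1 - r)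
               = G (of_real (ln r)) \<and>
             radial_value (degree f) \<rho>' (2 * pi * real k / real (p ^ n)) (1 - r)
               = G (of_real (ln r) + 2 * of_real pi * \<i>))))"

text \<open>
  The path \<open>\<alpha>\<^sub>j\<close> on \<open>V\<^sub>0\<close> from \<open>01\<close> to \<open>\<xi>\<^sub>m\<^sup>j\<close>: the arc of angle \<open>2 \<pi> j / m\<close> followed by the segment
  \<open>r \<xi>\<^sub>m\<^sup>j\<close>; the two series agree on its final part.
\<close>
definition path_alpha :: "nat \<Rightarrow> nat \<Rightarrow> nat \<Rightarrow> path_family" where
  "path_alpha p m j = (\<lambda>f\<in>covers p 0. \<lambda>\<rho>\<in>fibre Tangent01 f.
     THE \<rho>'. \<rho>' \<in> fibre (At (root_unity m ^ j)) f \<and> fps_conv_radius \<rho>' > 0 \<and>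
       (\<exists>\<epsilon>>0. \<forall>r. 1 - \<epsilon> < r \<longrightarrow> 0 < r \<longrightarrow> r < 1 \<longrightarrow>
          radial_value (degree f) \<rho> (2 * pi * real j / real m) r
            = eval_fps \<rho>' ((of_real r - 1) * root_unity m ^ j)))"

text \<open>\<open>\<beta>\<^sub>j = \<alpha>\<^sub>j \<cdot> x^(-j/m)\<close>; the type argument only fixes the prime.\<close>
definition path_beta :: "'p::prime_card itself \<Rightarrow> nat \<Rightarrow> nat \<Rightarrow> path_family" where
  "path_beta _ m j = path_comp CARD('p) 0 Tangent01 (path_alpha CARD('p) m j)
     (padic_power 0 (loop_x CARD('p) 0) (THE c :: 'p zp. of_nat m * c = - of_nat j))"

text \<open>
  \<open>\<delta>\<close>, a path on \<open>V\<^sub>n\<close> from \<open>01\<close> to \<open>u\<close>, is a lift of the path \<open>\<gamma>\<close> on \<open>V\<^sub>0\<close> from \<open>01\<close> to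
  \<open>v = u ^ (p ^ n)\<close>: for every cover \<open>g\<close> of \<open>V\<^sub>0\<close> and every connected component \<open>f\<close> of its
  pullback along \<open>q : z \<mapsto> z ^ (p ^ n)\<close>, if the point \<open>\<rho>\<close> of \<open>f\<close> above \<open>01\<close> lies over the point \<open>\<eta>\<close>
  of \<open>g\<close>, that is, \<open>\<rho> = \<eta> \<circ> q\<close>, then \<open>\<delta>(\<rho>) = \<gamma>(\<eta>) \<circ> q\<close>. In the hypothesis \<open>t = z^(1/(NM))\<close> with \<open>N\<close> and \<open>M\<close> the
  degrees of \<open>f\<close> and \<open>g\<close>, and \<open>\<eta>\<close> is a series in \<open>(z ^ (p ^ n))^(1/M) = t ^ (p ^ n * N)\<close>.
\<close>
definition is_lift ::
  "nat \<Rightarrow> nat \<Rightarrow> complex \<Rightarrow> path_family \<Rightarrow> path_family \<Rightarrow> bool" where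
  "is_lift p n u \<gamma> \<delta> \<longleftrightarrow> \<delta> \<in> etale_paths p n Tangent01 (At u) \<and>
     (\<forall>g\<in>covers p 0. \<forall>f\<in>covers p n. \<forall>\<eta>\<in>fibre Tangent01 g. \<forall>\<rho>\<in>fibre Tangent01 f.
        \<rho> oo fps_X ^ degree g = \<eta> oo fps_X ^ (p ^ n * degree f) \<longrightarrow>
        \<delta> f \<rho> = \<gamma> g \<eta> oo ((fps_const u + fps_X) ^ (p ^ n) - fps_const (u ^ (p ^ n))))"


section \<open>The measures \<open>K(\<xi>\<^sub>m\<^sup>j)(\<sigma>)\<close>\<close>

text \<open>
  The image of \<open>g\<close> in the abelianization of the pro-\<open>p\<close> fundamental group, the quotient by
  the closed commutator subgroup, is \<open>a x\<^sub>n + \<Sum>\<^sub>k \<kappa>\<^sub>k y\<^bsub>n,k\<^esub>\<close>.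
\<close>
definition abelian_image_eq ::
  "nat \<Rightarrow> path_family \<Rightarrow> 'p::prime_card zp \<Rightarrow> (nat \<Rightarrow> 'p zp) \<Rightarrow> bool" where
  "abelian_image_eq n g a \<kappa> \<longleftrightarrow>
     (let p = CARD('p); G = pi1 p n in
      g \<in> carrier G \<and>
      (\<exists>c\<in>pi1_closure p n (derived G (carrier G)).
         g = padic_power n (loop_x p n) a \<otimes>\<^bsub>G\<^esub>
             foldr (\<lambda>k s. padic_power n (loop_y p n k) (\<kappa> k) \<otimes>\<^bsub>G\<^esub> s) [0..<p ^ n] \<one>\<^bsub>G\<^esub> \<otimes>\<^bsub>G\<^esub> c))"

text \<open>
  \<open>\<nu>\<close> is the measure \<open>K(\<xi>\<^sub>m\<^sup>j)(\<sigma>)\<close>. The lift of \<open>\<beta>\<^sub>j\<close> is unique, and so are the coefficients, since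
  the fundamental group of \<open>V\<^sub>n\<close> is free pro-\<open>p\<close> on \<open>x\<^sub>n\<close> and the \<open>y\<^bsub>n,k\<^esub>\<close>; hence exactly one
  measure \<open>\<nu>\<close> (up to its values on sets that are not compact open) has this property.
\<close>
definition is_K :: "nat \<Rightarrow> nat \<Rightarrow> (complex \<Rightarrow> complex) \<Rightarrow> ('p::prime_card zp set \<Rightarrow> 'p zp) \<Rightarrow> bool" where
  "is_K m j \<sigma> \<nu> \<longleftrightarrow> zp_measure \<nu> \<and>
     (\<forall>n. let p = CARD('p); u = root_unity m ^ residue_mod m j (p ^ n) in
        \<exists>\<beta>. is_lift p n u (path_beta TYPE('p) m j) \<beta> \<and>
          (\<exists>a. abelian_image_eq n
             (path_comp p n Tangent01 (path_inverse p n Tangent01 (At u) \<beta>)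
                (galois_act p n Tangent01 \<sigma> \<beta>))
             a (\<lambda>k. \<nu> (zp_ball n k))))"

end

theory Submission
  imports
    Defs
    "HOL-Algebra.Sylow"
    "HOL-Algebra.Multiplicative_Group"
    "HOL-Computational_Algebra.Fundamental_Theorem_Algebra"
    "HOL-Number_Theory.Cong"
begin

text \<open>
  The coefficient of \<open>y\<^bsub>n,k\<^esub>\<close> modulo \<open>P = p\<^sup>N\<close> is read off from the action on the Kummer cover
  \<open>w\<^sup>P = 1 - \<xi>\<^sup>-\<^sup>k z\<close> of \<open>V\<^sub>n\<close>, where \<open>\<xi>\<close> is the standard root of unity of order \<open>p\<^sup>n\<close>: all loops commute with
  the scalars \<open>\<mu>\<^sub>P\<close>, hence commutators act trivially, and so do \<open>x\<^sub>n\<close> and the other \<open>y\<^bsub>n,l\<^esub>\<close>, whereas \<open>y\<^bsub>n,k\<^esub>\<close> acts by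
  \<open>\<xi>\<^sub>P\<close>. The lift of \<open>\<beta>\<^sub>j\<close> takes the series \<open>(1 - \<xi>\<^sup>-\<^sup>k z)\<^bsup>1/P\<^esup>\<close> to the principal root of \<open>1 - \<xi>\<^sup>-\<^sup>k u\<close>, with \<open>u\<close> its
  endpoint, so \<open>\<xi>\<^sub>P\<close> to the power \<open>K(k)\<close> compares that root with the \<open>\<sigma>\<close>-image of the root for \<open>\<chi>(\<sigma>)\<^sup>-\<^sup>1 k\<close>.
  For \<open>K(\<xi>\<^sub>m\<^sup>-\<^sup>i)\<close> at \<open>k\<close> and \<open>K(\<xi>\<^sub>m\<^sup>i)\<close> at \<open>-k\<close> the two numbers are complex conjugates \<open>1 - w\<close> with
  \<open>w = exp (\<mp> 2 \<pi> i x)\<close>, \<open>x\<close> the fractional part of \<open>k / p\<^sup>n + [i p\<^sup>-\<^sup>n]\<^sub>m / m\<close>. The quotient of their principal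
  roots is the root of unity \<open>exp (- 2 \<pi> i (x - 1 / 2) / P)\<close>, and \<open>x - 1 / 2\<close> is the value of \<open>E\<^sub>1 + \<mu>(i/m)\<close> at \<open>k\<close>.
\<close>

section \<open>Algebraic numbers and power series with algebraic coefficients\<close>

section \<open>Algebraic numbers\<close>

text \<open>Neither measure can be computed by itself: what \<sigma> does to a principal root of 1 -
  w is not determined by its effect on roots of unity, since \<sigma> respects neither absolute
  values nor branches. The roots for w and for its conjugate have the same absolute value, so their
  quotient is a root of unity; this is why one measure at k has to be paired with the other at -k.
  The regularization comes from comparing this quotient at two classes: if k = \<chi>(\<sigma>) k',
  then \<sigma> carries the quotient at k' to the one at k up to the unknown coefficients, and it
  raises roots of unity of p-power order to the power \<chi>(\<sigma>). With e = E_1 + \<mu>(i/m)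
  the result is e(k) - \<chi>(\<sigma>) e(k'). The order of the quotient involves 2 and m besides p,
  so all identities are multiplied by 2 m p^n and proved modulo p^N p^n. Letting N grow turns them
  into equalities of p-adic integers, and division takes place only in the field of p-adic
  numbers.\<close>

interpretation rat_space: vector_space "\<lambda>(r :: rat) (x :: complex). of_rat r * x"
  by standard (simp_all add: algebra_simps of_rat_add of_rat_mult)

lemma algebraic_power_relation:
  fixes x :: complex
  assumes "algebraic x"
  obtains a r where "0 < a" "x ^ a = (\<Sum>i<a. of_rat (r i) * x ^ i)"
proof -
  obtain p where p: "\<And>i. poly.coeff p i \<in> \<rat>" "p \<noteq> 0" "poly p x = 0"
    using assms unfolding algebraic_altdef by blast
  obtain q where q: "\<And>i. poly.coeff p i = of_rat (q i)"
  proof -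
    have "\<exists>r. poly.coeff p i = of_rat r" for i
      using p(1)[of i] by (auto elim: Rats_cases)
    then have "\<exists>q. \<forall>i. poly.coeff p i = of_rat (q i)"
      by (intro choice allI)
    then show ?thesis using that by blast
  qed
  define a where "a = degree p"
  have a0: "a > 0"
    using p(2,3) unfolding a_def by (auto elim!: degree_eq_zeroE intro!: gr0I)
  have l: "q a \<noteq> 0"
    using p(2) q[of a] by (auto simp: a_def)
  have "0 = (\<Sum>i\<le>a. of_rat (q i) * x ^ i)"
    using p(3) unfolding poly_altdef a_def q by simp
  also have "\<dots> = of_rat (q a) * x ^ a + (\<Sum>i<a. of_rat (q i) * x ^ i)"
    by (simp add: lessThan_Suc_atMost[symmetric])
  finally have "x ^ a = - (\<Sum>i<a. of_rat (q i) * x ^ i) / of_rat (q a)"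
    using l by (simp add: field_simps add_eq_0_iff)
  also have "\<dots> = (\<Sum>i<a. of_rat (- q i / q a) * x ^ i)"
    by (simp add: sum_divide_distrib sum_negf[symmetric] of_rat_divide of_rat_minus)
  finally show ?thesis by (rule that[OF a0])
qed

lemma rat_span_mult_closed:
  fixes z :: complex
  assumes "\<And>w. w \<in> W \<Longrightarrow> z * w \<in> rat_space.span W" "v \<in> rat_space.span W"
  shows "z * v \<in> rat_space.span W"
  using assms(2)
proof (induction rule: rat_space.span_induct_alt)
  case base
  show ?case by (simp add: rat_space.span_zero)
next
  case (step c x y)
  have "z * (of_rat c * x + y) = of_rat c * (z * x) + z * y"
    by (simp add: algebra_simps)
  then show ?case
    using step assms(1) by (simp add: rat_space.span_add rat_space.span_scale)
qed

text \<open>The span contains every power of z, so the first \<open>card W + 1\<close> powers cannot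
  be rationally independent.\<close>

lemma algebraic_if_stable_span:
  fixes z :: complex
  assumes "finite W" "1 \<in> rat_space.span W"
    and st: "\<And>w. w \<in> W \<Longrightarrow> z * w \<in> rat_space.span W"
  shows "algebraic z"
proof -
  note mul = rat_span_mult_closed[OF st]
  have pw: "z ^ l \<in> rat_space.span W" for l
    by (induction l) (use assms mul in auto)
  show ?thesis
  proof (cases "inj_on (\<lambda>l. z ^ l) {..card W}")
    case True
    let ?S = "(\<lambda>l. z ^ l) ` {..card W}"
    have "card ?S = card W + 1"
      using True by (simp add: card_image)
    moreover have "?S \<subseteq> rat_space.span W"
      using pw by auto
    ultimately have "rat_space.dependent ?S"
      using rat_space.independent_span_bound[OF assms(1), of ?S] by fastforce
    then obtain u where u: "(\<Sum>v\<in>?S. of_rat (u v) * v) = 0" "\<exists>v\<in>?S. u v \<noteq> 0"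
      by (subst (asm) rat_space.dependent_finite) auto
    define p where "p = (\<Sum>l\<le>card W. Polynomial.monom (of_rat (u (z ^ l)) :: complex) l)"
    have c: "poly.coeff p l = (if l \<le> card W then of_rat (u (z ^ l)) else 0)" for l
      by (simp add: p_def coeff_sum)
    have "poly p z = 0"
      using u(1) True by (simp add: p_def poly_sum poly_monom sum.reindex)
    moreover have "p \<noteq> 0"
      using u(2) c by (metis (no_types, lifting) atMost_iff coeff_0 imageE of_rat_eq_0_iff)
    moreover have "poly.coeff p l \<in> \<rat>" for l
      by (simp add: c)
    ultimately show ?thesis
      by (intro algebraicI'[of _ z])
  next
    \<comment> \<open>Equal powers would shrink the set of vectors, so a coincidence is treated
      apart: it gives the annihilating polynomial X^j - X^i at once.\<close>
    case False
    then obtain i j where ij: "i < j" "z ^ i = z ^ j"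
      by (auto simp: inj_on_def) (metis linorder_neqE_nat)
    let ?p = "Polynomial.monom 1 j - Polynomial.monom 1 i :: complex poly"
    have "poly ?p z = 0" using ij by (simp add: poly_monom)
    moreover have "poly.coeff ?p j = 1" using ij by simp
    then have "?p \<noteq> 0" by force
    moreover have "poly.coeff ?p l \<in> \<rat>" for l by simp
    ultimately show ?thesis
      by (intro algebraicI'[of _ z])
  qed
qed

text \<open>The monomials \<open>x ^ i * y ^ j\<close> with i < a and j < b span a space stable
  under x and under y, because x^a and y^b reduce to lower powers; hence it is stable under the sum
  and the product.\<close>

lemma algebraic_add_mult:
  fixes x y :: complex
  assumes "algebraic x" "algebraic y"
  shows "algebraic (x + y)" "algebraic (x * y)"
proof -
  obtain a r where a: "0 < a" "x ^ a = (\<Sum>i<a. of_rat (r i) * x ^ i)"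
    using assms(1) by (rule algebraic_power_relation)
  obtain b s where b: "0 < b" "y ^ b = (\<Sum>i<b. of_rat (s i) * y ^ i)"
    using assms(2) by (rule algebraic_power_relation)
  define W where "W = (\<lambda>(i, j). x ^ i * y ^ j) ` ({..<a} \<times> {..<b})"
  let ?V = "rat_space.span W"
  have fin: "finite W" by (simp add: W_def)
  have base: "x ^ i * y ^ j \<in> ?V" if "i < a" "j < b" for i j
    using that by (auto simp: W_def intro!: rat_space.span_base)
  have one: "1 \<in> ?V" using base[of 0 0] a b by simp
  have X: "x * v \<in> ?V" if "v \<in> W" for v
  proof -
    obtain t where t: "t \<in> {..<a} \<times> {..<b}" "v = (\<lambda>(i, j). x ^ i * y ^ j) t"
      using \<open>v \<in> W\<close> unfolding W_def by (rule imageE)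
    obtain i j where ij: "v = x ^ i * y ^ j" "i < a" "j < b"
      using t by (cases t) auto
    show ?thesis
    proof (cases "Suc i < a")
      case True
      then show ?thesis using base[of "Suc i" j] ij by (simp add: mult.assoc)
    next
      case False
      then have "a = Suc i" using ij by simp
      then have "x * v = x ^ a * y ^ j"
        using ij(1) by (simp only: power_Suc mult.assoc)
      also have "\<dots> = (\<Sum>i<a. of_rat (r i) * (x ^ i * y ^ j))"
        unfolding a(2) by (simp add: sum_distrib_right mult.assoc)
      also have "\<dots> \<in> ?V"
        using base ij by (intro rat_space.span_sum rat_space.span_scale) auto
      finally show ?thesis .
    qed
  qed
  have Y: "y * v \<in> ?V" if "v \<in> W" for v
  proof -
    obtain t where t: "t \<in> {..<a} \<times> {..<b}" "v = (\<lambda>(i, j). x ^ i * y ^ j) t"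
      using \<open>v \<in> W\<close> unfolding W_def by (rule imageE)
    obtain i j where ij: "v = x ^ i * y ^ j" "i < a" "j < b"
      using t by (cases t) auto
    show ?thesis
    proof (cases "Suc j < b")
      case True
      then show ?thesis using base[of i "Suc j"] ij by (simp add: mult_ac)
    next
      case False
      then have "b = Suc j" using ij by simp
      then have "y * v = x ^ i * y ^ b"
        using ij(1) by (simp only: power_Suc mult.left_commute)
      also have "\<dots> = (\<Sum>j<b. of_rat (s j) * (x ^ i * y ^ j))"
        unfolding b(2) by (simp add: sum_distrib_left mult_ac)
      also have "\<dots> \<in> ?V"
        using base ij by (intro rat_space.span_sum rat_space.span_scale) auto
      finally show ?thesis .
    qed
  qed
  show "algebraic (x + y)"
    using fin one X Y by (rule_tac algebraic_if_stable_span[of W]) (auto simp: ring_distribs rat_space.span_add)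
  show "algebraic (x * y)"
    using fin one rat_span_mult_closed[OF X Y] by (rule_tac algebraic_if_stable_span[of W]) (auto simp: mult.assoc)
qed

lemma qbar_add: "x \<in> qbar \<Longrightarrow> y \<in> qbar \<Longrightarrow> x + y \<in> qbar"
  and qbar_mult: "x \<in> qbar \<Longrightarrow> y \<in> qbar \<Longrightarrow> x * y \<in> qbar"
  by (simp_all add: qbar_def algebraic_add_mult)

lemma qbar_minus: "x \<in> qbar \<Longrightarrow> - x \<in> qbar"
  and qbar_inverse: "x \<in> qbar \<Longrightarrow> inverse x \<in> qbar"
  by (auto simp add: qbar_def)

lemma qbar_rat: "of_rat r \<in> qbar"
proof -
  have "poly.coeff [:- of_rat r, 1 :: complex:] i \<in> \<rat>" for i
    by (cases i) (auto simp: coeff_pCons split: nat.splits)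
  then show ?thesis
    unfolding qbar_def by (intro CollectI algebraicI'[of "[:- of_rat r, 1:]"]) auto
qed

lemma qbar_0 [simp]: "0 \<in> qbar" and qbar_1 [simp]: "1 \<in> qbar"
  using qbar_rat[of 0] qbar_rat[of 1] by simp_all

lemma qbar_diff: "x \<in> qbar \<Longrightarrow> y \<in> qbar \<Longrightarrow> x - y \<in> qbar"
  using qbar_add[of x "- y"] qbar_minus by simp

lemma qbar_divide: "x \<in> qbar \<Longrightarrow> y \<in> qbar \<Longrightarrow> x / y \<in> qbar"
  using qbar_mult[of x "inverse y"] qbar_inverse by (simp add: divide_inverse)

lemma qbar_power: "x \<in> qbar \<Longrightarrow> x ^ n \<in> qbar"
  by (induction n) (auto intro: qbar_mult)

lemma qbar_sum: "(\<And>i. i \<in> A \<Longrightarrow> f i \<in> qbar) \<Longrightarrow> sum f A \<in> qbar"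
  by (induction A rule: infinite_finite_induct) (auto intro: qbar_add)

lemma qbar_root: "x ^ n \<in> qbar \<Longrightarrow> 0 < n \<Longrightarrow> x \<in> qbar"
proof -
  assume *: "x ^ n \<in> qbar" "0 < n"
  let ?q = "Polynomial.monom 1 n :: complex poly"
  have "algebraic x"
    by (rule algebraic_root[of "x ^ n" ?q]) (use * in \<open>auto simp: qbar_def poly_monom degree_monom_eq\<close>)
  then show ?thesis by (simp add: qbar_def)
qed

lemma qbar_root_unity: "x ^ n = 1 \<Longrightarrow> 0 < n \<Longrightarrow> x \<in> qbar"
  by (rule qbar_root[of x n]) auto

lemma degree_diff_eq_left:
  fixes p q :: "'a::ab_group_add poly"
  shows "degree q < degree p \<Longrightarrow> degree (p - q) = degree p"
  using degree_add_eq_left[of "- q" p] by simp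

section \<open>Power series with algebraic coefficients\<close>

definition qbar_fps :: "complex fps set" where
  "qbar_fps = {F. \<forall>l. fps_nth F l \<in> qbar}"

lemma qbar_fps_nth: "F \<in> qbar_fps \<Longrightarrow> fps_nth F l \<in> qbar"
  by (simp add: qbar_fps_def)

lemma qbar_fps_const [simp]: "fps_const c \<in> qbar_fps \<longleftrightarrow> c \<in> qbar"
  by (auto simp: qbar_fps_def dest: spec[of _ 0])

lemma qbar_fps_0 [simp]: "0 \<in> qbar_fps" and qbar_fps_1 [simp]: "1 \<in> qbar_fps"
  and qbar_fps_X [simp]: "fps_X \<in> qbar_fps"
  by (auto simp: qbar_fps_def fps_X_def)

lemma qbar_fps_add: "F \<in> qbar_fps \<Longrightarrow> G \<in> qbar_fps \<Longrightarrow> F + G \<in> qbar_fps"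
  and qbar_fps_diff: "F \<in> qbar_fps \<Longrightarrow> G \<in> qbar_fps \<Longrightarrow> F - G \<in> qbar_fps"
  and qbar_fps_mult: "F \<in> qbar_fps \<Longrightarrow> G \<in> qbar_fps \<Longrightarrow> F * G \<in> qbar_fps"
  by (auto simp: qbar_fps_def fps_mult_nth intro!: qbar_add qbar_diff qbar_sum qbar_mult)

lemma qbar_fps_power: "F \<in> qbar_fps \<Longrightarrow> F ^ n \<in> qbar_fps"
  by (induction n) (auto intro: qbar_fps_mult)

lemma qbar_fps_compose: "F \<in> qbar_fps \<Longrightarrow> G \<in> qbar_fps \<Longrightarrow> F oo G \<in> qbar_fps"
  using qbar_fps_power[of G]
  by (auto simp: qbar_fps_def fps_compose_nth intro!: qbar_sum qbar_mult)

text \<open>Rationality serves twice: it makes the coefficients of the binomial series algebraic,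
  and it makes every Galois automorphism fix them.\<close>

lemma gchoose_inverse_of_nat_rational: "(1 / of_nat n :: complex) gchoose l \<in> range of_rat"
proof -
  have "fact l = (of_rat (fact l) :: complex)"
    by (metis of_nat_fact of_rat_of_nat_eq)
  then have "(1 / of_nat n :: complex) gchoose l = of_rat ((1 / of_nat n) gchoose l)"
    by (simp add: gbinomial_prod_rev of_rat_divide of_rat_prod of_rat_diff)
  then show ?thesis by blast
qed

lemma qbar_fps_binomial: "fps_binomial (1 / of_nat n) \<in> qbar_fps"
proof -
  have "(1 / of_nat n :: complex) gchoose l \<in> qbar" for l
    using gchoose_inverse_of_nat_rational[of n l] qbar_rat by auto
  then show ?thesis by (simp add: qbar_fps_def)
qed

lemmas qbar_fps_intros = qbar_fps_add qbar_fps_diff qbar_fps_mult qbar_fps_power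

text \<open>Dividing A by its constant term leaves a series 1 + B, whose root is the binomial series
  at B; the prescribed b selects the branch.\<close>

lemma fps_root_exists:
  fixes A :: "complex fps"
  assumes "A \<in> qbar_fps" "fps_nth A 0 \<noteq> 0" "0 < n" "b ^ n = fps_nth A 0"
  obtains R where "R \<in> qbar_fps" "R ^ n = A" "fps_nth R 0 = b"
proof -
  define a where "a = fps_nth A 0"
  define B where "B = fps_const (1 / a) * A - 1"
  define R where "R = fps_const b * (fps_binomial (1 / of_nat n) oo B)"
  have B0: "fps_nth B 0 = 0"
    using assms(2) by (simp add: B_def a_def)
  have aq: "a \<in> qbar" using assms(1) by (simp add: a_def qbar_fps_nth)
  have bq: "b \<in> qbar" by (rule qbar_root[of b n]) (use assms aq a_def in auto)
  have "R \<in> qbar_fps"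
    unfolding R_def B_def using assms(1) aq bq
    by (intro qbar_fps_mult qbar_fps_compose qbar_fps_diff qbar_fps_binomial)
       (auto intro: qbar_divide)
  moreover have "R ^ n = A"
  proof -
    have "(fps_binomial (1 / of_nat n) oo B) ^ n = fps_binomial (1 / of_nat n) ^ n oo B"
      using B0 by (simp add: fps_compose_power)
    also have "\<dots> = (1 + fps_X) oo B"
      using assms(3) by (simp add: fps_binomial_power fps_binomial_1)
    also have "\<dots> = fps_const (1 / a) * A"
      using B0 by (simp add: fps_compose_add_distrib B_def)
    finally have "R ^ n = fps_const (b ^ n) * (fps_const (1 / a) * A)"
      by (simp add: R_def power_mult_distrib fps_const_power)
    also have "\<dots> = fps_const (b ^ n * (1 / a)) * A"
      by (simp only: mult.assoc[symmetric] fps_const_mult)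
    also have "\<dots> = A"
      using assms by (simp add: a_def)
    finally show ?thesis .
  qed
  moreover have "fps_nth R 0 = b" by (simp add: R_def)
  ultimately show ?thesis by (rule that)
qed

text \<open>Power series form a domain, so S^n has at most n roots of order n, and the n multiples
  of S by roots of unity already exhaust them.\<close>

lemma fps_equal_powers:
  fixes R S :: "complex fps"
  assumes "R ^ n = S ^ n" "0 < n"
  obtains \<omega> where "\<omega> ^ n = 1" "R = fps_const \<omega> * S"
proof (cases "S = 0")
  case True
  then have "R = 0" using assms by (metis power_eq_0_iff)
  then show ?thesis using True that[of 1] by simp
next
  case False
  define p where "p = Polynomial.monom 1 n - [:S ^ n:]"
  define Z where "Z = {\<omega> :: complex. \<omega> ^ n = 1}"
  have "degree p = n" using assms(2) unfolding p_def
    by (subst degree_diff_eq_left) (auto simp: degree_monom_eq)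
  then have p0: "p \<noteq> 0" using assms(2) by auto
  have fin: "finite {x. poly p x = 0}" by (rule poly_roots_finite[OF p0])
  have inj: "inj_on (\<lambda>\<omega>. fps_const \<omega> * S) Z"
    using False by (auto simp: inj_on_def)
  have sub: "(\<lambda>\<omega>. fps_const \<omega> * S) ` Z \<subseteq> {x. poly p x = 0}"
    by (auto simp: p_def Z_def poly_monom power_mult_distrib fps_const_power)
  have "card ((\<lambda>\<omega>. fps_const \<omega> * S) ` Z) = n"
    using inj assms(2) card_nth_roots[of 1 n] by (simp add: card_image Z_def)
  moreover have "card {x. poly p x = 0} \<le> n"
    using poly_roots_degree[OF p0] \<open>degree p = n\<close> by simp
  ultimately have "(\<lambda>\<omega>. fps_const \<omega> * S) ` Z = {x. poly p x = 0}"
    using sub fin by (intro card_subset_eq) (auto intro: antisym card_mono)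
  moreover have "R \<in> {x. poly p x = 0}" using assms by (simp add: p_def poly_monom)
  ultimately show ?thesis using that by (auto simp: Z_def)
qed

text \<open>Some root with algebraic coefficients exists, and R differs from it by a constant root
  of unity.\<close>

lemma qbar_fps_root:
  fixes R :: "complex fps"
  assumes "R ^ n \<in> qbar_fps" "fps_nth (R ^ n) 0 \<noteq> 0" "0 < n"
  shows "R \<in> qbar_fps"
proof -
  obtain S where S: "S \<in> qbar_fps" "S ^ n = R ^ n" "fps_nth S 0 = fps_nth R 0"
    using fps_root_exists[OF assms(1,2,3), of "fps_nth R 0"] by (auto simp: fps_nth_power_0)
  obtain \<omega> where "\<omega> ^ n = 1" "R = fps_const \<omega> * S"
    using fps_equal_powers[of R n S] S assms by auto
  then show ?thesis using S assms(3) by (auto intro!: qbar_fps_mult qbar_root_unity[of _ n])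
qed

lemma fps_equal_powers_unique:
  fixes R S :: "complex fps"
  assumes "R ^ n = S ^ n" "0 < n" "fps_nth R 0 = fps_nth S 0" "fps_nth S 0 \<noteq> 0"
  shows "R = S"
proof -
  obtain \<omega> where "\<omega> ^ n = 1" "R = fps_const \<omega> * S"
    using fps_equal_powers assms by metis
  then show ?thesis using assms by auto
qed

lemma fps_compose_X_power_inj:
  fixes F G :: "complex fps"
  assumes "F oo fps_X ^ k = G oo fps_X ^ k" "0 < k"
  shows "F = G"
proof (rule fps_ext)
  fix l
  have "fps_nth (F oo fps_X ^ k) (k * l) = fps_nth (G oo fps_X ^ k) (k * l)"
    using assms by simp
  then show "fps_nth F l = fps_nth G l"
    using assms(2) by (simp add: fps_nth_compose_X_power)
qed

section \<open>Kummer covers: fibres, irreducibility, Galois closures\<close>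

section \<open>The covers \<open>(1 - w ^ P) ^ Q = c z\<close>\<close>

text \<open>
  The sign makes the polynomial monic. For \<open>c = \<xi>\<^sup>-\<^sup>k\<close>, \<open>\<xi>\<close> the standard \<open>p\<^sup>n\<close>-th root of unity, \<open>kummer_cover (p ^ N) 1 c\<close> is a
  cover of \<open>V\<^sub>n\<close> on which only \<open>y\<^bsub>n,k\<^esub>\<close> acts nontrivially. It is a component of the pullback of the
  cover \<open>kummer_cover (p ^ N) (p ^ n) 1\<close> of \<open>V\<^sub>0\<close>, and this is how lifts of paths are evaluated on it.
\<close>

definition kummer_cover :: "nat \<Rightarrow> nat \<Rightarrow> complex \<Rightarrow> complex poly poly" where
  "kummer_cover P Q c = (Polynomial.monom 1 P - 1) ^ Q - [:[:0, (-1) ^ Q * c:]:]"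

context
  fixes P Q :: nat and c :: complex
  assumes P: "0 < P" and Q: "0 < Q"
begin

lemma degree_monom_diff_one: "degree (Polynomial.monom 1 P - 1 :: complex poly poly) = P"
  using P by (subst degree_diff_eq_left) (auto simp: degree_monom_eq)

lemma lead_coeff_monom_diff_one: "lead_coeff (Polynomial.monom 1 P - 1 :: complex poly poly) = 1"
  using P unfolding degree_monom_diff_one by simp

lemma degree_kummer_cover: "degree (kummer_cover P Q c) = P * Q"
proof -
  have "degree ((Polynomial.monom 1 P - 1) ^ Q :: complex poly poly) = P * Q"
    using degree_monom_diff_one by (metis degree_power_eq P degree_0 less_not_refl)
  then show ?thesis
    using P Q unfolding kummer_cover_def by (subst degree_diff_eq_left) auto
qed

lemma lead_coeff_kummer_cover: "lead_coeff (kummer_cover P Q c) = 1"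
proof -
  have "degree ((Polynomial.monom 1 P - 1) ^ Q :: complex poly poly) = P * Q"
    using degree_monom_diff_one by (metis degree_power_eq P degree_0 less_not_refl)
  moreover have "lead_coeff ((Polynomial.monom 1 P - 1) ^ Q :: complex poly poly) = 1"
    by (simp only: lead_coeff_power lead_coeff_monom_diff_one power_one)
  moreover have "poly.coeff [:[:0, (-1) ^ Q * c:]:] (P * Q) = 0"
    using P Q by (simp add: coeff_pCons split: nat.splits)
  ultimately show ?thesis
    unfolding degree_kummer_cover unfolding kummer_cover_def coeff_diff by simp
qed

end

lemma expand_coeff_simps [simp]:
  "expand_coeff b N 0 = 0" "expand_coeff b N 1 = 1"
  "expand_coeff b N [:0, a:] = fps_const a * coordinate b N"
  "expand_coeff b N [:a:] = fps_const a"
proof -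
  have [simp]: "map_poly fps_const [:0, a:] = [:0, fps_const a:]"
    "map_poly fps_const [:a:] = [:fps_const a:]"
    by (simp_all add: poly_eq_iff coeff_map_poly coeff_pCons split: nat.splits)
  show "expand_coeff b N 0 = 0" "expand_coeff b N 1 = 1"
  "expand_coeff b N [:0, a:] = fps_const a * coordinate b N"
  "expand_coeff b N [:a:] = fps_const a"
    by (simp_all add: expand_coeff_def)
qed

lemma expand_coeff_add: "expand_coeff b N (x + y) = expand_coeff b N x + expand_coeff b N y"
  and expand_coeff_mult: "expand_coeff b N (x * y) = expand_coeff b N x * expand_coeff b N y"
proof -
  interpret map_poly_comm_ring_hom "fps_const :: complex \<Rightarrow> complex fps"
    by standard auto
  show "expand_coeff b N (x + y) = expand_coeff b N x + expand_coeff b N y"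
    "expand_coeff b N (x * y) = expand_coeff b N x * expand_coeff b N y"
    by (simp_all add: expand_coeff_def hom_distribs)
qed

lemma expand_eval_kummer_cover:
  "expand_eval b N (kummer_cover P Q c) \<rho> = (\<rho> ^ P - 1) ^ Q - fps_const ((-1) ^ Q * c) * coordinate b N"
proof -
  interpret e: comm_ring_hom "expand_coeff b N"
    by standard (simp_all add: expand_coeff_add expand_coeff_mult)
  interpret map_poly_comm_ring_hom "expand_coeff b N" ..
  have "map_poly (expand_coeff b N) (kummer_cover P Q c)
    = (Polynomial.monom 1 P - 1) ^ Q - [:expand_coeff b N [:0, (-1) ^ Q * c:]:]"
    unfolding kummer_cover_def hom_distribs by (simp add: map_poly_monom map_poly_pCons)
  then show ?thesis
    by (simp add: expand_eval_def poly_monom poly_power)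
qed

lemma expand_eval_kummer_cover_eq_0:
  "expand_eval b N (kummer_cover P Q c) \<rho> = 0 \<longleftrightarrow> (1 - \<rho> ^ P) ^ Q = fps_const c * coordinate b N"
proof -
  have "(\<rho> ^ P - 1) ^ Q = (-1) ^ Q * (1 - \<rho> ^ P) ^ Q"
    by (simp flip: power_mult_distrib)
  moreover have "fps_const ((-1) ^ Q * c) = (-1) ^ Q * fps_const c"
    by (simp flip: fps_const_mult fps_const_power fps_const_neg)
  ultimately have "expand_eval b N (kummer_cover P Q c) \<rho>
      = (-1) ^ Q * ((1 - \<rho> ^ P) ^ Q - fps_const c * coordinate b N)"
    by (simp add: expand_eval_kummer_cover algebra_simps)
  then show ?thesis by simp
qed

lemma fibre_kummer_cover:
  assumes "0 < P" "0 < Q"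
  shows "fibre b (kummer_cover P Q c)
    = {\<rho> \<in> qbar_fps. (1 - \<rho> ^ P) ^ Q = fps_const c * coordinate b (P * Q)}"
  by (auto simp: fibre_def qbar_fps_def expand_eval_kummer_cover_eq_0 degree_kummer_cover assms)

text \<open>Both root extractions start from a unit: \<open>c * v \<noteq> 0\<close> ensures this
  for \<open>1 - \<rho> ^ P\<close>, and \<open>c * v \<noteq> 1\<close> for
  \<open>\<rho> ^ P\<close>. So a series found analytically, or as an image under an automorphism,
  lies in the fibre once it solves the equation.\<close>

lemma qbar_fps_if_equation:
  assumes "0 < P" "0 < Q" "c \<in> qbar" "v \<in> qbar" "c * v \<noteq> 0" "c * v \<noteq> 1"
    "(1 - \<rho> ^ P) ^ Q = fps_const c * (fps_const v + fps_X)"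
  shows "\<rho> \<in> qbar_fps"
proof -
  let ?y = "1 - \<rho> ^ P"
  have y0: "fps_nth ?y 0 ^ Q = c * v"
    using arg_cong[OF assms(7), of "\<lambda>F. fps_nth F 0"] by (simp add: fps_nth_power_0)
  have y: "?y \<in> qbar_fps"
    by (rule qbar_fps_root[of _ Q]) (use assms in \<open>auto intro!: qbar_fps_intros\<close>)
  have "\<rho> ^ P = 1 - ?y" by simp
  moreover have "1 - ?y \<in> qbar_fps" using y by (rule qbar_fps_diff[OF qbar_fps_1])
  moreover have "fps_nth (1 - ?y) 0 \<noteq> 0"
    using y0 assms(6) by (metis eq_iff_diff_eq_0 fps_one_nth fps_sub_nth power_one)
  ultimately show ?thesis using assms(1) by (metis qbar_fps_root)
qed

text \<open>The cover is unramified at v, so each solution at z = v extends uniquely to a series.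
  Later, germs in a fibre are identified by comparing constant terms only.\<close>

lemma bij_betw_fibre_kummer_cover:
  assumes "0 < P" "0 < Q" "c \<in> qbar" "v \<in> qbar" "c * v \<noteq> 0" "c * v \<noteq> 1"
  shows "bij_betw (\<lambda>\<rho>. fps_nth \<rho> 0) (fibre (At v) (kummer_cover P Q c))
           {w. (1 - w ^ P) ^ Q = c * v}"
proof -
  let ?A = "fps_const c * (fps_const v + fps_X)"
  have A: "?A \<in> qbar_fps" using assms by (auto intro!: qbar_fps_intros)
  have A0: "fps_nth ?A 0 = c * v" by simp
  have fib: "fibre (At v) (kummer_cover P Q c) = {\<rho> \<in> qbar_fps. (1 - \<rho> ^ P) ^ Q = ?A}"
    by (simp add: fibre_kummer_cover assms coordinate_def)
  have ev: "(1 - fps_nth \<rho> 0 ^ P) ^ Q = c * v" if "(1 - \<rho> ^ P) ^ Q = ?A" for \<rho>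
  proof -
    have "fps_nth ((1 - \<rho> ^ P) ^ Q) 0 = c * v" using that A0 by simp
    then show ?thesis by (simp add: fps_nth_power_0)
  qed
  show ?thesis
    unfolding fib
  proof (rule bij_betw_imageI)
    show "inj_on (\<lambda>\<rho>. fps_nth \<rho> 0) {\<rho> \<in> qbar_fps. (1 - \<rho> ^ P) ^ Q = ?A}"
    proof (rule inj_onI, clarify)
      fix R S assume R: "(1 - R ^ P) ^ Q = ?A" and S: "(1 - S ^ P) ^ Q = ?A"
        and eq: "fps_nth R 0 = fps_nth S 0"
      have s0: "1 - fps_nth S 0 ^ P \<noteq> 0"
        using ev[OF S] assms by (metis power_0_left not_gr0)
      have s1: "fps_nth S 0 ^ P \<noteq> 0"
      proof
        assume "fps_nth S 0 ^ P = 0"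
        then have "c * v = 1" using ev[OF S] by (simp only: diff_zero power_one)
        then show False using assms by simp
      qed
      have "1 - R ^ P = 1 - S ^ P"
        by (rule fps_equal_powers_unique[of _ Q])
           (use R S eq s0 assms in \<open>auto simp: fps_nth_power_0\<close>)
      then have "R ^ P = S ^ P" by simp
      then show "R = S"
        by (rule fps_equal_powers_unique) (use assms eq s1 in \<open>auto\<close>)
    qed
    show "(\<lambda>\<rho>. fps_nth \<rho> 0) ` {\<rho> \<in> qbar_fps. (1 - \<rho> ^ P) ^ Q = ?A} = {w. (1 - w ^ P) ^ Q = c * v}"
    proof (intro equalityI subsetI)
      fix w assume w: "w \<in> {w. (1 - w ^ P) ^ Q = c * v}"
      obtain Y where Y: "Y \<in> qbar_fps" "Y ^ Q = ?A" "fps_nth Y 0 = 1 - w ^ P"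
        using fps_root_exists[OF A, of Q "1 - w ^ P"] w assms by auto
      have w0: "w ^ P \<noteq> 0"
      proof
        assume "w ^ P = 0"
        then have "c * v = 1" using w by (simp only: mem_Collect_eq diff_zero power_one)
        then show False using assms by simp
      qed
      obtain R where R: "R \<in> qbar_fps" "R ^ P = 1 - Y" "fps_nth R 0 = w"
      proof (rule fps_root_exists)
        show "1 - Y \<in> qbar_fps" using Y(1) by (rule qbar_fps_diff[OF qbar_fps_1])
        show "fps_nth (1 - Y) 0 \<noteq> 0" "w ^ P = fps_nth (1 - Y) 0"
          using Y(3) w0 by simp_all
      qed (use assms(1) in auto)
      have "(1 - R ^ P) ^ Q = ?A" using R Y by simp
      then show "w \<in> (\<lambda>\<rho>. fps_nth \<rho> 0) ` {\<rho> \<in> qbar_fps. (1 - \<rho> ^ P) ^ Q = ?A}"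
        using R by blast
    qed (use ev in auto)
  qed
qed

text \<open>There are Q choices of y = 1 - w^P, none equal to 1 because a is not 1, and each leaves
  P choices of w.\<close>

lemma card_iterated_roots:
  fixes a :: complex
  assumes "0 < P" "0 < Q" "a \<noteq> 0" "a \<noteq> 1"
  shows "card {w. (1 - w ^ P) ^ Q = a} = P * Q"
proof -
  let ?Y = "{y. y ^ Q = a}"
  have eq: "{w. (1 - w ^ P) ^ Q = a} = (\<Union>y\<in>?Y. {w. w ^ P = 1 - y})"
    by (auto intro: exI[of _ "1 - x ^ P" for x])
  have fin: "finite ?Y" using assms card_nth_roots[of a Q] by (intro card_ge_0_finite) simp
  have c: "card {w. w ^ P = 1 - y} = P" if "y \<in> ?Y" for y
    using that assms by (intro card_nth_roots) auto
  have "card (\<Union>y\<in>?Y. {w. w ^ P = 1 - y}) = (\<Sum>y\<in>?Y. card {w. w ^ P = 1 - y})"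
  proof (rule card_UN_disjoint)
    show "\<forall>y\<in>?Y. finite {w. w ^ P = 1 - y}"
      using c assms(1) by (metis card_ge_0_finite)
  qed (use fin in auto)
  also have "\<dots> = P * Q"
    using c card_nth_roots[of a Q] assms by simp
  finally show ?thesis by (simp only: eq)
qed

lemma card_fibre_kummer_cover:
  assumes "0 < P" "0 < Q" "c \<in> qbar" "v \<in> qbar" "c * v \<noteq> 0" "c * v \<noteq> 1"
  shows "card (fibre (At v) (kummer_cover P Q c)) = degree (kummer_cover P Q c)"
  using bij_betw_same_card[OF bij_betw_fibre_kummer_cover[OF assms]]
    card_iterated_roots[OF assms(1,2,5,6)] degree_kummer_cover[OF assms(1,2)]
  by simp

section \<open>Irreducibility\<close>

text \<open>The variables exchange roles: w becomes a number and z stays the indeterminate, so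
  \<open>map_poly (\<lambda>q. poly.coeff q j) a\<close> is the coefficient of z^j, a polynomial in
  w.\<close>

lemma coeff_poly_const_eval:
  fixes a :: "complex poly poly"
  shows "poly.coeff (poly a [:w:]) j = poly (map_poly (\<lambda>q. poly.coeff q j) a) w"
  by (induction a) (auto simp: map_poly_pCons)

text \<open>Such an a is a polynomial in w alone; a complex zero of it would make some
  \<open>poly a [:w:]\<close> vanish, so it is a nonzero constant.\<close>

lemma unit_if_constant_coeffs:
  fixes a :: "complex poly poly"
  assumes nz: "\<And>w. poly a [:w:] \<noteq> 0"
    and A: "\<And>j. 0 < j \<Longrightarrow> map_poly (\<lambda>q. poly.coeff q j) a = 0"
  shows "a dvd 1"
proof -
  define A0 where "A0 = map_poly (\<lambda>q. poly.coeff q 0) a"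
  have "poly A0 w \<noteq> 0" for w
  proof
    assume 0: "poly A0 w = 0"
    have "poly.coeff (poly a [:w:]) j = 0" for j
      using 0 A[of j] by (cases "j = 0") (auto simp: coeff_poly_const_eval A0_def)
    then have "poly a [:w:] = 0" by (simp add: poly_eq_iff)
    then show False using nz by blast
  qed
  note noroot = this
  obtain a0 where a0: "A0 = [:a0:]"
    using fundamental_theorem_of_algebra_alt[of A0] noroot by blast
  have "a0 \<noteq> 0" using noroot[of 0] a0 by simp
  have c: "poly.coeff (poly.coeff a i) j = poly.coeff (map_poly (\<lambda>q. poly.coeff q j) a) i" for i j
    by (simp add: coeff_map_poly)
  have "poly.coeff (poly.coeff a i) j = poly.coeff (poly.coeff [:[:a0:]:] i) j" for i j
  proof (cases "j = 0")
    case True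
    have "poly.coeff (poly.coeff a i) j = poly.coeff A0 i"
      unfolding c True A0_def ..
    then show ?thesis using True a0 by (simp add: coeff_pCons split: nat.splits)
  next
    case False
    have "poly.coeff (poly.coeff a i) j = 0"
      unfolding c using A[of j] False by simp
    then show ?thesis using False by (simp add: coeff_pCons split: nat.splits)
  qed
  then have "a = [:[:a0:]:]" by (simp add: poly_eq_iff)
  moreover have "[:[:a0:]:] * [:[:1 / a0:]:] = 1" using \<open>a0 \<noteq> 0\<close> by (simp add: one_pCons)
  ultimately show ?thesis by (metis dvdI)
qed

text \<open>The polynomial is linear in \<open>z\<close>, so one factor does not involve \<open>z\<close>; having no zeros, that
  factor is constant.\<close>

lemma irreducible_kummer_cover:
  assumes "0 < P" "0 < Q" "c \<noteq> 0"
  shows "irreducible (kummer_cover P Q c)"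
proof (rule irreducibleI)
  let ?F = "kummer_cover P Q c"
  show "?F \<noteq> 0"
    using degree_kummer_cover[of P Q c] assms by (metis degree_0 mult_pos_pos neq0_conv)
  show "\<not> ?F dvd 1"
  proof
    assume "?F dvd 1"
    then have "degree ?F \<le> degree (1 :: complex poly poly)" by (rule dvd_imp_degree_le) simp
    then show False using degree_kummer_cover[of P Q c] assms by simp
  qed
  fix a b assume ab: "?F = a * b"
  define cf where "cf = (\<lambda>(a :: complex poly poly) j. map_poly (\<lambda>q. poly.coeff q j) a)"
  have prod: "poly a [:w:] * poly b [:w:] = [:(w ^ P - 1) ^ Q, - ((-1) ^ Q * c):]" for w
  proof -
    have "poly a [:w:] * poly b [:w:] = poly ?F [:w:]" by (simp add: ab)
    also have "\<dots> = [:(w ^ P - 1) ^ Q, - ((-1) ^ Q * c):]"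
      by (simp add: kummer_cover_def poly_monom poly_power poly_const_pow one_pCons)
    finally show ?thesis .
  qed
  have nz: "poly a [:w:] \<noteq> 0" "poly b [:w:] \<noteq> 0" for w
    using prod[of w] assms by auto
  have deg: "degree (poly a [:w:]) + degree (poly b [:w:]) = 1" for w
  proof -
    have "degree (poly a [:w:] * poly b [:w:]) = 1"
      unfolding prod using assms by simp
    then show ?thesis using nz by (simp add: degree_mult_eq)
  qed
  have "(\<forall>j>0. cf a j = 0) \<or> (\<forall>j>0. cf b j = 0)"
  proof (rule ccontr)
    \<comment> \<open>If z occurred in both factors, a number w outside finitely many zeros would
      make both specialisations nonconstant in z, although their degrees add up to 1.\<close>
    assume "\<not> ?thesis"
    then obtain j k where jk: "0 < j" "cf a j \<noteq> 0" "0 < k" "cf b k \<noteq> 0" by blast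
    then have "finite {w. poly (cf a j * cf b k) w = 0}" by (intro poly_roots_finite) auto
    then obtain w where "poly (cf a j * cf b k) w \<noteq> 0"
      using infinite_UNIV_char_0[where 'a = complex] by (metis (mono_tags, lifting) UNIV_I finite_subset mem_Collect_eq subsetI)
    then have "poly.coeff (poly a [:w:]) j \<noteq> 0" "poly.coeff (poly b [:w:]) k \<noteq> 0"
      by (auto simp: coeff_poly_const_eval cf_def)
    then have "j \<le> degree (poly a [:w:])" "k \<le> degree (poly b [:w:])"
      by (auto intro: le_degree)
    then show False using deg[of w] jk by linarith
  qed
  then show "a dvd 1 \<or> b dvd 1"
    using unit_if_constant_coeffs[of a] unit_if_constant_coeffs[of b] nz by (auto simp: cf_def)
qed

section \<open>Galois closures of \<open>p\<close>-power degree\<close>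

text \<open>A prime q other than p dividing the order would give, by Sylow, a subgroup of order q;
  the order of a nontrivial element in it would divide both q and p^e.\<close>

lemma (in group) order_prime_power_if_exponent:
  fixes p :: nat
  assumes "prime p" "finite (carrier G)" "\<And>x. x \<in> carrier G \<Longrightarrow> x [^] (p ^ e) = \<one>"
  shows "\<exists>k. order G = p ^ k"
proof -
  have only_p: "q = p" if q: "prime q" "q dvd order G" for q
  proof (rule ccontr)
    assume "q \<noteq> p"
    have "order G = q ^ 1 * (order G div q)" using q by simp
    then obtain H where H: "subgroup H G" "card H = q ^ 1"
      using sylow_thm[OF q(1) is_group _ assms(2)] by blast
    have "card H > 1" using H q prime_gt_1_nat by simp
    then obtain x where x: "x \<in> H" "x \<noteq> \<one>"
      by (metis One_nat_def card.empty card_Suc_eq card_le_Suc0_iff_eq card_ge_0_finite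
          leD not_one_less_zero subgroup.one_closed[OF H(1)] less_trans zero_less_one)
    have xG: "x \<in> carrier G" using x H by (metis subgroup.mem_carrier)
    interpret H: group "G\<lparr>carrier := H\<rparr>" by (rule subgroup_imp_group[OF H(1)])
    have "x [^]\<^bsub>G\<lparr>carrier := H\<rparr>\<^esub> order (G\<lparr>carrier := H\<rparr>) = \<one>\<^bsub>G\<lparr>carrier := H\<rparr>\<^esub>"
      by (rule H.pow_order_eq_1) (use x in simp)
    then have "x [^] q = \<one>"
      using H by (simp add: order_def nat_pow_consistent[symmetric])
    then have "ord x dvd q" using pow_eq_id[OF xG] by blast
    moreover have "ord x dvd p ^ e" using pow_eq_id[OF xG] assms(3)[OF xG] by blast
    moreover have "coprime q (p ^ e)"
      using q \<open>prime p\<close> \<open>q \<noteq> p\<close> by (simp add: primes_coprime)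
    ultimately have "ord x = 1" by (metis coprime_common_divisor nat_dvd_1_iff_1)
    then show False using x ord_eq_1[OF xG] by simp
  qed
  have "order G \<noteq> 0" using assms(2) order_gt_0_iff_finite by auto
  then obtain r where r: "order G = p ^ multiplicity p (order G) * r" "\<not> p dvd r"
    using multiplicity_decompose'[of "order G" p] assms(1) by (metis not_prime_unit)
  have "r = 1"
  proof (rule ccontr)
    assume "r \<noteq> 1"
    then obtain q where "prime q" "q dvd r" using prime_factor_nat by blast
    then show False using only_p r by (metis dvd_mult)
  qed
  then show ?thesis using r by auto
qed

definition closure_group :: "complex \<Rightarrow> complex poly poly \<Rightarrow> (complex fps \<Rightarrow> complex fps) monoid" where
  "closure_group v f = \<lparr>carrier = closure_galois_group v f,
     mult = compose (splitting_ring v f), one = (\<lambda>x\<in>splitting_ring v f. x)\<rparr>"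

lemma closure_galois_groupD:
  assumes "\<phi> \<in> closure_galois_group v f"
  shows "x \<in> splitting_ring v f \<Longrightarrow> \<phi> x \<in> splitting_ring v f"
    "x \<in> splitting_ring v f \<Longrightarrow> y \<in> splitting_ring v f \<Longrightarrow> \<phi> (x + y) = \<phi> x + \<phi> y"
    "x \<in> splitting_ring v f \<Longrightarrow> y \<in> splitting_ring v f \<Longrightarrow> \<phi> (x * y) = \<phi> x * \<phi> y"
    "poly_qbar c \<Longrightarrow> \<phi> (expand_coeff (At v) 1 c) = expand_coeff (At v) 1 c"
    "bij_betw \<phi> (splitting_ring v f) (splitting_ring v f)"
    "\<phi> \<in> extensional (splitting_ring v f)"
  using assms by (auto simp: closure_galois_group_def bij_betw_def)

text \<open>The ring is generated by the roots together with the base polynomials, which are fixed,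
  so induction on the generation applies.\<close>

lemma closure_galois_group_eqI:
  assumes "\<phi> \<in> closure_galois_group v f" "\<psi> \<in> closure_galois_group v f"
    "\<And>\<rho>. \<rho> \<in> fibre (At v) f \<Longrightarrow> \<phi> \<rho> = \<psi> \<rho>"
  shows "\<phi> = \<psi>"
proof (rule extensionalityI)
  fix x assume "x \<in> splitting_ring v f"
  then show "\<phi> x = \<psi> x"
    by (induction rule: splitting_ring.induct)
       (simp_all add: closure_galois_groupD[OF assms(1)] closure_galois_groupD[OF assms(2)] assms(3)
         del: One_nat_def)
qed (use assms closure_galois_groupD(6) in blast)+

lemma group_closure_group: "group (closure_group v f)"
proof -
  let ?S = "splitting_ring v f" and ?G = "closure_galois_group v f"
  have comp: "compose ?S \<phi> \<psi> \<in> ?G" if "\<phi> \<in> ?G" "\<psi> \<in> ?G" for \<phi> \<psi>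
  proof -
    note D = closure_galois_groupD[OF that(1)] and E = closure_galois_groupD[OF that(2)]
    have "bij_betw (compose ?S \<phi> \<psi>) ?S ?S"
      by (rule bij_betw_compose[OF E(5) D(5)])
    then show ?thesis
      unfolding closure_galois_group_def
      by (auto simp: compose_def splitting_ring.intros D(1-4) E(1-4) simp del: One_nat_def)
  qed
  have one: "(\<lambda>x\<in>?S. x) \<in> ?G"
    by (auto simp: closure_galois_group_def splitting_ring.intros bij_betw_def inj_on_def simp del: One_nat_def)
  have inv: "(\<lambda>x\<in>?S. inv_into ?S \<phi> x) \<in> ?G" "compose ?S (\<lambda>x\<in>?S. inv_into ?S \<phi> x) \<phi> = (\<lambda>x\<in>?S. x)"
    if "\<phi> \<in> ?G" for \<phi>
  proof -
    note D = closure_galois_groupD[OF that]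
    have bij: "bij_betw \<phi> ?S ?S" by (rule D)
    have i: "inv_into ?S \<phi> y \<in> ?S" "\<phi> (inv_into ?S \<phi> y) = y" if "y \<in> ?S" for y
      using bij that by (auto simp: bij_betw_def intro: inv_into_into f_inv_into_f)
    have e: "inv_into ?S \<phi> y = x" if "x \<in> ?S" "\<phi> x = y" for x y
      using bij that by (auto simp: bij_betw_def inv_into_f_f)
    show "(\<lambda>x\<in>?S. inv_into ?S \<phi> x) \<in> ?G"
      unfolding closure_galois_group_def
      using bij_betw_inv_into[OF bij] bij_betw_cong[of ?S "\<lambda>x\<in>?S. inv_into ?S \<phi> x" "inv_into ?S \<phi>" ?S]
      by (auto simp: splitting_ring.intros i D(1-4) simp del: One_nat_def intro!: e)
    show "compose ?S (\<lambda>x\<in>?S. inv_into ?S \<phi> x) \<phi> = (\<lambda>x\<in>?S. x)"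
      by (rule extensionalityI[of _ ?S]) (auto simp: compose_def e D(1))
  qed
  show ?thesis
    unfolding closure_group_def
  proof (rule groupI; simp)
    fix x y z assume "x \<in> ?G" "y \<in> ?G" "z \<in> ?G"
    then show "compose ?S (compose ?S x y) z = compose ?S x (compose ?S y z)"
      by (intro compose_assoc[symmetric, of _ _ ?S]) (auto simp: closure_galois_groupD)
  next
    fix x assume "x \<in> ?G"
    then show "compose ?S (\<lambda>x\<in>?S. x) x = x"
      by (intro Id_compose[of _ ?S ?S]) (auto simp: closure_galois_groupD)
  next
    fix x assume "x \<in> ?G"
    then show "\<exists>y\<in>?G. compose ?S y x = (\<lambda>x\<in>?S. x)" using inv by blast
  qed (use comp one in auto)
qed

lemma closure_group_pow:
  assumes "\<phi> \<in> closure_galois_group v f" "x \<in> splitting_ring v f"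
  shows "(\<phi> [^]\<^bsub>closure_group v f\<^esub> (k :: nat)) x = (\<phi> ^^ k) x"
proof -
  show ?thesis
    using assms(2)
  proof (induction k arbitrary: x)
    case 0
    then show ?case by (simp add: closure_group_def nat_pow_def)
  next
    case (Suc k)
    have "(\<phi> [^]\<^bsub>closure_group v f\<^esub> Suc k) x = (\<phi> [^]\<^bsub>closure_group v f\<^esub> k) (\<phi> x)"
      using Suc.prems by (simp add: nat_pow_def closure_group_def compose_def)
    also have "\<dots> = (\<phi> ^^ Suc k) x"
      using Suc closure_galois_groupD(1)[OF assms(1)] by (simp add: funpow_swap1)
    finally show ?case .
  qed
qed

text \<open>Restriction to the finite set of roots is injective, so the group is finite; the
  exponent p^e then forces its order to be a power of p, without the order being computed.\<close>

lemma card_closure_galois_group_prime_power: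
  assumes "prime p" "finite (fibre (At v) f)"
    and "\<And>\<phi> \<rho>. \<phi> \<in> closure_galois_group v f \<Longrightarrow> \<rho> \<in> fibre (At v) f \<Longrightarrow> \<phi> \<rho> \<in> fibre (At v) f"
    and "\<And>\<phi> \<rho>. \<phi> \<in> closure_galois_group v f \<Longrightarrow> \<rho> \<in> fibre (At v) f \<Longrightarrow> (\<phi> ^^ (p ^ e)) \<rho> = \<rho>"
  shows "\<exists>k. card (closure_galois_group v f) = p ^ k"
proof -
  interpret group "closure_group v f" by (rule group_closure_group)
  have car: "carrier (closure_group v f) = closure_galois_group v f"
    by (simp add: closure_group_def)
  have "inj_on (\<lambda>\<phi>. restrict \<phi> (fibre (At v) f)) (closure_galois_group v f)"
  proof (rule inj_onI)
    fix x y assume xy: "x \<in> closure_galois_group v f" "y \<in> closure_galois_group v f"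
      "restrict x (fibre (At v) f) = restrict y (fibre (At v) f)"
    show "x = y"
      by (rule closure_galois_group_eqI[OF xy(1,2)]) (metis restrict_apply' xy(3))
  qed
  moreover have "(\<lambda>\<phi>. restrict \<phi> (fibre (At v) f)) ` closure_galois_group v f
      \<subseteq> fibre (At v) f \<rightarrow>\<^sub>E fibre (At v) f"
    using assms(3) by auto
  moreover have "finite (fibre (At v) f \<rightarrow>\<^sub>E fibre (At v) f)"
    using assms(2) by (intro finite_PiE)
  ultimately have fin: "finite (closure_galois_group v f)"
    by (meson finite_imageD finite_subset)
  have "x [^]\<^bsub>closure_group v f\<^esub> (p ^ e) = \<one>\<^bsub>closure_group v f\<^esub>" if "x \<in> carrier (closure_group v f)" for x
  proof (rule closure_galois_group_eqI)
    show "x [^]\<^bsub>closure_group v f\<^esub> (p ^ e) \<in> closure_galois_group v f"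
      "\<one>\<^bsub>closure_group v f\<^esub> \<in> closure_galois_group v f"
      using nat_pow_closed[OF that] one_closed by (simp_all only: car)
    fix \<rho> assume r: "\<rho> \<in> fibre (At v) f"
    then have "\<rho> \<in> splitting_ring v f" by (rule splitting_ring.intros)
    then show "(x [^]\<^bsub>closure_group v f\<^esub> (p ^ e)) \<rho> = \<one>\<^bsub>closure_group v f\<^esub> \<rho>"
      using that r assms(4) by (simp add: closure_group_pow car) (simp add: closure_group_def)
  qed
  from order_prime_power_if_exponent[OF assms(1) _ this] show ?thesis
    using fin by (simp add: order_def car)
qed

text \<open>Apart from 0 and infinity the only branch point is 1/c, which
  \<open>c ^ (p ^ n) = 1\<close> places among the punctures. An automorphism multiplies y = 1 -
  \<rho>^P by a Q-th root of unity, so its Q-th iterate fixes y and multiplies \<rho> by a P-th root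
  of unity; its iterate of order P Q = p^(M + N) is trivial.\<close>

lemma kummer_cover_in_covers:
  assumes p: "prime p" and P: "P = p ^ N" and Q: "Q = p ^ M" and c: "c ^ (p ^ n) = 1"
  shows "kummer_cover P Q c \<in> covers p n"
proof -
  have pos: "0 < P" "0 < Q" "0 < p ^ n" using p P Q by (auto simp: prime_gt_0_nat)
  have c0: "c \<noteq> 0" using c pos by (auto simp: power_0_left)
  have cq: "c \<in> qbar" using c pos by (rule_tac qbar_root_unity)
  let ?f = "kummer_cover P Q c"
  have "poly2_qbar ?f"
  proof -
    \<comment> \<open>The power comes from a polynomial over the integers, so its coefficients are
      integer constants.\<close>
    have int: "poly.coeff ((Polynomial.monom 1 P - 1 :: complex poly poly) ^ Q) l \<in> range (\<lambda>z. [:of_int z:])" for l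
    proof -
      interpret comm_ring_hom "\<lambda>z. [:of_int z:] :: complex poly"
        by standard (auto simp: one_pCons)
      interpret map_poly_comm_ring_hom "\<lambda>z. [:of_int z:] :: complex poly" ..
      have "(Polynomial.monom 1 P - 1 :: complex poly poly) ^ Q
          = map_poly (\<lambda>z. [:of_int z:]) ((Polynomial.monom 1 P - 1) ^ Q)"
        by (simp add: hom_distribs map_poly_monom one_pCons)
      then show ?thesis by (auto simp: coeff_map_poly)
    qed
    have "poly.coeff (poly.coeff ((Polynomial.monom 1 P - 1 :: complex poly poly) ^ Q) l) j \<in> qbar" for l j
      using int[of l] qbar_rat[of "of_int z" for z]
      by (auto simp: coeff_pCons split: nat.splits)
    moreover have "poly.coeff (poly.coeff [:[:0, (-1) ^ Q * c:]:] l) j \<in> qbar" for l j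
      using cq by (auto simp: coeff_pCons intro!: qbar_mult qbar_power qbar_minus split: nat.splits)
    ultimately show ?thesis
      by (auto simp: poly2_qbar_def poly_qbar_def kummer_cover_def intro!: qbar_diff)
  qed
  moreover have fib: "card (fibre (At v) ?f) = degree ?f" if "v \<in> V_points p n" for v
  proof (rule card_fibre_kummer_cover)
    show "c * v \<noteq> 1"
    proof
      assume "c * v = 1"
      then have "c ^ p ^ n * v ^ p ^ n = 1" by (simp flip: power_mult_distrib)
      then have "v ^ p ^ n = 1" using c by simp
      then show False using that by (simp add: V_points_def)
    qed
  qed (use pos c0 cq that in \<open>auto simp: V_points_def\<close>)
  moreover have "\<exists>v\<in>V_points p n. \<exists>e. card (closure_galois_group v ?f) = p ^ e"
  proof (intro bexI)
    \<comment> \<open>The closure has to be examined at one point only; 2 lies in every V_n because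
      its absolute value is neither 0 nor 1.\<close>
    have "(2 :: complex) ^ (p ^ n) \<noteq> 1"
    proof
      assume "(2 :: complex) ^ (p ^ n) = 1"
      then have "norm (2 :: complex) = norm (1 :: complex)"
        using pos by (intro power_eq_imp_eq_norm[of _ "p ^ n"]) auto
      then show False by simp
    qed
    then show V: "2 \<in> V_points p n"
      using qbar_rat[of 2] by (simp add: V_points_def)
    have c2: "c * 2 \<noteq> 0" "c * 2 \<noteq> 1"
    proof -
      have "norm c = norm (1 :: complex)"
        using c pos by (intro power_eq_imp_eq_norm[of _ "p ^ n"]) auto
      then have "norm (c * 2) = 2" by (simp add: norm_mult)
      then have "norm (c * 2) \<noteq> norm (0 :: complex)" "norm (c * 2) \<noteq> norm (1 :: complex)"
        by (simp_all del: norm_mult)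
      then show "c * 2 \<noteq> 0" "c * 2 \<noteq> 1" by metis+
    qed
    have fin: "finite (fibre (At 2) ?f)"
      using fib[OF V] degree_kummer_cover[of P Q c] pos by (intro card_ge_0_finite) simp
    have fibe: "fibre (At 2) ?f = {\<rho> \<in> qbar_fps. (1 - \<rho> ^ P) ^ Q = fps_const c * (fps_const 2 + fps_X)}"
      using pos by (simp add: fibre_kummer_cover coordinate_def)
    let ?S = "splitting_ring 2 ?f" and ?A = "fps_const c * (fps_const 2 + fps_X) :: complex fps"
    have cS: "fps_const a \<in> ?S" if "a \<in> qbar" for a
      using splitting_ring.intros(1)[of "[:a:]" 2 ?f] that
      by (auto simp: poly_qbar_def coeff_pCons split: nat.splits)
    have Apoly: "\<exists>q. poly_qbar q \<and> ?A = expand_coeff (At 2) 1 q"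
    proof (intro exI conjI)
      show "?A = expand_coeff (At 2) 1 [:0, c:]" by (simp add: coordinate_def)
      show "poly_qbar [:0, c:]" using cq by (auto simp: poly_qbar_def coeff_pCons split: nat.splits)
    qed
    have powS: "x ^ k \<in> ?S" if "x \<in> ?S" for x k
      using that cS[of 1] by (induction k) (auto intro: splitting_ring.intros(4))
    have subS: "1 - x \<in> ?S" if "x \<in> ?S" for x
    proof -
      have "fps_const 1 + fps_const (-1) * x \<in> ?S"
        using that by (intro splitting_ring.intros(3,4) cS qbar_minus qbar_1)
      then show ?thesis by (simp flip: fps_const_neg)
    qed
    have itS: "(\<phi> ^^ k) x \<in> ?S" if "\<phi> \<in> closure_galois_group 2 ?f" "x \<in> ?S" for \<phi> x k
      using that(2) by (induction k) (auto simp: closure_galois_groupD[OF that(1)])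
    have fixc: "\<phi> (fps_const a) = fps_const a" if "\<phi> \<in> closure_galois_group 2 ?f" "a \<in> qbar" for \<phi> a
      using closure_galois_groupD(4)[OF that(1), of "[:a:]"] that(2)
      by (auto simp: poly_qbar_def coeff_pCons split: nat.splits)
    have hpow: "\<phi> (x ^ k) = \<phi> x ^ k" if "\<phi> \<in> closure_galois_group 2 ?f" "x \<in> ?S" for \<phi> x k
      using that(2) powS[OF that(2)] fixc[OF that(1), of 1]
      by (induction k) (auto simp: closure_galois_groupD[OF that(1)])
    have hsub: "\<phi> (1 - x) = 1 - \<phi> x" if "\<phi> \<in> closure_galois_group 2 ?f" "x \<in> ?S" for \<phi> x
    proof -
      have "1 - x = fps_const 1 + fps_const (-1) * x" by (simp flip: fps_const_neg)
      also have "\<phi> \<dots> = fps_const 1 + fps_const (-1) * \<phi> x"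
        using that fixc[OF that(1), of 1] fixc[OF that(1), of "-1"]
        by (simp add: closure_galois_groupD[OF that(1)] cS qbar_minus splitting_ring.intros(3,4) del: fps_const_neg fps_const_1_eq_1)
      also have "\<dots> = 1 - \<phi> x" by (simp flip: fps_const_neg)
      finally show ?thesis .
    qed
    have eq: "(1 - \<phi> \<rho> ^ P) ^ Q = ?A" "\<phi> \<rho> \<in> fibre (At 2) ?f"
      if "\<phi> \<in> closure_galois_group 2 ?f" "\<rho> \<in> fibre (At 2) ?f" for \<phi> \<rho>
    proof -
      have r: "\<rho> \<in> ?S" using that(2) by (rule splitting_ring.intros)
      have "(1 - \<phi> \<rho> ^ P) ^ Q = \<phi> ((1 - \<rho> ^ P) ^ Q)"
        using that r by (simp add: hpow hsub subS powS)
      also have "\<dots> = \<phi> ?A" using that fibe by simp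
      also have "\<dots> = ?A"
      proof -
        obtain q where "poly_qbar q" "?A = expand_coeff (At 2) 1 q" using Apoly by blast
        then show ?thesis using closure_galois_groupD(4)[OF that(1), of q] by simp
      qed
      finally show *: "(1 - \<phi> \<rho> ^ P) ^ Q = ?A" .
      have "\<phi> \<rho> \<in> qbar_fps"
        by (rule qbar_fps_if_equation[OF _ _ _ _ _ _ *]) (use pos c0 cq c2 qbar_rat[of 2] in auto)
      then show "\<phi> \<rho> \<in> fibre (At 2) ?f" using * fibe by simp
    qed
    have eig: "(\<phi> ^^ k) (fps_const \<omega> * x) = fps_const \<omega> * (\<phi> ^^ k) x"
      if "\<phi> \<in> closure_galois_group 2 ?f" "\<omega> \<in> qbar" "x \<in> ?S" for \<phi> \<omega> x k
      using that by (induction k) (auto simp: closure_galois_groupD[OF that(1)] cS itS fixc)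
    \<comment> \<open>Stated for any map commuting with algebraic scalars, because it is applied to
      an automorphism and again to its Q-th iterate.\<close>
    have orb: "(\<psi> ^^ k) x = fps_const (\<omega> ^ k) * x"
      if "\<And>\<omega> x. \<omega> \<in> qbar \<Longrightarrow> x \<in> ?S \<Longrightarrow> \<psi> (fps_const \<omega> * x) = fps_const \<omega> * \<psi> x" "\<omega> \<in> qbar" "x \<in> ?S" "\<psi> x = fps_const \<omega> * x" for \<psi> \<omega> x k
      using that by (induction k) (auto simp: qbar_power simp flip: fps_const_mult simp del: fps_const_power)
    show "\<exists>e. card (closure_galois_group 2 ?f) = p ^ e"
    proof (rule card_closure_galois_group_prime_power[OF p fin, where e = "M + N"])
      fix \<phi> \<rho> assume \<phi>: "\<phi> \<in> closure_galois_group 2 ?f" and \<rho>: "\<rho> \<in> fibre (At 2) ?f"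
      show "\<phi> \<rho> \<in> fibre (At 2) ?f" using eq \<phi> \<rho> by blast
      have r: "\<rho> \<in> ?S" using \<rho> by (rule splitting_ring.intros)
      define y where "y = 1 - \<rho> ^ P"
      have yS: "y \<in> ?S" unfolding y_def by (intro subS powS r)
      have "\<phi> y ^ Q = y ^ Q"
        using eq[OF \<phi> \<rho>] \<rho> fibe \<phi> r by (simp add: y_def hsub hpow powS)
      then obtain \<omega> where \<omega>: "\<omega> ^ Q = 1" "\<phi> y = fps_const \<omega> * y"
        using fps_equal_powers[OF _ pos(2)] by blast
      have "(\<phi> ^^ Q) y = fps_const (\<omega> ^ Q) * y"
        by (rule orb) (use \<omega> pos yS eig[OF \<phi>, of _ _ 1] in \<open>auto intro: qbar_root_unity\<close>)
      then have y: "(\<phi> ^^ Q) y = y" using \<omega> by simp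
      have "(\<phi> ^^ k) y = 1 - (\<phi> ^^ k) \<rho> ^ P" for k
        unfolding y_def using \<phi> r by (induction k) (auto simp: hsub hpow powS itS)
      with y have "(\<phi> ^^ Q) \<rho> ^ P = \<rho> ^ P" by (simp add: y_def)
      then obtain \<omega>' where \<omega>': "\<omega>' ^ P = 1" "(\<phi> ^^ Q) \<rho> = fps_const \<omega>' * \<rho>"
        using fps_equal_powers[OF _ pos(1)] by blast
      have "((\<phi> ^^ Q) ^^ P) \<rho> = fps_const (\<omega>' ^ P) * \<rho>"
        by (rule orb) (use \<omega>' pos r eig[OF \<phi>] in \<open>auto intro: qbar_root_unity\<close>)
      then show "(\<phi> ^^ (p ^ (M + N))) \<rho> = \<rho>"
        using \<omega>' by (simp add: P Q power_add funpow_mult mult.commute)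
    qed
  qed
  ultimately show ?thesis
    using irreducible_kummer_cover[of P Q c] lead_coeff_kummer_cover[of P Q c] pos c0
    by (simp add: covers_def)
qed

section \<open>Paths as a groupoid, and the character by which they act on a Kummer fibre\<close>

section \<open>The groupoid of paths\<close>

lemma etale_pathsD:
  assumes "\<gamma> \<in> etale_paths p n b c" "f \<in> covers p n"
  shows "\<gamma> f \<in> extensional (fibre b f)" "bij_betw (\<gamma> f) (fibre b f) (fibre c f)"
    "\<rho> \<in> fibre b f \<Longrightarrow> \<gamma> f \<rho> \<in> fibre c f"
    "g \<in> covers p n \<Longrightarrow> d \<noteq> 0 \<Longrightarrow> poly_qbar d \<Longrightarrow> poly2_qbar h \<Longrightarrow> \<rho> \<in> fibre b g \<Longrightarrow> \<rho>' \<in> fibre b f \<Longrightarrow>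
       morphism_maps b g f d h \<rho> \<rho>' \<longleftrightarrow> morphism_maps c g f d h (\<gamma> g \<rho>) (\<gamma> f \<rho>')"
  using assms by (auto simp: etale_paths_def bij_betw_def)

lemma path_comp_in_etale_paths:
  assumes "\<delta> \<in> etale_paths p n b c" "\<gamma> \<in> etale_paths p n c d"
  shows "path_comp p n b \<gamma> \<delta> \<in> etale_paths p n b d"
proof -
  have "bij_betw (compose (fibre b f) (\<gamma> f) (\<delta> f)) (fibre b f) (fibre d f)" if "f \<in> covers p n" for f
    by (rule bij_betw_compose[OF etale_pathsD(2)[OF assms(1) that] etale_pathsD(2)[OF assms(2) that]])
  moreover have "morphism_maps b g f e h \<rho> \<rho>' \<longleftrightarrow>
      morphism_maps d g f e h (\<gamma> g (\<delta> g \<rho>)) (\<gamma> f (\<delta> f \<rho>'))"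
    if "f \<in> covers p n" "g \<in> covers p n" "e \<noteq> 0" "poly_qbar e" "poly2_qbar h"
      "\<rho> \<in> fibre b g" "\<rho>' \<in> fibre b f" for f g e h \<rho> \<rho>'
    using etale_pathsD(4)[OF assms(1) that]
      etale_pathsD(4)[OF assms(2) that(1-5) etale_pathsD(3)[OF assms(1) that(2,6)]
        etale_pathsD(3)[OF assms(1) that(1,7)]]
    by (rule trans)
  ultimately show ?thesis
    by (simp add: etale_paths_def path_comp_def compose_def)
qed

lemma path_inverse_in_etale_paths:
  assumes "\<gamma> \<in> etale_paths p n b c"
  shows "path_inverse p n b c \<gamma> \<in> etale_paths p n c b"
proof -
  let ?i = "\<lambda>f. inv_into (fibre b f) (\<gamma> f)"
  have i: "?i f \<rho> \<in> fibre b f" "\<gamma> f (?i f \<rho>) = \<rho>" if "f \<in> covers p n" "\<rho> \<in> fibre c f" for f \<rho>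
    using etale_pathsD(2)[OF assms that(1)] that(2)
    by (simp_all add: bij_betw_def inv_into_into f_inv_into_f)
  have "bij_betw (\<lambda>\<rho>\<in>fibre c f. ?i f \<rho>) (fibre c f) (fibre b f)" if "f \<in> covers p n" for f
    using bij_betw_inv_into[OF etale_pathsD(2)[OF assms that]] by simp
  moreover have "morphism_maps c g f e h \<rho> \<rho>' \<longleftrightarrow> morphism_maps b g f e h (?i g \<rho>) (?i f \<rho>')"
    if "f \<in> covers p n" "g \<in> covers p n" "e \<noteq> 0" "poly_qbar e" "poly2_qbar h"
      "\<rho> \<in> fibre c g" "\<rho>' \<in> fibre c f" for f g e h \<rho> \<rho>'
    using etale_pathsD(4)[OF assms that(1-5), of "?i g \<rho>" "?i f \<rho>'"] i that by simp
  ultimately show ?thesis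
    by (simp add: etale_paths_def path_inverse_def)
qed

lemma path_inverse_comp:
  assumes "\<gamma> \<in> etale_paths p n b c"
  shows "path_comp p n b (path_inverse p n b c \<gamma>) \<gamma> = (\<lambda>f\<in>covers p n. \<lambda>\<rho>\<in>fibre b f. \<rho>)"
proof
  fix f
  show "path_comp p n b (path_inverse p n b c \<gamma>) \<gamma> f = (\<lambda>f\<in>covers p n. \<lambda>\<rho>\<in>fibre b f. \<rho>) f"
  proof (cases "f \<in> covers p n")
    case True
    have "inj_on (\<gamma> f) (fibre b f)" using etale_pathsD(2)[OF assms True] by (simp add: bij_betw_def)
    then show ?thesis using True etale_pathsD(3)[OF assms True]
      by (auto simp: path_comp_def path_inverse_def compose_def fun_eq_iff)
  qed (simp add: path_comp_def)
qed

lemma pi1_simps: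
  "carrier (pi1 p n) = etale_paths p n Tangent01 Tangent01"
  "\<gamma> \<otimes>\<^bsub>pi1 p n\<^esub> \<delta> = path_comp p n Tangent01 \<gamma> \<delta>"
  "\<one>\<^bsub>pi1 p n\<^esub> = (\<lambda>f\<in>covers p n. \<lambda>\<rho>\<in>fibre Tangent01 f. \<rho>)"
  by (simp_all add: pi1_def)

lemma pi1_mult_apply:
  "f \<in> covers p n \<Longrightarrow> \<rho> \<in> fibre Tangent01 f \<Longrightarrow> (\<gamma> \<otimes>\<^bsub>pi1 p n\<^esub> \<delta>) f \<rho> = \<gamma> f (\<delta> f \<rho>)"
  by (simp add: pi1_simps path_comp_def compose_def)

lemma group_pi1: "group (pi1 p n)"
proof (rule groupI; unfold pi1_simps)
  show "(\<lambda>f\<in>covers p n. \<lambda>\<rho>\<in>fibre Tangent01 f. \<rho>) \<in> etale_paths p n Tangent01 Tangent01"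
    by (simp add: etale_paths_def bij_betw_def inj_on_def)
  fix x assume x: "x \<in> etale_paths p n Tangent01 Tangent01"
  show "path_comp p n Tangent01 (\<lambda>f\<in>covers p n. \<lambda>\<rho>\<in>fibre Tangent01 f. \<rho>) x = x"
  proof
    fix f
    show "path_comp p n Tangent01 (\<lambda>f\<in>covers p n. \<lambda>\<rho>\<in>fibre Tangent01 f. \<rho>) x f = x f"
    proof (cases "f \<in> covers p n")
      case True
      then show ?thesis
        using etale_pathsD[OF x True]
        by (auto simp: path_comp_def compose_def fun_eq_iff extensional_def)
    next
      case False
      then show ?thesis using x by (simp add: path_comp_def etale_paths_def extensional_def)
    qed
  qed
  show "\<exists>y\<in>etale_paths p n Tangent01 Tangent01.
      path_comp p n Tangent01 y x = (\<lambda>f\<in>covers p n. \<lambda>\<rho>\<in>fibre Tangent01 f. \<rho>)"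
    using path_inverse_in_etale_paths[OF x] path_inverse_comp[OF x] by blast
  fix y z assume y: "y \<in> etale_paths p n Tangent01 Tangent01" and z: "z \<in> etale_paths p n Tangent01 Tangent01"
  show "path_comp p n Tangent01 x y \<in> etale_paths p n Tangent01 Tangent01"
    using path_comp_in_etale_paths x y by blast
  show "path_comp p n Tangent01 (path_comp p n Tangent01 x y) z
      = path_comp p n Tangent01 x (path_comp p n Tangent01 y z)"
    using etale_pathsD(3)[OF z] by (auto simp: path_comp_def compose_def fun_eq_iff)
qed

lemma pi1_pow_apply:
  assumes "f \<in> covers p n" "\<And>\<rho>. \<rho> \<in> fibre Tangent01 f \<Longrightarrow> \<gamma> f \<rho> \<in> fibre Tangent01 f"
    "\<rho> \<in> fibre Tangent01 f"
  shows "(\<gamma> [^]\<^bsub>pi1 p n\<^esub> (l :: nat)) f \<rho> = (\<gamma> f ^^ l) \<rho>"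
  using assms(3)
proof (induction l arbitrary: \<rho>)
  case 0
  then show ?case using assms(1) by (simp add: nat_pow_def pi1_simps)
next
  case (Suc l)
  have "(\<gamma> [^]\<^bsub>pi1 p n\<^esub> Suc l) f \<rho> = (\<gamma> [^]\<^bsub>pi1 p n\<^esub> l) f (\<gamma> f \<rho>)"
    using Suc.prems assms(1) by (simp add: nat_pow_def pi1_mult_apply)
  then show ?case using Suc assms(2) by (simp add: funpow_swap1)
qed

lemma pi1_pow_extensional:
  assumes "f \<in> covers p n"
  shows "(\<gamma> [^]\<^bsub>pi1 p n\<^esub> (l :: nat)) f \<in> extensional (fibre Tangent01 f)"
  using assms by (cases l) (auto simp: nat_pow_def pi1_simps path_comp_def compose_def)

lemma zp_mod_bounds: "0 \<le> zp_mod a N" "zp_mod a N < int CARD('p) ^ N" for a :: "'p::prime_card zp"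
proof -
  have "int CARD('p) ^ N > 0" by simp
  then show "0 \<le> zp_mod a N" "zp_mod a N < int CARD('p) ^ N"
    using zp_mod_mod[of a N] by (metis pos_mod_sign, metis pos_mod_bound)
qed

text \<open>If the action on the fibre has period p^M, the powers with exponent a mod p^N agree for
  all N from M on, and their common value is the limit. Only the behaviour of \<gamma> on this one
  fibre enters, so loops given by formulas are covered.\<close>

lemma padic_power_apply:
  fixes a :: "'p::prime_card zp"
  assumes f: "f \<in> covers CARD('p) n"
    and fib: "\<And>\<rho>. \<rho> \<in> fibre Tangent01 f \<Longrightarrow> \<gamma> f \<rho> \<in> fibre Tangent01 f"
    and per: "\<And>\<rho>. \<rho> \<in> fibre Tangent01 f \<Longrightarrow> (\<gamma> f ^^ (CARD('p) ^ M)) \<rho> = \<rho>"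
    and \<rho>: "\<rho> \<in> fibre Tangent01 f"
  shows "padic_power n \<gamma> a f \<rho> = (\<gamma> f ^^ nat (zp_mod a M)) \<rho>"
proof -
  let ?pw = "\<lambda>N. (\<gamma> [^]\<^bsub>pi1 CARD('p) n\<^esub> nat (zp_mod a N)) f"
  have it: "(\<gamma> f ^^ l) \<rho> \<in> fibre Tangent01 f" if "\<rho> \<in> fibre Tangent01 f" for l \<rho>
    using that by (induction l) (auto simp: fib)
  have per': "(\<gamma> f ^^ (CARD('p) ^ M * q)) \<rho> = \<rho>" if "\<rho> \<in> fibre Tangent01 f" for q \<rho>
    using that per it by (induction q) (auto simp: funpow_add)
  have stable: "?pw N = ?pw M" if "M \<le> N" for N
  proof (rule extensionalityI[OF pi1_pow_extensional[OF f] pi1_pow_extensional[OF f]])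
    fix \<rho> assume \<rho>: "\<rho> \<in> fibre Tangent01 f"
    have "nat (zp_mod a N) mod CARD('p) ^ M = nat (zp_mod a M)"
      using nat_mod_distrib[of "zp_mod a N" "int CARD('p) ^ M"] zp_mod_mod_le[OF that, of a]
        zp_mod_bounds(1)[of a N] by (simp add: nat_power_eq)
    then have "nat (zp_mod a N) = nat (zp_mod a M) + CARD('p) ^ M * (nat (zp_mod a N) div CARD('p) ^ M)"
      using mod_mult_div_eq[of "nat (zp_mod a N)" "CARD('p) ^ M"] by simp
    then have "(\<gamma> f ^^ nat (zp_mod a N)) \<rho> = (\<gamma> f ^^ nat (zp_mod a M)) \<rho>"
      using per'[OF \<rho>] by (metis comp_apply funpow_add)
    then show "?pw N \<rho> = ?pw M \<rho>"
      by (simp only: pi1_pow_apply[where \<gamma> = \<gamma>, OF f fib \<rho>])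
  qed
  have "(THE \<phi>. \<exists>N0. \<forall>N\<ge>N0. \<phi> = ?pw N) = ?pw M"
  proof (rule the_equality)
    show "\<exists>N0. \<forall>N\<ge>N0. ?pw M = ?pw N" using stable by metis
    fix \<phi> assume "\<exists>N0. \<forall>N\<ge>N0. \<phi> = ?pw N"
    then obtain N0 where "\<And>N. N \<ge> N0 \<Longrightarrow> \<phi> = ?pw N" by blast
    from this[of "max N0 M"] show "\<phi> = ?pw M" using stable[of "max N0 M"] by simp
  qed
  then show ?thesis
    using f \<rho> pi1_pow_apply[where \<gamma> = \<gamma>, OF f fib \<rho>] by (simp add: padic_power_def)
qed

section \<open>Scalar actions on the fibre of a Kummer cover\<close>

text \<open>The branch of (1 - c t^P)^(1/P) with value 1 at t = 0. For t = z^(1/P) it is a root of 1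
  - c z, for t = z^(1/(P Q)) a root of 1 - c z^(1/Q).\<close>

definition kummer_series :: "nat \<Rightarrow> complex \<Rightarrow> complex fps" where
  "kummer_series P c = fps_binomial (1 / of_nat P) oo (fps_const (- c) * fps_X ^ P)"

lemma kummer_series_power:
  assumes "0 < P"
  shows "kummer_series P c ^ P = 1 - fps_const c * fps_X ^ P"
proof -
  let ?B = "fps_const (- c) * fps_X ^ P :: complex fps"
  have B0: "fps_nth ?B 0 = 0" using assms by simp
  have "kummer_series P c ^ P = (1 + fps_X) oo ?B"
    unfolding kummer_series_def fps_compose_power[OF B0] using assms
    by (simp add: fps_binomial_power fps_binomial_1 del: fps_const_neg)
  also have "\<dots> = 1 + ?B"
    using B0 by (simp add: fps_compose_add_distrib del: fps_const_neg)
  also have "\<dots> = 1 - fps_const c * fps_X ^ P"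
    by (simp flip: fps_const_neg)
  finally show ?thesis .
qed

lemma kummer_series_nth_0: "0 < P \<Longrightarrow> fps_nth (kummer_series P c) 0 = 1"
  by (simp add: kummer_series_def)

lemma kummer_series_qbar: "c \<in> qbar \<Longrightarrow> kummer_series P c \<in> qbar_fps"
  unfolding kummer_series_def
  by (intro qbar_fps_compose qbar_fps_binomial qbar_fps_mult qbar_fps_power) (auto intro: qbar_minus)

text \<open>One power series is a point of two covers: of V_n with Q = 1 and d = c, and of V_0 with
  d = c^Q = 1. This coincidence makes the lifting condition for paths directly applicable.\<close>

lemma kummer_series_in_fibre:
  assumes "0 < P" "0 < Q" "c \<in> qbar" "c ^ Q = d"
  shows "kummer_series P c \<in> fibre Tangent01 (kummer_cover P Q d)"
  using assms
  by (auto simp: fibre_kummer_cover coordinate_def kummer_series_qbar kummer_series_power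
      power_mult_distrib power_mult simp flip: fps_const_power)

lemma fibre_Tangent01_kummer_cover:
  assumes "0 < P" "c \<in> qbar"
  shows "fibre Tangent01 (kummer_cover P 1 c) = (\<lambda>\<omega>. fps_const \<omega> * kummer_series P c) ` {\<omega>. \<omega> ^ P = 1}"
proof (intro equalityI subsetI)
  fix \<rho> assume "\<rho> \<in> fibre Tangent01 (kummer_cover P 1 c)"
  then have "1 - \<rho> ^ P = fps_const c * fps_X ^ P"
    using assms by (simp add: fibre_kummer_cover coordinate_def)
  then have "\<rho> ^ P = kummer_series P c ^ P"
    using assms by (simp add: kummer_series_power algebra_simps)
  then obtain \<omega> where "\<omega> ^ P = 1" "\<rho> = fps_const \<omega> * kummer_series P c"
    by (rule fps_equal_powers) (use assms in auto)
  then show "\<rho> \<in> (\<lambda>\<omega>. fps_const \<omega> * kummer_series P c) ` {\<omega>. \<omega> ^ P = 1}" by blast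
next
  fix \<rho> assume "\<rho> \<in> (\<lambda>\<omega>. fps_const \<omega> * kummer_series P c) ` {\<omega>. \<omega> ^ P = 1}"
  then obtain \<omega> where \<omega>: "\<omega> ^ P = 1" "\<rho> = fps_const \<omega> * kummer_series P c" by blast
  then have "\<omega> \<in> qbar" using assms by (auto intro: qbar_root_unity)
  then show "\<rho> \<in> fibre Tangent01 (kummer_cover P 1 c)"
    using assms \<omega>
    by (auto simp: fibre_kummer_cover coordinate_def power_mult_distrib kummer_series_power fps_const_power
        intro!: qbar_fps_mult kummer_series_qbar)
qed

lemma scalar_in_fibre:
  assumes "0 < P" "c \<in> qbar" "\<omega> ^ P = 1" "\<rho> \<in> fibre Tangent01 (kummer_cover P 1 c)"
  shows "fps_const \<omega> * \<rho> \<in> fibre Tangent01 (kummer_cover P 1 c)"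
proof -
  have "\<omega> \<in> qbar" using assms by (auto intro: qbar_root_unity)
  then show ?thesis using assms
    by (auto simp: fibre_kummer_cover power_mult_distrib fps_const_power intro!: qbar_fps_mult)
qed

text \<open>The pair with denominator 1 and numerator \<omega> w presents the deck transformation w
  -> \<omega> w; compatibility of a path with it means commuting with \<omega>.\<close>

lemma morphism_maps_scalar:
  assumes "0 < degree g"
  shows "morphism_maps b g g 1 [:0, [:\<omega>:]:] \<rho> \<rho>' \<longleftrightarrow> \<rho>' = fps_const \<omega> * \<rho>"
proof -
  have ev: "expand_eval b N [:0, [:\<omega>:]:] y = fps_const \<omega> * y" for N y
  proof -
    have "map_poly (expand_coeff b N) [:0, [:\<omega>:]:] = [:0, fps_const \<omega>:]"
      by (simp add: poly_eq_iff coeff_map_poly coeff_pCons split: nat.splits)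
    then show ?thesis by (simp add: expand_eval_def mult.commute)
  qed
  have "fps_const \<omega> * refine_series b (degree g) \<rho> = refine_series b (degree g) (fps_const \<omega> * \<rho>)"
    using assms by (simp add: refine_series_def fps_compose_mult_distrib split: basepoint.splits)
  moreover have "refine_series b (degree g) x = refine_series b (degree g) y \<longleftrightarrow> x = y" for x y
    using fps_compose_X_power_inj[of x "degree g" y] assms
    by (auto simp: refine_series_def split: basepoint.splits)
  ultimately show ?thesis
    by (simp add: morphism_maps_def ev)
qed

locale kummer_fibre =
  fixes p n N :: nat and c :: complex
  assumes p: "prime p" and c: "c ^ (p ^ n) = 1"
begin

definition "P = p ^ N"
definition "f = kummer_cover P 1 c"

lemma P_pos: "0 < P"
  using p by (simp add: P_def prime_gt_0_nat)

lemma c_qbar: "c \<in> qbar"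
  using p c by (auto intro!: qbar_root_unity[of c "p ^ n"] simp: prime_gt_0_nat)

lemma f_covers: "f \<in> covers p n"
  unfolding f_def using p c kummer_cover_in_covers[of p P N 1 0 c n] by (simp add: P_def)

lemma degree_f: "degree f = P"
  using degree_kummer_cover[of P 1 c] P_pos by (simp add: f_def)

lemma path_scalar:
  assumes "\<gamma> \<in> etale_paths p n Tangent01 b" "\<omega> ^ P = 1" "\<rho> \<in> fibre Tangent01 f"
  shows "\<gamma> f (fps_const \<omega> * \<rho>) = fps_const \<omega> * \<gamma> f \<rho>"
proof -
  have w: "\<omega> \<in> qbar" using assms(2) P_pos by (rule qbar_root_unity)
  have fib: "fps_const \<omega> * \<rho> \<in> fibre Tangent01 f"
    using assms scalar_in_fibre[OF P_pos c_qbar] by (simp add: f_def)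
  have q1: "poly_qbar 1" by (auto simp: poly_qbar_def)
  have q2: "poly2_qbar [:0, [:\<omega>:]:]"
    using w by (auto simp: poly2_qbar_def poly_qbar_def coeff_pCons split: nat.splits)
  have d: "0 < degree f" using degree_f P_pos by simp
  show ?thesis
    using etale_pathsD(4)[OF assms(1) f_covers f_covers _ q1 q2 assms(3) fib]
    unfolding morphism_maps_scalar[OF d] by simp
qed

text \<open>The fibre is a torsor under the P-th roots of unity, and \<gamma> translates it by
  \<omega>. As a relation on arbitrary path families it applies to \<open>loop_x\<close>,
  \<open>loop_y\<close> and \<open>padic_power\<close>, which are given by formulas.\<close>

definition "acts \<gamma> \<omega> \<longleftrightarrow> \<omega> ^ P = 1 \<and> (\<forall>\<rho>\<in>fibre Tangent01 f. \<gamma> f \<rho> = fps_const \<omega> * \<rho>)"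

lemma acts_apply: "acts \<gamma> \<omega> \<Longrightarrow> \<rho> \<in> fibre Tangent01 f \<Longrightarrow> \<gamma> f \<rho> = fps_const \<omega> * \<rho>"
  by (simp add: acts_def)

lemma kummer_series_fibre: "kummer_series P c \<in> fibre Tangent01 f"
  unfolding f_def using P_pos c_qbar by (intro kummer_series_in_fibre) auto

text \<open>The point \<open>kummer_series P c\<close> has constant term 1, so the scalar is visible
  in the constant term of its image.\<close>

lemma acts_unique: "acts \<gamma> \<omega> \<Longrightarrow> acts \<gamma> \<omega>' \<Longrightarrow> \<omega> = \<omega>'"
proof -
  assume "acts \<gamma> \<omega>" "acts \<gamma> \<omega>'"
  then have "fps_const \<omega> * kummer_series P c = fps_const \<omega>' * kummer_series P c"
    using acts_apply[OF _ kummer_series_fibre] by metis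
  then have "fps_nth (fps_const \<omega> * kummer_series P c) 0 = fps_nth (fps_const \<omega>' * kummer_series P c) 0"
    by (rule arg_cong)
  then show ?thesis using P_pos by (simp only: fps_mult_left_const_nth kummer_series_nth_0 mult_1_right)
qed

lemma fibre_f: "fibre Tangent01 f = (\<lambda>\<omega>. fps_const \<omega> * kummer_series P c) ` {\<omega>. \<omega> ^ P = 1}"
  unfolding f_def by (rule fibre_Tangent01_kummer_cover[OF P_pos c_qbar])

lemma acts_in_fibre: "acts \<gamma> \<omega> \<Longrightarrow> \<rho> \<in> fibre Tangent01 f \<Longrightarrow> \<gamma> f \<rho> \<in> fibre Tangent01 f"
  using scalar_in_fibre[OF P_pos c_qbar] by (simp add: acts_def f_def)

lemma actsI:
  assumes "\<And>\<omega>. \<omega> ^ P = 1 \<Longrightarrow> \<gamma> f (fps_const \<omega> * kummer_series P c) = fps_const \<omega>' * (fps_const \<omega> * kummer_series P c)"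
    "\<omega>' ^ P = 1"
  shows "acts \<gamma> \<omega>'"
  using assms by (auto simp: acts_def fibre_f)

text \<open>A map of a torsor that commutes with the group is determined by one value, hence is a
  translation.\<close>

lemma carrier_acts:
  assumes "\<gamma> \<in> carrier (pi1 p n)"
  obtains \<omega> where "acts \<gamma> \<omega>"
proof -
  have \<gamma>: "\<gamma> \<in> etale_paths p n Tangent01 Tangent01" using assms by (simp add: pi1_simps)
  have "\<gamma> f (kummer_series P c) \<in> fibre Tangent01 f"
    by (rule etale_pathsD(3)[OF \<gamma> f_covers kummer_series_fibre])
  then obtain \<omega>' where \<omega>': "\<omega>' ^ P = 1" "\<gamma> f (kummer_series P c) = fps_const \<omega>' * kummer_series P c"
    by (auto simp: fibre_f)
  have "acts \<gamma> \<omega>'"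
  proof (rule actsI)
    fix \<omega> :: complex assume "\<omega> ^ P = 1"
    then show "\<gamma> f (fps_const \<omega> * kummer_series P c) = fps_const \<omega>' * (fps_const \<omega> * kummer_series P c)"
      using path_scalar[OF \<gamma> _ kummer_series_fibre] \<omega>' by (simp add: mult.left_commute)
  qed (rule \<omega>')
  then show ?thesis by (rule that)
qed

lemma acts_one: "acts \<one>\<^bsub>pi1 p n\<^esub> 1"
  using f_covers by (simp add: acts_def pi1_simps)

lemma acts_mult:
  assumes "acts \<gamma> \<omega>" "acts \<delta> \<omega>'"
  shows "acts (\<gamma> \<otimes>\<^bsub>pi1 p n\<^esub> \<delta>) (\<omega> * \<omega>')"
  using assms acts_in_fibre[OF assms(2)]
  by (auto simp: acts_def pi1_mult_apply[OF f_covers] power_mult_distrib mult.assoc simp flip: fps_const_mult)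

lemma acts_funpow:
  assumes "acts \<gamma> \<omega>" "\<rho> \<in> fibre Tangent01 f"
  shows "(\<gamma> f ^^ l) \<rho> = fps_const (\<omega> ^ l) * \<rho>" "(\<gamma> f ^^ l) \<rho> \<in> fibre Tangent01 f"
proof -
  have "(\<gamma> f ^^ l) \<rho> = fps_const (\<omega> ^ l) * \<rho> \<and> (\<gamma> f ^^ l) \<rho> \<in> fibre Tangent01 f"
  proof (induction l)
    case (Suc l)
    have "\<gamma> f ((\<gamma> f ^^ l) \<rho>) = fps_const \<omega> * (fps_const (\<omega> ^ l) * \<rho>)"
      using acts_apply[OF assms(1) conjunct2[OF Suc]] conjunct1[OF Suc] by simp
    moreover have "\<gamma> f ((\<gamma> f ^^ l) \<rho>) \<in> fibre Tangent01 f"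
      using acts_in_fibre[OF assms(1)] Suc by blast
    ultimately show ?case by (simp add: mult.assoc flip: fps_const_mult del: fps_const_power)
  qed (use assms in auto)
  then show "(\<gamma> f ^^ l) \<rho> = fps_const (\<omega> ^ l) * \<rho>" "(\<gamma> f ^^ l) \<rho> \<in> fibre Tangent01 f" by auto
qed

lemma acts_padic_power:
  fixes a :: "'p::prime_card zp"
  assumes "acts \<gamma> \<omega>" and pC: "p = CARD('p)"
  shows "acts (padic_power n \<gamma> a) (\<omega> ^ nat (zp_mod a N))"
proof -
  have "padic_power n \<gamma> a f \<rho> = fps_const (\<omega> ^ nat (zp_mod a N)) * \<rho>" if "\<rho> \<in> fibre Tangent01 f" for \<rho>
  proof -
    have "padic_power n \<gamma> a f \<rho> = (\<gamma> f ^^ nat (zp_mod a N)) \<rho>"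
    proof (rule padic_power_apply)
      show "f \<in> covers CARD('p) n" using f_covers pC by simp
      show "\<gamma> f \<rho> \<in> fibre Tangent01 f" if "\<rho> \<in> fibre Tangent01 f" for \<rho>
        using acts_in_fibre[OF assms(1) that] .
      show "(\<gamma> f ^^ CARD('p) ^ N) \<rho> = \<rho>" if "\<rho> \<in> fibre Tangent01 f" for \<rho>
        using acts_funpow[OF assms(1) that, of P] assms(1) unfolding pC[symmetric] P_def[symmetric]
        by (simp add: acts_def)
    qed (rule that)
    then show ?thesis using acts_funpow[OF assms(1) that] by simp
  qed
  moreover have "(\<omega> ^ nat (zp_mod a N)) ^ P = 1"
    using assms(1) by (simp add: acts_def flip: power_mult) (simp add: mult.commute power_mult)
  ultimately show ?thesis by (simp add: acts_def)
qed

text \<open>Scalars multiply, so on the fundamental group they form a homomorphism to an abelian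
  group, which kills commutators.\<close>

lemma derived_acts:
  assumes "\<gamma> \<in> derived (pi1 p n) (carrier (pi1 p n))"
  shows "acts \<gamma> 1"
proof -
  interpret group "pi1 p n" by (rule group_pi1)
  \<comment> \<open>The inverse is again a group element and so has some scalar; its product with h
    is the identity, whose scalar can only be 1.\<close>
  have invs: "acts (inv\<^bsub>pi1 p n\<^esub> h) (1 / \<omega>)" if "h \<in> carrier (pi1 p n)" "acts h \<omega>" for h \<omega>
  proof -
    note hc = that(1)
    obtain \<omega>' where w: "acts (inv\<^bsub>pi1 p n\<^esub> h) \<omega>'" by (rule carrier_acts[OF inv_closed[OF hc]])
    have "acts \<one>\<^bsub>pi1 p n\<^esub> (\<omega> * \<omega>')" using acts_mult[OF that(2) w] unfolding r_inv[OF that(1)] .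
    then have eq: "\<omega> * \<omega>' = 1" using acts_unique[OF _ acts_one] by blast
    then have "\<omega> \<noteq> 0" by auto
    then have "\<omega>' = 1 / \<omega>" using eq by (simp add: field_simps)
    then show ?thesis using w by simp
  qed
  show ?thesis
    using assms unfolding derived_def
  proof (induction rule: generate.induct)
    case one
    show ?case by (rule acts_one)
  next
    case (incl h)
    then obtain a b where ab: "a \<in> carrier (pi1 p n)" "b \<in> carrier (pi1 p n)"
      "h = a \<otimes>\<^bsub>pi1 p n\<^esub> b \<otimes>\<^bsub>pi1 p n\<^esub> inv\<^bsub>pi1 p n\<^esub> a \<otimes>\<^bsub>pi1 p n\<^esub> inv\<^bsub>pi1 p n\<^esub> b" by auto
    obtain \<alpha> where \<alpha>: "acts a \<alpha>" by (rule carrier_acts[OF ab(1)])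
    obtain \<beta> where \<beta>: "acts b \<beta>" by (rule carrier_acts[OF ab(2)])
    have "\<alpha> \<noteq> 0" "\<beta> \<noteq> 0" using \<alpha> \<beta> P_pos by (auto simp: acts_def power_0_left)
    moreover have "acts h (\<alpha> * \<beta> * (1 / \<alpha>) * (1 / \<beta>))"
      unfolding ab(3) by (intro acts_mult invs ab(1,2) \<alpha> \<beta>)
    ultimately show ?case by simp
  next
    case (inv h)
    then obtain a b where ab: "a \<in> carrier (pi1 p n)" "b \<in> carrier (pi1 p n)"
      "h = a \<otimes>\<^bsub>pi1 p n\<^esub> b \<otimes>\<^bsub>pi1 p n\<^esub> inv\<^bsub>pi1 p n\<^esub> a \<otimes>\<^bsub>pi1 p n\<^esub> inv\<^bsub>pi1 p n\<^esub> b" by auto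
    obtain \<alpha> where \<alpha>: "acts a \<alpha>" by (rule carrier_acts[OF ab(1)])
    obtain \<beta> where \<beta>: "acts b \<beta>" by (rule carrier_acts[OF ab(2)])
    have "\<alpha> \<noteq> 0" "\<beta> \<noteq> 0" using \<alpha> \<beta> P_pos by (auto simp: acts_def power_0_left)
    moreover have "acts h (\<alpha> * \<beta> * (1 / \<alpha>) * (1 / \<beta>))"
      unfolding ab(3) by (intro acts_mult invs ab(1,2) \<alpha> \<beta>)
    ultimately have "acts h 1" by simp
    moreover have "h \<in> carrier (pi1 p n)" unfolding ab(3) by (intro m_closed inv_closed ab(1,2))
    ultimately show ?case using invs[of h 1] by simp
  next
    case (eng h1 h2)
    then show ?case using acts_mult[of h1 1 h2 1] by simp
  qed
qed

text \<open>On any finite set of covers an element of the closure agrees with one of the derived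
  subgroup; here the set consists of f alone.\<close>

lemma pi1_closure_derived_acts:
  assumes "\<gamma> \<in> pi1_closure p n (derived (pi1 p n) (carrier (pi1 p n)))"
  shows "acts \<gamma> 1"
proof -
  obtain \<delta> where "\<delta> \<in> derived (pi1 p n) (carrier (pi1 p n))" "\<gamma> f = \<delta> f"
    using assms f_covers unfolding pi1_closure_def by (auto dest: spec[of _ "{f}"])
  then show ?thesis using derived_acts by (simp add: acts_def)
qed

end

section \<open>Analytic continuation: the loops, and the endpoint values of the paths\<close>

section \<open>Analytic continuation of Kummer series\<close>

lemma kummer_series_nth:
  assumes "0 < P"
  shows "fps_nth (kummer_series P c) l
    = (if P dvd l then ((1 / of_nat P) gchoose (l div P)) * (- c) ^ (l div P) else 0)"
proof -
  have "fps_const (- c) * fps_X ^ P = (fps_const (- c) * fps_X) oo (fps_X ^ P :: complex fps)"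
    using assms by (simp add: fps_compose_mult_distrib)
  then have "kummer_series P c
      = (fps_binomial (1 / of_nat P) oo (fps_const (- c) * fps_X)) oo fps_X ^ P"
    unfolding kummer_series_def using assms by (simp add: fps_compose_assoc)
  then show ?thesis
    by (simp add: fps_nth_compose_X_power fps_compose_linear del: fps_const_neg)
qed

text \<open>Inside the unit disc the binomial series converges to the principal power; this fixes
  the branch of all later endpoint values.\<close>

lemma kummer_series_sums:
  assumes "0 < P" "norm c \<le> 1" "norm t < 1"
  shows "(\<lambda>l. fps_nth (kummer_series P c) l * t ^ l) sums (1 - c * t ^ P) powr (1 / of_nat P)"
proof -
  have "norm (- (c * t ^ P)) \<le> norm t ^ P"
    using assms by (simp add: norm_mult norm_power mult_left_le_one_le)
  also have "\<dots> < 1" using assms by (simp add: power_less_one_iff)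
  finally have "(\<lambda>k. ((1 / of_nat P) gchoose k) * (- (c * t ^ P)) ^ k)
      sums (1 + - (c * t ^ P)) powr (1 / of_nat P)"
    by (rule gen_binomial_complex)
  moreover have "(- (c * t ^ P)) ^ k = (- c) ^ k * t ^ (P * k)" for k
    by (metis mult_minus_left power_mult power_mult_distrib)
  ultimately have "(\<lambda>k. fps_nth (kummer_series P c) (P * k) * t ^ (P * k))
      sums (1 - c * t ^ P) powr (1 / of_nat P)"
    using assms by (simp add: kummer_series_nth mult.assoc)
  then show ?thesis
    using assms(1)
    by (subst (asm) sums_mono_reindex) (auto simp: strict_mono_def kummer_series_nth)
qed

lemma eval_kummer_series:
  assumes "0 < P" "norm c \<le> 1" "norm t < 1"
  shows "eval_fps (fps_const \<omega> * kummer_series P c) t = \<omega> * (1 - c * t ^ P) powr (1 / of_nat P)"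
  using sums_mult[OF kummer_series_sums[OF assms], of \<omega>]
  by (simp add: eval_fps_def sums_iff mult.assoc)

text \<open>The point t in \<open>radial_value\<close> satisfies t^P = r^(1/Q) exp(i \<theta>/Q), so
  the arc around 0 is felt only through the angle \<theta>/Q.\<close>

lemma radial_kummer_series:
  assumes "0 < P" "0 < Q" "norm c \<le> 1" "0 < r" "r < 1"
  shows "radial_value (P * Q) (fps_const \<omega> * kummer_series P c) \<theta> r
    = \<omega> * (1 - c * (of_real (root Q r) * cis (\<theta> / real Q))) powr (1 / of_nat P)"
proof -
  let ?t = "of_real (root (P * Q) r) * cis (\<theta> / real (P * Q))"
  have "norm ?t < 1" using assms by (simp add: norm_mult real_root_lt_1_iff)
  moreover have "?t ^ P = of_real (root Q r) * cis (\<theta> / real Q)"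
  proof -
    have "root (P * Q) r ^ P = root Q r"
      using assms by (simp add: real_root_mult_exp real_root_pos2 real_root_ge_zero)
    moreover have "cis (\<theta> / real (P * Q)) ^ P = cis (\<theta> / real Q)"
      using assms by (subst Complex.DeMoivre) simp
    ultimately show ?thesis
      by (simp add: power_mult_distrib flip: of_real_power)
  qed
  ultimately show ?thesis
    unfolding radial_value_def using eval_kummer_series[OF assms(1,3)] by simp
qed

text \<open>This keeps 1 - z off the negative axis, where the principal power fails to be
  analytic.\<close>

lemma Re_one_minus_pos:
  assumes "norm z = 1" "z \<noteq> 1"
  shows "0 < Re (1 - z)"
proof (rule ccontr)
  assume "\<not> 0 < Re (1 - z)"
  then have "Re z = 1" using complex_Re_le_cmod[of z] assms by simp
  then have "Im z = 0" using assms(1) by (simp add: cmod_def)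
  with \<open>Re z = 1\<close> show False using assms(2) by (simp add: complex_eq_iff)
qed

lemma not_nonpos_Reals_if_Re_pos: "0 < Re z \<Longrightarrow> z \<notin> \<real>\<^sub>\<le>\<^sub>0"
  by (auto simp: complex_nonpos_Reals_iff)

text \<open>In the coordinate u of \<open>loop_y\<close> two continuations are known to agree for
  real u only; the identity theorem carries this to u + 2 pi i.\<close>

lemma half_plane_identity:
  fixes F G :: "complex \<Rightarrow> complex"
  assumes "F holomorphic_on {u. Re u < a}" "G holomorphic_on {u. Re u < a}"
    and eq: "\<And>x. x < a \<Longrightarrow> F (of_real x) = G (of_real x)"
    and "Re w < a"
  shows "F w = G w"
proof -
  let ?S = "{u. Re u < a}" and ?U = "of_real ` {..<a} :: complex set"
  have "of_real (a - 1) islimpt ?U"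
    unfolding islimpt_approachable
  proof (intro allI impI)
    fix e :: real assume "e > 0"
    then show "\<exists>x'\<in>?U. x' \<noteq> of_real (a - 1) \<and> dist x' (of_real (a - 1)) < e"
      by (intro bexI[of _ "of_real (a - 1 - e / 2)"]) (auto simp: dist_norm simp flip: of_real_diff)
  qed
  moreover have "open ?S" "connected ?S"
    by (auto intro: open_halfspace_Re_lt convex_connected convex_halfspace_Re_lt)
  ultimately have "F w - G w = 0"
    using assms
    by (intro analytic_continuation[of "\<lambda>u. F u - G u" ?S ?U "of_real (a - 1)" w])
       (auto intro!: holomorphic_intros)
  then show ?thesis by simp
qed

lemma root_unity_power_self: "0 < r \<Longrightarrow> root_unity r ^ r = 1"
  by (simp add: root_unity_def flip: exp_of_nat_mult)

lemma root_unity_power_cis: "root_unity r ^ k = cis (2 * pi * real k / real r)"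
  by (simp add: root_unity_def cis_conv_exp flip: exp_of_nat_mult) (simp add: mult_ac)

context kummer_fibre
begin

lemma norm_c: "norm c = 1"
  using power_eq_imp_eq_norm[of c "p ^ n" 1] c p by (simp add: prime_gt_0_nat)

text \<open>The loop multiplies t by a P-th root of unity, and only powers of t^P occur in the
  series.\<close>

lemma loop_x_acts: "acts (loop_x p n) 1"
proof (rule actsI)
  fix \<omega> :: complex assume "\<omega> ^ P = 1"
  then have "fps_const \<omega> * kummer_series P c \<in> fibre Tangent01 f" by (auto simp: fibre_f)
  then have "loop_x p n f (fps_const \<omega> * kummer_series P c)
      = Abs_fps (\<lambda>l. root_unity P ^ l * fps_nth (fps_const \<omega> * kummer_series P c) l)"
    by (simp add: loop_x_def f_covers degree_f)
  also have "\<dots> = fps_const \<omega> * kummer_series P c"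
    using P_pos root_unity_power_self[of P]
    by (auto simp: fps_eq_iff kummer_series_nth power_mult)
  finally show "loop_x p n f (fps_const \<omega> * kummer_series P c) = fps_const 1 * (fps_const \<omega> * kummer_series P c)"
    by simp
qed simp

lemma radial_f:
  assumes "0 < r" "r < 1"
  shows "radial_value (degree f) (fps_const \<omega> * kummer_series P c) \<theta> r
    = \<omega> * (1 - c * cis \<theta> * of_real r) powr (1 / of_nat P)"
  using radial_kummer_series[of P 1 c r \<omega> \<theta>] assms P_pos norm_c by (simp add: degree_f mult_ac)

lemma radial_f_nonzero:
  assumes "0 < r" "r < 1"
  shows "(1 - c * cis \<theta> * of_real r) powr (1 / of_nat P) \<noteq> 0"
proof -
  have "norm (c * cis \<theta> * of_real r) < 1" using assms norm_c by (simp add: norm_mult)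
  then have "1 - c * cis \<theta> * of_real r \<noteq> 0" by (metis eq_iff_diff_eq_0 less_irrefl norm_one)
  then show ?thesis by simp
qed

text \<open>One continuation G evaluates the description in \<open>loop_y\<close>: any other agrees
  with G on a common half plane, hence also after the shift by 2 pi i, and there the nonzero value
  of the root determines the scalar.\<close>

lemma loop_y_eqI:
  assumes "\<omega> ^ P = 1" "\<omega>' ^ P = 1" "0 < \<epsilon>" "\<epsilon> < 1" "G holomorphic_on {u. Re u < ln \<epsilon>}"
    and G: "\<And>r. 0 < r \<Longrightarrow> r < \<epsilon> \<Longrightarrow>
      \<omega> * (1 - c * root_unity (p ^ n) ^ k * of_real (1 - r)) powr (1 / of_nat P) = G (of_real (ln r)) \<and>
      \<omega>' * (1 - c * root_unity (p ^ n) ^ k * of_real (1 - r)) powr (1 / of_nat P) = G (of_real (ln r) + 2 * of_real pi * \<i>)"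
  shows "loop_y p n k f (fps_const \<omega> * kummer_series P c) = fps_const \<omega>' * kummer_series P c"
proof -
  let ?\<theta> = "2 * pi * real k / real (p ^ n)"
  let ?R = "\<lambda>\<omega>. fps_const \<omega> * kummer_series P c"
  let ?B = "\<lambda>r. (1 - c * cis ?\<theta> * of_real (1 - r)) powr (1 / of_nat P)"
  let ?C = "\<lambda>\<rho>' \<epsilon> G. 0 < \<epsilon> \<and> \<epsilon> < 1 \<and> G holomorphic_on {u. Re u < ln \<epsilon>} \<and>
          (\<forall>r. 0 < r \<longrightarrow> r < \<epsilon> \<longrightarrow>
             radial_value (degree f) (?R \<omega>) ?\<theta> (1 - r) = G (of_real (ln r)) \<and>
             radial_value (degree f) \<rho>' ?\<theta> (1 - r) = G (of_real (ln r) + 2 * of_real pi * \<i>))"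
  have fib: "?R \<omega> \<in> fibre Tangent01 f" "?R \<omega>' \<in> fibre Tangent01 f"
    using assms by (auto simp: fibre_f)
  have rad: "radial_value (degree f) (?R w) ?\<theta> (1 - r) = w * ?B r" if "0 < r" "r < 1" for r w
    using radial_f[of "1 - r" w ?\<theta>] that by simp
  have GB: "\<omega> * ?B r = G (of_real (ln r))" "\<omega>' * ?B r = G (of_real (ln r) + 2 * of_real pi * \<i>)"
    if "0 < r" "r < \<epsilon>" for r
    using G[OF that] by (simp_all add: root_unity_power_cis)
  have C1: "?C (?R \<omega>') \<epsilon> G"
    using assms GB rad by auto
  have uniq: "\<rho>' = ?R \<omega>'" if \<rho>': "\<rho>' \<in> fibre Tangent01 f" and C: "?C \<rho>' \<epsilon>' G'" for \<rho>' \<epsilon>' G'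
  proof -
    obtain w where w: "\<rho>' = ?R w" using \<rho>' by (auto simp: fibre_f)
    define e where "e = min \<epsilon> \<epsilon>'"
    have e: "0 < e" "e < 1" "e \<le> \<epsilon>" "e \<le> \<epsilon>'" using assms C by (auto simp: e_def)
    have sub: "{u. Re u < ln e} \<subseteq> {u. Re u < ln \<epsilon>}" "{u. Re u < ln e} \<subseteq> {u. Re u < ln \<epsilon>'}"
    proof -
      have "ln e \<le> ln \<epsilon>" "ln e \<le> ln \<epsilon>'" using e by simp_all
      then show "{u. Re u < ln e} \<subseteq> {u. Re u < ln \<epsilon>}" "{u. Re u < ln e} \<subseteq> {u. Re u < ln \<epsilon>'}"
        by auto
    qed
    define r where "r = e / 2"
    have r: "0 < r" "r < e" "r < 1" using e by (auto simp: r_def)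
    have lnr: "ln r < ln e" using r by simp
    have "G (of_real (ln r) + 2 * of_real pi * \<i>) = G' (of_real (ln r) + 2 * of_real pi * \<i>)"
    proof (rule half_plane_identity[of G "ln e" G'])
      show "G holomorphic_on {u. Re u < ln e}" "G' holomorphic_on {u. Re u < ln e}"
        using assms C sub by (blast intro: holomorphic_on_subset)+
      fix x assume "x < ln e"
      then have x: "0 < exp x" "exp x < e" using e by (auto simp: ln_ge_iff less_le_not_le)
      have x0: "x < 0" using x e by (metis exp_less_cancel_iff exp_zero less_trans)
      have "\<omega> * ?B (exp x) = G (of_real (ln (exp x)))"
        by (rule GB) (use x x0 e in auto)
      moreover have "radial_value (degree f) (?R \<omega>) ?\<theta> (1 - exp x) = G' (of_real (ln (exp x)))"
        using C x x0 e by auto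
      moreover have "radial_value (degree f) (?R \<omega>) ?\<theta> (1 - exp x) = \<omega> * ?B (exp x)"
        by (rule rad) (use x x0 e in auto)
      ultimately show "G (of_real x) = G' (of_real x)" by simp
    qed (use lnr in simp)
    moreover have "G' (of_real (ln r) + 2 * of_real pi * \<i>) = w * ?B r"
    proof -
      have "radial_value (degree f) \<rho>' ?\<theta> (1 - r) = G' (of_real (ln r) + 2 * of_real pi * \<i>)"
        using C r e by auto
      then show ?thesis using rad[OF r(1,3), of w] w by simp
    qed
    moreover have "G (of_real (ln r) + 2 * of_real pi * \<i>) = \<omega>' * ?B r"
      using GB(2)[of r] r e by simp
    ultimately have "w * ?B r = \<omega>' * ?B r" by (simp only:)
    moreover have "?B r \<noteq> 0" by (rule radial_f_nonzero) (use r in auto)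
    ultimately have "w = \<omega>'" by (metis mult_cancel_right)
    then show ?thesis using w by simp
  qed
  have "loop_y p n k f (?R \<omega>) = (THE \<rho>'. \<rho>' \<in> fibre Tangent01 f \<and> (\<exists>\<epsilon> G. ?C \<rho>' \<epsilon> G))"
    using fib f_covers by (simp add: loop_y_def)
  also have "\<dots> = ?R \<omega>'"
  proof (rule the_equality)
    show "?R \<omega>' \<in> fibre Tangent01 f \<and> (\<exists>\<epsilon> G. ?C (?R \<omega>') \<epsilon> G)"
      using fib C1 by blast
  qed (use uniq in blast)
  finally show ?thesis .
qed

text \<open>With z = \<zeta> (1 - exp u) and c \<zeta> = 1 one gets 1 - c z = exp u. The root
  continues as a multiple of exp (u / P), which the shift of u by 2 pi i multiplies by exp (2 pi i /
  P).\<close>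

lemma loop_y_acts_at_branch_point:
  assumes "c * root_unity (p ^ n) ^ k = 1"
  shows "acts (loop_y p n k) (root_unity P)"
proof (rule actsI)
  fix \<omega> :: complex assume w: "\<omega> ^ P = 1"
  have wr: "(root_unity P * \<omega>) ^ P = 1"
    using w P_pos by (simp add: power_mult_distrib root_unity_power_self)
  have "loop_y p n k f (fps_const \<omega> * kummer_series P c) = fps_const (root_unity P * \<omega>) * kummer_series P c"
  proof (rule loop_y_eqI[OF w wr, of "1/2" "\<lambda>u. \<omega> * exp (u / of_nat P)"])
    fix r :: real assume r: "0 < r" "r < 1 / 2"
    have "(1 - c * root_unity (p ^ n) ^ k * of_real (1 - r)) powr (1 / of_nat P)
        = exp (of_real (ln r) / of_nat P)"
      using r unfolding assms by (simp add: powr_def Ln_of_real)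
    moreover have "exp ((of_real (ln r) + 2 * of_real pi * \<i>) / of_nat P)
        = root_unity P * exp (of_real (ln r) / of_nat P)"
      by (simp add: root_unity_def add_divide_distrib exp_add)
    ultimately show "\<omega> * (1 - c * root_unity (p ^ n) ^ k * of_real (1 - r)) powr (1 / of_nat P)
          = \<omega> * exp (of_real (ln r) / of_nat P) \<and>
        root_unity P * \<omega> * (1 - c * root_unity (p ^ n) ^ k * of_real (1 - r)) powr (1 / of_nat P)
          = \<omega> * exp ((of_real (ln r) + 2 * of_real pi * \<i>) / of_nat P)"
      by simp
  qed (use P_pos in \<open>auto intro!: holomorphic_intros\<close>)
  then show "loop_y p n k f (fps_const \<omega> * kummer_series P c)
      = fps_const (root_unity P) * (fps_const \<omega> * kummer_series P c)"
    by (simp add: mult.assoc flip: fps_const_mult)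
qed (use P_pos root_unity_power_self in auto)

text \<open>Near a puncture other than 1/c the function 1 - c z stays in the right half plane, so
  its principal root depends on exp u only and has period 2 pi i in u.\<close>

lemma loop_y_acts_elsewhere:
  assumes "c * root_unity (p ^ n) ^ k \<noteq> 1"
  shows "acts (loop_y p n k) 1"
proof (rule actsI)
  fix \<omega> :: complex assume w: "\<omega> ^ P = 1"
  define z where "z = c * root_unity (p ^ n) ^ k"
  have nz: "norm z = 1" by (simp add: z_def norm_mult norm_c root_unity_power_cis)
  define \<delta> where "\<delta> = Re (1 - z)"
  have d: "0 < \<delta>" unfolding \<delta>_def using Re_one_minus_pos[OF nz] assms by (simp add: z_def)
  \<comment> \<open>The bound \<delta> keeps the real part positive, since the perturbation
    \<open>z * exp u\<close> has absolute value below \<epsilon>; the bound 1/2 gives \<epsilon> <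
    1.\<close>
  define \<epsilon> where "\<epsilon> = min (1/2) \<delta>"
  have e: "0 < \<epsilon>" "\<epsilon> < 1" "\<epsilon> \<le> \<delta>" using d by (auto simp: \<epsilon>_def)
  let ?G = "\<lambda>u. \<omega> * (1 - z * (1 - exp u)) powr (1 / of_nat P)"
  have "loop_y p n k f (fps_const \<omega> * kummer_series P c) = fps_const \<omega> * kummer_series P c"
  proof (rule loop_y_eqI[OF w w e(1,2), of ?G])
    have "1 - z * (1 - exp u) \<notin> \<real>\<^sub>\<le>\<^sub>0" if "Re u < ln \<epsilon>" for u
    proof (rule not_nonpos_Reals_if_Re_pos)
      have "norm (z * exp u) = exp (Re u)" using nz by (simp add: norm_mult)
      also have "\<dots> < \<epsilon>" using that e by (metis exp_less_mono exp_ln)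
      finally have "- Re (z * exp u) < \<delta>" using abs_Re_le_cmod[of "z * exp u"] e by linarith
      moreover have "Re (1 - z * (1 - exp u)) = \<delta> + Re (z * exp u)"
        by (simp add: \<delta>_def algebra_simps)
      ultimately show "0 < Re (1 - z * (1 - exp u))" by linarith
    qed
    then show "?G holomorphic_on {u. Re u < ln \<epsilon>}"
      by (intro holomorphic_intros) auto
    fix r :: real assume "0 < r" "r < \<epsilon>"
    moreover have "exp (of_real (ln r) + 2 * of_real pi * \<i>) = exp (of_real (ln r) :: complex)"
      by (simp add: exp_add exp_two_pi_i)
    moreover have "exp (of_real (ln r) :: complex) = of_real r"
      using \<open>0 < r\<close> by (metis exp_ln exp_of_real)
    ultimately show "\<omega> * (1 - c * root_unity (p ^ n) ^ k * of_real (1 - r)) powr (1 / of_nat P) = ?G (of_real (ln r)) \<and>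
      \<omega> * (1 - c * root_unity (p ^ n) ^ k * of_real (1 - r)) powr (1 / of_nat P) = ?G (of_real (ln r) + 2 * of_real pi * \<i>)"
      by (simp only: z_def of_real_diff of_real_1)
  qed
  then show "loop_y p n k f (fps_const \<omega> * kummer_series P c)
      = fps_const 1 * (fps_const \<omega> * kummer_series P c)" by simp
qed simp

end

section \<open>The \<open>p\<close>-adic integers\<close>

lemma zp_eqI: "(\<And>n. zp_mod x n = zp_mod y n) \<Longrightarrow> x = y"
  by (metis ext zp_mod_inject)

lemma zp_of_compatible:
  fixes a :: "nat \<Rightarrow> int"
  assumes "\<And>n. a (Suc n) mod int CARD('p::prime_card) ^ n = a n mod int CARD('p::prime_card) ^ n"
  obtains x :: "'p::prime_card zp" where "\<And>n. zp_mod x n = a n mod int CARD('p::prime_card) ^ n"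
proof -
  let ?x = "\<lambda>n. a n mod int CARD('p) ^ n"
  have "zp_mod (Abs_zp ?x :: 'p zp) = ?x"
    by (rule Abs_zp_inverse) (use assms in \<open>simp add: mod_power_Suc_mod del: power_Suc\<close>)
  then show ?thesis by (metis that)
qed

lemma zp_mod_simps:
  fixes x y :: "'p::prime_card zp"
  shows "zp_mod (x + y) n = (zp_mod x n + zp_mod y n) mod int CARD('p) ^ n"
    "zp_mod (x - y) n = (zp_mod x n - zp_mod y n) mod int CARD('p) ^ n"
    "zp_mod (x * y) n = (zp_mod x n * zp_mod y n) mod int CARD('p) ^ n"
    "zp_mod (- x) n = (- zp_mod x n) mod int CARD('p) ^ n"
    "zp_mod (1 :: 'p zp) n = 1 mod int CARD('p) ^ n"
    "zp_mod (0 :: 'p zp) n = 0"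
  by (simp_all add: plus_zp.rep_eq minus_zp.rep_eq times_zp.rep_eq uminus_zp.rep_eq one_zp.rep_eq zero_zp.rep_eq)

lemma zp_mod_of_nat: "zp_mod (of_nat a :: 'p::prime_card zp) n = int a mod int CARD('p) ^ n"
proof (induction a)
  case (Suc a)
  have "zp_mod (of_nat (Suc a) :: 'p zp) n = (1 mod int CARD('p) ^ n + int a mod int CARD('p) ^ n) mod int CARD('p) ^ n"
    using Suc by (simp add: zp_mod_simps)
  then show ?case by (simp add: mod_add_eq)
qed (simp add: zp_mod_simps)

lemma zp_mod_of_int: "zp_mod (of_int a :: 'p::prime_card zp) n = a mod int CARD('p) ^ n"
proof (cases a)
  case (nonneg k)
  then show ?thesis using zp_mod_of_nat[of k n] by simp
next
  case (neg k)
  then have "(of_int a :: 'p zp) = - of_nat (Suc k)" by simp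
  then show ?thesis using neg
    by (simp only: zp_mod_simps zp_mod_of_nat mod_minus_eq)
qed

text \<open>Inverses modulo p^n exist because m is prime to p; being unique modulo p^n, they are
  compatible.\<close>

lemma zp_of_nat_invertible:
  assumes "\<not> CARD('p::prime_card) dvd m"
  obtains x :: "'p::prime_card zp" where "of_nat m * x = 1"
proof -
  let ?q = "int CARD('p)"
  have cop: "coprime (int m) (?q ^ n)" for n
    using assms prime_imp_coprime[OF prime_card[where 'a = 'p], of m]
    by (simp add: coprime_commute coprime_power_right_iff)
  have "\<exists>x. [int m * x = 1] (mod ?q ^ n)" for n
    using cop by (rule cong_solve_coprime_int)
  then obtain a where a: "\<And>n. [int m * a n = 1] (mod ?q ^ n)" by metis
  have "a (Suc n) mod ?q ^ n = a n mod ?q ^ n" for n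
  proof -
    have "[int m * a (Suc n) = 1] (mod ?q ^ n)"
      by (rule cong_dvd_modulus[OF a[of "Suc n"]]) simp
    then have "[int m * a (Suc n) = int m * a n] (mod ?q ^ n)"
      using a[of n] cong_sym cong_trans by blast
    then have "[a (Suc n) = a n] (mod ?q ^ n)"
      using cop by (simp add: cong_mult_lcancel)
    then show ?thesis by (simp add: cong_def)
  qed
  then obtain x :: "'p zp" where x: "\<And>n. zp_mod x n = a n mod ?q ^ n"
    by (rule zp_of_compatible) blast
  have "of_nat m * x = 1"
  proof (rule zp_eqI)
    fix n
    show "zp_mod (of_nat m * x) n = zp_mod (1 :: 'p zp) n"
      using a[of n] by (simp add: zp_mod_simps zp_mod_of_nat x cong_def mod_mult_eq)
  qed
  then show ?thesis by (rule that)
qed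

lemma zp_division_by_unit:
  assumes "\<not> CARD('p::prime_card) dvd m"
  shows "of_nat m * (THE c :: 'p::prime_card zp. of_nat m * c = - of_nat j) = - of_nat j"
proof -
  obtain x :: "'p zp" where x: "of_nat m * x = 1" using zp_of_nat_invertible[OF assms] .
  show ?thesis
  proof (rule theI[of _ "x * (- of_nat j)"])
    show "of_nat m * (x * (- of_nat j)) = - of_nat j" by (simp only: mult.assoc[symmetric] x mult_1_left)
    fix c :: "'p zp" assume "of_nat m * c = - of_nat j"
    then have "x * (of_nat m * c) = x * (- of_nat j)" by simp
    moreover have "x * (of_nat m * c) = of_nat m * x * c" by (simp only: mult_ac)
    ultimately show "c = x * (- of_nat j)" by (simp add: x)
  qed
qed

lemma root_unity_power_eq_iff:
  assumes "0 < r"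
  shows "root_unity r ^ a = root_unity r ^ b \<longleftrightarrow> [a = b] (mod r)"
proof -
  have "root_unity r ^ k = exp (2 * of_real pi * \<i> * of_nat k / of_nat r)" for k
    by (simp add: root_unity_def flip: exp_of_nat_mult) (simp add: mult_ac)
  then show ?thesis using complex_root_unity_eq[of r a b] assms by (simp add: cong_def)
qed

lemma root_unity_mult_power: "0 < s \<Longrightarrow> root_unity (r * s) ^ s = root_unity r"
  by (simp add: root_unity_def flip: exp_of_nat_mult)

lemma residue_mod_props:
  assumes "coprime b m" "0 < m"
  shows "residue_mod m a b < m" "[b * residue_mod m a b = a] (mod m)"
    and residue_mod_eqI: "x < m \<Longrightarrow> [b * x = a] (mod m) \<Longrightarrow> residue_mod m a b = x"
proof -
  obtain y where y: "[b * y = 1] (mod m)" using cong_solve_coprime_nat[OF assms(1)] by auto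
  have e: "[b * (y * a mod m) = a] (mod m)"
    using cong_scalar_right[OF y, of a] by (simp add: cong_def mod_mult_right_eq mult.assoc)
  have u: "x = x'" if "x < m" "[b * x = a] (mod m)" "x' < m" "[b * x' = a] (mod m)" for x x'
  proof -
    have "[b * x = b * x'] (mod m)" using that cong_sym cong_trans by blast
    then have "[x = x'] (mod m)" using assms(1) by (simp add: cong_mult_lcancel_nat)
    then show ?thesis using that by (simp add: cong_def)
  qed
  have ex: "\<exists>!x. x < m \<and> [b * x = a] (mod m)"
    using e u assms(2) by (intro ex1I[of _ "y * a mod m"]) auto
  show "residue_mod m a b < m" "[b * residue_mod m a b = a] (mod m)"
    using theI'[OF ex] by (auto simp: residue_mod_def)
  then show "x < m \<Longrightarrow> [b * x = a] (mod m) \<Longrightarrow> residue_mod m a b = x"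
    using u by blast
qed

section \<open>The path \<open>\<beta>\<^sub>j\<close> on Kummer covers\<close>

lemma powr_inverse_of_nat_power:
  assumes "z \<noteq> 0" "0 < k"
  shows "((z :: complex) powr (1 / of_nat k)) ^ k = z"
proof -
  have "(z powr (1 / of_nat k)) ^ k = exp (of_nat k * (1 / of_nat k * Ln z))"
    using assms by (simp only: powr_def if_False exp_of_nat_mult)
  then show ?thesis using assms by (simp add: exp_Ln)
qed

text \<open>In x = z - v the continuation is the principal P-th root of 1 - w (1 + x/v)^(1/Q), where
  w = c exp(i \<theta>/Q) satisfies w^Q = v. As v is not 1, neither is w, and Re (1 - w) > 0 makes
  the germ analytic.\<close>

lemma kummer_germ_at_endpoint:
  assumes PQ: "0 < P" "0 < Q" and c: "c ^ Q = 1" and v: "v = cis \<theta>" "v \<noteq> 1" "v \<in> qbar"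
  obtains \<rho> where "\<rho> \<in> fibre (At v) (kummer_cover P Q 1)" "0 < fps_conv_radius \<rho>"
    "\<exists>\<epsilon>>0. \<forall>r. 1 - \<epsilon> < r \<longrightarrow> 0 < r \<longrightarrow> r < 1 \<longrightarrow>
       radial_value (P * Q) (kummer_series P c) \<theta> r = eval_fps \<rho> ((of_real r - 1) * v)"
    "fps_nth \<rho> 0 = (1 - c * cis (\<theta> / real Q)) powr (1 / of_nat P)"
proof -
  have v0: "v \<noteq> 0" and nv: "norm v = 1" using v by auto
  define w where "w = c * cis (\<theta> / real Q)"
  have nc: "norm c = 1" using power_eq_imp_eq_norm[of c Q 1] c PQ by simp
  have nw: "norm w = 1" by (simp add: w_def norm_mult nc)
  have wQ: "w ^ Q = v"
    using c PQ by (simp add: w_def v power_mult_distrib Complex.DeMoivre)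
  have "w \<noteq> 1" using wQ v by auto
  then have w1: "0 < Re (1 - w)" by (rule Re_one_minus_pos[OF nw])
  define S where "S = (\<lambda>x. w * (1 + x / v) powr (1 / of_nat Q))"
  define F where "F = (\<lambda>x. (1 - S x) powr (1 / of_nat P))"
  have S0: "S 0 = w" by (simp add: S_def)
  have Sa: "S analytic_on {0}"
    unfolding S_def using v0 by (intro analytic_intros) auto
  have Fa: "F analytic_on {0}"
    unfolding F_def using w1 not_nonpos_Reals_if_Re_pos[of "1 - w"]
    by (intro analytic_intros Sa) (auto simp: S0)
  define \<rho> where "\<rho> = fps_expansion F 0"
  have exp: "F has_fps_expansion \<rho>"
    unfolding \<rho>_def by (rule analytic_at_imp_has_fps_expansion_0[OF Fa])
  have r0: "fps_nth \<rho> 0 = F 0"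
    using has_fps_expansion_imp_0_eq_fps_nth_0[OF exp] by simp
  \<comment> \<open>Where the bases do not vanish, both fractional powers can be undone; this turns
    the formula for F into the equation of the cover.\<close>
  have near: "eventually (\<lambda>x. 1 + x / v \<noteq> 0 \<and> 1 - S x \<noteq> 0) (nhds 0)"
  proof (rule eventually_conj)
    have "isCont (\<lambda>x. 1 + x / v) 0" using v0 by (intro continuous_intros)
    then have "((\<lambda>x. 1 + x / v) \<longlongrightarrow> 1) (nhds 0)"
      using tendsto_at_iff_tendsto_nhds[of "\<lambda>x. 1 + x / v" 0] by (simp add: isCont_def)
    then show "eventually (\<lambda>x. 1 + x / v \<noteq> 0) (nhds 0)"
      by (rule tendsto_imp_eventually_ne) simp
    have "isCont S 0" using Sa by (simp add: analytic_at_imp_isCont)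
    then have "(S \<longlongrightarrow> w) (nhds 0)"
      using S0 tendsto_at_iff_tendsto_nhds[of S 0] by (simp add: isCont_def)
    then have "((\<lambda>x. 1 - S x) \<longlongrightarrow> 1 - w) (nhds 0)"
      by (intro tendsto_intros)
    then show "eventually (\<lambda>x. 1 - S x \<noteq> 0) (nhds 0)"
      by (rule tendsto_imp_eventually_ne) (use w1 in auto)
  qed
  have A: "(\<lambda>x. (1 - F x ^ P) ^ Q) has_fps_expansion (1 - \<rho> ^ P) ^ Q"
    by (intro fps_expansion_intros exp)
  have B: "(\<lambda>x. v + x) has_fps_expansion fps_const v + fps_X"
    by (intro fps_expansion_intros)
  have C: "eventually (\<lambda>x. (1 - F x ^ P) ^ Q = v + x) (nhds 0)"
    using near
  proof eventually_elim
    case (elim x)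
    have "F x ^ P = 1 - S x" unfolding F_def using powr_inverse_of_nat_power[of "1 - S x" P] elim PQ(1) by blast
    then have "1 - F x ^ P = S x" by simp
    then have "(1 - F x ^ P) ^ Q = w ^ Q * ((1 + x / v) powr (1 / of_nat Q)) ^ Q"
      by (simp only: S_def power_mult_distrib)
    also have "\<dots> = v * (1 + x / v)"
      using powr_inverse_of_nat_power[of "1 + x / v" Q] elim PQ(2) wQ by simp
    also have "\<dots> = v + x" using v0 by (simp add: field_simps)
    finally show ?case .
  qed
  have "(\<lambda>x. v + x) has_fps_expansion (1 - \<rho> ^ P) ^ Q"
    using has_fps_expansion_cong[OF C refl] A by blast
  then have "(1 - \<rho> ^ P) ^ Q = fps_const v + fps_X"
    using B by (rule fps_expansion_unique_complex)
  then have eq: "(1 - \<rho> ^ P) ^ Q = fps_const 1 * (fps_const v + fps_X)"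
    by simp
  show ?thesis
  proof (rule that[of \<rho>])
    \<comment> \<open>The expansion of an analytic function has complex coefficients a priori; the
      equation of the cover makes them algebraic.\<close>
    have "\<rho> \<in> qbar_fps"
      by (rule qbar_fps_if_equation[OF PQ _ v(3) _ _ eq]) (use v0 v in auto)
    then show "\<rho> \<in> fibre (At v) (kummer_cover P Q 1)"
      using eq PQ by (simp add: fibre_kummer_cover coordinate_def)
    show "0 < fps_conv_radius \<rho>" using exp by (simp add: has_fps_expansion_def)
    show "fps_nth \<rho> 0 = (1 - c * cis (\<theta> / real Q)) powr (1 / of_nat P)"
      by (simp add: r0 F_def S0 w_def)
    obtain e where e: "e > 0" "\<And>x. norm x < e \<Longrightarrow> eval_fps \<rho> x = F x"
      using exp unfolding has_fps_expansion_def eventually_nhds_metric by (auto simp: dist_norm)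
    have "radial_value (P * Q) (kummer_series P c) \<theta> r = eval_fps \<rho> ((of_real r - 1) * v)"
      if r: "1 - e < r" "0 < r" "r < 1" for r
    proof -
      have "norm ((of_real r - 1) * v) = \<bar>r - 1\<bar>"
        unfolding norm_mult nv by (metis mult.right_neutral norm_of_real of_real_1 of_real_diff)
      then have "eval_fps \<rho> ((of_real r - 1) * v) = F ((of_real r - 1) * v)"
        by (intro e) (use r in auto)
      \<comment> \<open>On the ray z = r v the base is the positive number r, so the principal root
        is the real root occurring in \<open>radial_value\<close>.\<close>
      moreover have "(1 + (of_real r - 1) * v / v) powr (1 / of_nat Q) = of_real (root Q r)"
      proof -
        have "(1 + (of_real r - 1) * v / v) powr (1 / of_nat Q) = of_real r powr of_real (1 / real Q)"
          using v0 by simp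
        also have "\<dots> = of_real (r powr (1 / real Q))"
          using r by (subst powr_of_real) auto
        also have "r powr (1 / real Q) = root Q r"
          using r PQ by (simp add: root_powr_inverse)
        finally show ?thesis .
      qed
      moreover have "radial_value (P * Q) (kummer_series P c) \<theta> r
          = (1 - c * (of_real (root Q r) * cis (\<theta> / real Q))) powr (1 / of_nat P)"
        using radial_kummer_series[OF PQ, of c r 1 \<theta>] nc r by simp
      ultimately show ?thesis by (simp add: F_def S_def w_def mult_ac)
    qed
    then show "\<exists>\<epsilon>>0. \<forall>r. 1 - \<epsilon> < r \<longrightarrow> 0 < r \<longrightarrow> r < 1 \<longrightarrow>
       radial_value (P * Q) (kummer_series P c) \<theta> r = eval_fps \<rho> ((of_real r - 1) * v)"
      using e(1) by blast
  qed
qed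

text \<open>Let r tend to 1. Since a point of the fibre is determined by its value at v, this yields
  uniqueness in the description of \<open>path_alpha\<close>.\<close>

lemma fps_nth_0_eq_if_agree_radially:
  fixes F G :: "complex fps"
  assumes "0 < fps_conv_radius F" "0 < fps_conv_radius G"
    and "0 < \<epsilon>" "\<And>r. 1 - \<epsilon> < r \<Longrightarrow> 0 < r \<Longrightarrow> r < 1 \<Longrightarrow> eval_fps F ((of_real r - 1) * v) = eval_fps G ((of_real r - 1) * v)"
  shows "fps_nth F 0 = fps_nth G 0"
proof -
  have lim: "((\<lambda>r. eval_fps H ((of_real r - 1) * v)) \<longlongrightarrow> fps_nth H 0) (at_left (1 :: real))"
    if "0 < fps_conv_radius H" for H :: "complex fps"
  proof -
    have "isCont (eval_fps H) 0" using that by (intro continuous_eval_fps) (simp add: zero_ereal_def)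
    moreover have "((\<lambda>r. (of_real r - 1) * v) \<longlongrightarrow> (of_real 1 - 1) * v) (at_left (1 :: real))"
      by (intro tendsto_intros)
    ultimately show ?thesis
      using isCont_tendsto_compose[of 0 "eval_fps H"] by (simp add: eval_fps_at_0)
  qed
  have ev: "eventually (\<lambda>r. eval_fps F ((of_real r - 1) * v) = eval_fps G ((of_real r - 1) * v)) (at_left (1 :: real))"
    unfolding eventually_at_left_field
    by (rule exI[of _ "max 0 (1 - \<epsilon>)"]) (use assms in auto)
  from tendsto_cong[OF ev] lim[OF assms(1)] lim[OF assms(2)] show ?thesis
    by (metis tendsto_unique trivial_limit_at_left_real)
qed

lemma path_alpha_kummer_series:
  assumes p: "prime p" and P: "P = p ^ N" and Q: "Q = p ^ M" and c: "c ^ Q = 1" and j: "0 < j" "j < m"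
  shows "fps_nth (path_alpha p m j (kummer_cover P Q 1) (kummer_series P c)) 0
    = (1 - c * cis (2 * pi * real j / real m / real Q)) powr (1 / of_nat P)"
proof -
  let ?g = "kummer_cover P Q 1" and ?v = "root_unity m ^ j" and ?\<theta> = "2 * pi * real j / real m"
  have pos: "0 < P" "0 < Q" using p P Q by (auto simp: prime_gt_0_nat)
  have g: "?g \<in> covers p 0" using kummer_cover_in_covers[OF p P Q, of 1 0] by simp
  have deg: "degree ?g = P * Q" using pos by (rule degree_kummer_cover)
  have v: "?v = cis ?\<theta>" by (rule root_unity_power_cis)
  have v1: "?v \<noteq> 1" using root_unity_power_eq_iff[of m j 0] j by (auto simp: cong_def)
  have "?v ^ m = 1" using root_unity_power_self[of m] j by (metis less_trans mult.commute power_mult power_one)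
  then have vq: "?v \<in> qbar" using j by (intro qbar_root_unity[of _ m]) auto
  have cq: "c \<in> qbar" using c pos by (auto intro: qbar_root_unity)
  have fib: "kummer_series P c \<in> fibre Tangent01 ?g"
    by (rule kummer_series_in_fibre[OF pos cq c])
  let ?C = "\<lambda>\<rho>'. \<rho>' \<in> fibre (At ?v) ?g \<and> fps_conv_radius \<rho>' > 0 \<and>
       (\<exists>\<epsilon>>0. \<forall>r. 1 - \<epsilon> < r \<longrightarrow> 0 < r \<longrightarrow> r < 1 \<longrightarrow>
          radial_value (P * Q) (kummer_series P c) ?\<theta> r = eval_fps \<rho>' ((of_real r - 1) * ?v))"
  obtain \<rho> where \<rho>: "?C \<rho>" "fps_nth \<rho> 0 = (1 - c * cis (?\<theta> / real Q)) powr (1 / of_nat P)"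
    using kummer_germ_at_endpoint[OF pos c v v1 vq] by metis
  have "path_alpha p m j ?g (kummer_series P c) = (THE \<rho>'. ?C \<rho>')"
    using g fib deg by (simp add: path_alpha_def)
  also have "\<dots> = \<rho>"
  proof (rule the_equality[of ?C])
    show "?C \<rho>" by (rule \<rho>(1))
    fix \<rho>' assume C: "?C \<rho>'"
    obtain e where e: "e > 0" "\<And>r. 1 - e < r \<Longrightarrow> 0 < r \<Longrightarrow> r < 1 \<Longrightarrow>
        radial_value (P * Q) (kummer_series P c) ?\<theta> r = eval_fps \<rho> ((of_real r - 1) * ?v)" using \<rho>(1) by blast
    obtain e' where e': "e' > 0" "\<And>r. 1 - e' < r \<Longrightarrow> 0 < r \<Longrightarrow> r < 1 \<Longrightarrow>
        radial_value (P * Q) (kummer_series P c) ?\<theta> r = eval_fps \<rho>' ((of_real r - 1) * ?v)" using C by blast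
    have "fps_nth \<rho>' 0 = fps_nth \<rho> 0"
    proof (rule fps_nth_0_eq_if_agree_radially)
      fix r assume "1 - min e e' < r" "0 < r" "r < 1"
      then show "eval_fps \<rho>' ((of_real r - 1) * ?v) = eval_fps \<rho> ((of_real r - 1) * ?v)"
        using e(2)[of r] e'(2)[of r] by simp
    qed (use C \<rho>(1) e(1) e'(1) in auto)
    moreover have "bij_betw (\<lambda>\<rho>. fps_nth \<rho> 0) (fibre (At ?v) ?g) {w. (1 - w ^ P) ^ Q = 1 * ?v}"
      by (rule bij_betw_fibre_kummer_cover[OF pos _ vq]) (use v v1 in auto)
    ultimately show "\<rho>' = \<rho>"
      using C \<rho>(1) by (auto simp: bij_betw_def inj_on_def)
  qed
  finally show ?thesis using \<rho>(2) by simp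
qed

text \<open>Written as a substitution, the loop commutes with sums, products and powers, and so
  preserves the equation of a Kummer cover.\<close>

lemma loop_x_on_cover:
  assumes g: "g \<in> covers p 0" "\<rho> \<in> fibre Tangent01 g"
  shows "loop_x p 0 g \<rho> = \<rho> oo (fps_const (root_unity (degree g)) * fps_X)"
  using assms by (simp add: loop_x_def fps_compose_linear)

lemma loop_x_kummer_cover:
  assumes p: "prime p" and P: "P = p ^ N" and Q: "Q = p ^ M"
    and \<rho>: "\<rho> \<in> fibre Tangent01 (kummer_cover P Q 1)"
  shows "loop_x p 0 (kummer_cover P Q 1) \<rho> \<in> fibre Tangent01 (kummer_cover P Q 1)"
    "(loop_x p 0 (kummer_cover P Q 1) ^^ k) \<rho> = Abs_fps (\<lambda>l. root_unity (P * Q) ^ (l * k) * fps_nth \<rho> l)"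
proof -
  let ?g = "kummer_cover P Q 1" and ?\<xi> = "root_unity (P * Q)"
  have pos: "0 < P" "0 < Q" using p P Q by (auto simp: prime_gt_0_nat)
  have g: "?g \<in> covers p 0" using kummer_cover_in_covers[OF p P Q, of 1 0] by simp
  have deg: "degree ?g = P * Q" using pos by (rule degree_kummer_cover)
  have \<xi>: "?\<xi> ^ (P * Q) = 1" using pos by (intro root_unity_power_self) simp
  then have \<xi>q: "?\<xi> \<in> qbar" using pos by (intro qbar_root_unity[of _ "P * Q"]) auto
  have fib: "fibre Tangent01 ?g = {\<rho> \<in> qbar_fps. (1 - \<rho> ^ P) ^ Q = fps_X ^ (P * Q)}"
    using pos by (simp add: fibre_kummer_cover coordinate_def)
  have step: "loop_x p 0 ?g \<rho> = \<rho> oo (fps_const ?\<xi> * fps_X)" "loop_x p 0 ?g \<rho> \<in> fibre Tangent01 ?g"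
    if "\<rho> \<in> fibre Tangent01 ?g" for \<rho>
  proof -
    show l: "loop_x p 0 ?g \<rho> = \<rho> oo (fps_const ?\<xi> * fps_X)"
      using loop_x_on_cover[OF g that] deg by simp
    let ?Y = "fps_const ?\<xi> * fps_X :: complex fps"
    have Y0: "fps_nth ?Y 0 = 0" by simp
    have "1 - (\<rho> oo ?Y) ^ P = (1 - \<rho> ^ P) oo ?Y"
      by (simp only: fps_compose_power[OF Y0] fps_compose_sub_distrib fps_compose_1)
    then have "(1 - (\<rho> oo ?Y) ^ P) ^ Q = (1 - \<rho> ^ P) ^ Q oo ?Y"
      by (simp only: fps_compose_power[OF Y0])
    also have "\<dots> = fps_X ^ (P * Q) oo ?Y" using that fib by simp
    also have "\<dots> = ?Y ^ (P * Q)" using fps_compose_power[OF Y0, of fps_X "P * Q"] by simp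
    also have "\<dots> = fps_X ^ (P * Q)"
      using \<xi> by (simp add: power_mult_distrib fps_const_power)
    finally have "(1 - (\<rho> oo ?Y) ^ P) ^ Q = fps_X ^ (P * Q)" .
    moreover have "\<rho> oo ?Y \<in> qbar_fps"
      using that fib \<xi>q by (intro qbar_fps_compose qbar_fps_mult) auto
    ultimately show "loop_x p 0 ?g \<rho> \<in> fibre Tangent01 ?g" by (simp add: l fib)
  qed
  show "loop_x p 0 ?g \<rho> \<in> fibre Tangent01 ?g" using step \<rho> by blast
  have "(loop_x p 0 ?g ^^ k) \<rho> = Abs_fps (\<lambda>l. ?\<xi> ^ (l * k) * fps_nth \<rho> l) \<and>
      (loop_x p 0 ?g ^^ k) \<rho> \<in> fibre Tangent01 ?g"
  proof (induction k)
    case (Suc k)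
    then have "(loop_x p 0 ?g ^^ Suc k) \<rho> = (loop_x p 0 ?g ^^ k) \<rho> oo (fps_const ?\<xi> * fps_X)"
      using step(1)[OF conjunct2[OF Suc.IH]] by (simp only: funpow.simps comp_apply)
    also have "\<dots> = Abs_fps (\<lambda>l. ?\<xi> ^ l * (?\<xi> ^ (l * k) * fps_nth \<rho> l))"
      using Suc unfolding fps_compose_linear by simp
    also have "\<dots> = Abs_fps (\<lambda>l. ?\<xi> ^ (l * Suc k) * fps_nth \<rho> l)"
      by (simp add: power_add mult.assoc)
    finally have "(loop_x p 0 ?g ^^ Suc k) \<rho> = Abs_fps (\<lambda>l. ?\<xi> ^ (l * Suc k) * fps_nth \<rho> l)" .
    moreover have "(loop_x p 0 ?g ^^ Suc k) \<rho> \<in> fibre Tangent01 ?g"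
      using step(2)[OF conjunct2[OF Suc.IH]] by simp
    ultimately show ?case by blast
  qed (use \<rho> in \<open>simp add: fps_eq_iff\<close>)
  then show "(loop_x p 0 ?g ^^ k) \<rho> = Abs_fps (\<lambda>l. ?\<xi> ^ (l * k) * fps_nth \<rho> l)" by blast
qed

text \<open>Let l represent -j/m modulo P Q. The power x^l turns c into c times the l-th power of
  \<open>root_unity Q\<close>, and the arc of \<alpha>_j adds the angle 2 pi j/(m Q). Altogether c
  is rotated by 2 pi (m l + j)/(m Q) = 2 pi h/m with Q h = m l + j, and h is j p^(-M) modulo
  m.\<close>

lemma path_beta_kummer_series:
  fixes m j :: nat
  assumes P: "P = CARD('p::prime_card) ^ N" and Q: "Q = CARD('p) ^ M" and c: "c ^ Q = 1"
    and j: "0 < j" "j < m" and m: "\<not> CARD('p) dvd m"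
  shows "fps_nth (path_beta TYPE('p) m j (kummer_cover P Q 1) (kummer_series P c)) 0
    = (1 - c * root_unity m ^ residue_mod m j Q) powr (1 / of_nat P)"
proof -
  have p: "prime CARD('p)" by (rule prime_card)
  let ?g = "kummer_cover P Q 1" and ?x = "loop_x CARD('p) 0"
  have pos: "0 < P" "0 < Q" using p P Q by (auto simp: prime_gt_0_nat)
  have g: "?g \<in> covers CARD('p) 0" using kummer_cover_in_covers[OF p P Q, of 1 0] by simp
  have cq: "c \<in> qbar" using c pos by (auto intro: qbar_root_unity)
  have fib: "kummer_series P c \<in> fibre Tangent01 ?g"
    by (rule kummer_series_in_fibre[OF pos cq c])
  define a where "a = (THE c :: 'p zp. of_nat m * c = - of_nat j)"
  define l where "l = nat (zp_mod a (N + M))"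
  have PQ: "CARD('p) ^ (N + M) = P * Q" by (simp add: P Q power_add)
  have lint: "int l = zp_mod a (N + M)" using zp_mod_bounds(1)[of a] by (simp add: l_def)
  have "of_nat m * a = - of_nat j" unfolding a_def using m by (rule zp_division_by_unit)
  then have "zp_mod (of_nat m * a) (N + M) = zp_mod (- of_nat j :: 'p zp) (N + M)" by simp
  then have "int m * int l mod int (P * Q) = (- int j) mod int (P * Q)"
    unfolding lint PQ[symmetric] of_nat_power
    by (simp only: zp_mod_simps zp_mod_of_nat mod_mult_left_eq mod_minus_eq)
  then have "int (P * Q) dvd int m * int l - (- int j)"
    by (simp add: mod_eq_dvd_iff)
  then have "int (P * Q) dvd int (m * l + j)" by simp
  then have "P * Q dvd m * l + j" by (simp only: of_nat_dvd_iff)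
  then obtain h0 where "m * l + j = P * Q * h0" by (rule dvdE)
  then obtain h where h: "m * l + j = Q * h" by (metis mult.assoc mult.commute)
  have pw: "(?x ?g ^^ (CARD('p) ^ (N + M))) \<rho> = \<rho>" if "\<rho> \<in> fibre Tangent01 ?g" for \<rho>
  proof -
    have "root_unity (P * Q) ^ (l * (P * Q)) = 1" for l
      using root_unity_power_self[of "P * Q"] pos by (metis mult.commute mult_pos_pos power_mult power_one)
    then show ?thesis using loop_x_kummer_cover(2)[OF p P Q that] unfolding PQ by (simp add: fps_eq_iff)
  qed
  have "padic_power 0 ?x a ?g (kummer_series P c) = (?x ?g ^^ l) (kummer_series P c)"
    unfolding l_def
    by (rule padic_power_apply[OF g _ _ fib]) (use loop_x_kummer_cover(1)[OF p P Q] pw in auto)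
  also have "\<dots> = kummer_series P (c * root_unity Q ^ l)"
  proof -
    \<comment> \<open>Only exponents divisible by P occur in the series, and the P-th power of
      \<open>root_unity (P * Q)\<close> is \<open>root_unity Q\<close>.\<close>
    have e: "root_unity (P * Q) ^ (P * k * l) = (root_unity Q ^ l) ^ k" for k
      using root_unity_mult_power[OF pos(1), of Q]
      by (simp only: power_mult mult.commute[of P Q]) (simp only: power_mult[symmetric] mult.commute)
    show ?thesis
    proof (rule fps_ext)
      fix i
      show "fps_nth ((?x ?g ^^ l) (kummer_series P c)) i = fps_nth (kummer_series P (c * root_unity Q ^ l)) i"
      proof (cases "P dvd i")
        case True
        then obtain k where k: "i = P * k" by (rule dvdE)
        have "(- (c * root_unity Q ^ l)) ^ k = (root_unity Q ^ l) ^ k * (- c) ^ k"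
          by (simp only: mult_minus_left[symmetric] power_mult_distrib mult.commute)
        then show ?thesis
          using pos e[of k] by (simp add: loop_x_kummer_cover(2)[OF p P Q fib] kummer_series_nth k)
      next
        case False
        then show ?thesis
          using pos by (simp add: loop_x_kummer_cover(2)[OF p P Q fib] kummer_series_nth)
      qed
    qed
  qed
  finally have x: "padic_power 0 ?x a ?g (kummer_series P c) = kummer_series P (c * root_unity Q ^ l)" .
  have "path_beta TYPE('p) m j ?g (kummer_series P c) = path_alpha CARD('p) m j ?g (kummer_series P (c * root_unity Q ^ l))"
    using g fib by (simp add: path_beta_def path_comp_def compose_def x flip: a_def)
  also have "fps_nth \<dots> 0 = (1 - (c * root_unity Q ^ l) * cis (2 * pi * real j / real m / real Q)) powr (1 / of_nat P)"
  proof (rule path_alpha_kummer_series[OF p P Q _ j])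
    show "(c * root_unity Q ^ l) ^ Q = 1"
      using c root_unity_power_self[OF pos(2)] by (simp add: power_mult_distrib) (metis mult.commute power_mult power_one)
  qed
  also have "(c * root_unity Q ^ l) * cis (2 * pi * real j / real m / real Q) = c * root_unity m ^ residue_mod m j Q"
  proof -
    have "root_unity Q ^ l * cis (2 * pi * real j / real m / real Q)
        = cis (2 * pi * real l / real Q + 2 * pi * real j / real m / real Q)"
      by (simp add: root_unity_power_cis cis_mult)
    also have "2 * pi * real l / real Q + 2 * pi * real j / real m / real Q
        = 2 * pi * real (m * l + j) / (real m * real Q)"
      using j pos by (simp add: field_simps)
    also have "\<dots> = 2 * pi * real h / real m"
      unfolding h using pos by simp
    also have "cis \<dots> = root_unity m ^ h" by (simp add: root_unity_power_cis)
    also have "\<dots> = root_unity m ^ residue_mod m j Q"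
    proof -
      have cop: "coprime Q m"
        using prime_imp_coprime[OF p m] by (simp add: Q)
      have "[Q * h = j] (mod m)" unfolding h[symmetric] by (simp add: cong_def)
      moreover have "[Q * residue_mod m j Q = j] (mod m)"
        using residue_mod_props(2)[OF cop] j by simp
      ultimately have "[Q * h = Q * residue_mod m j Q] (mod m)" using cong_sym cong_trans by blast
      then have "[h = residue_mod m j Q] (mod m)" using cop by (simp add: cong_mult_lcancel_nat)
      then show ?thesis using root_unity_power_eq_iff[of m] j by simp
    qed
    finally show ?thesis by (simp add: mult.assoc)
  qed
  finally show ?thesis .
qed

section \<open>The Galois action and the coefficients of the measures\<close>

section \<open>The Galois action\<close>

text \<open>The automorphism is a function on all complex numbers that is constrained on
  \<open>qbar\<close> only, so the rules below carry membership hypotheses.\<close>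

locale galois_automorphism =
  fixes m :: nat and \<sigma> :: "complex \<Rightarrow> complex"
  assumes \<sigma>: "\<sigma> \<in> galois_cyclotomic m"
begin

definition "\<sigma>' = inv_into qbar \<sigma>"

lemma aut_bij: "bij_betw \<sigma> qbar qbar"
  using \<sigma> by (simp add: galois_cyclotomic_def)

lemma aut_hom: "x \<in> qbar \<Longrightarrow> y \<in> qbar \<Longrightarrow> \<sigma> (x + y) = \<sigma> x + \<sigma> y"
  "x \<in> qbar \<Longrightarrow> y \<in> qbar \<Longrightarrow> \<sigma> (x * y) = \<sigma> x * \<sigma> y"
  using \<sigma> by (auto simp: galois_cyclotomic_def)

lemma aut_qbar: "x \<in> qbar \<Longrightarrow> \<sigma> x \<in> qbar" "x \<in> qbar \<Longrightarrow> \<sigma>' x \<in> qbar"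
  and aut_inverse: "x \<in> qbar \<Longrightarrow> \<sigma> (\<sigma>' x) = x" "x \<in> qbar \<Longrightarrow> \<sigma>' (\<sigma> x) = x"
  using aut_bij by (auto simp: \<sigma>'_def bij_betw_def f_inv_into_f inv_into_into)

lemma aut_0 [simp]: "\<sigma> 0 = 0"
  using aut_hom(1)[of 0 0] by simp

lemma aut_eq_iff: "x \<in> qbar \<Longrightarrow> y \<in> qbar \<Longrightarrow> \<sigma> x = \<sigma> y \<longleftrightarrow> x = y"
  using aut_bij by (auto simp: bij_betw_def inj_on_def)

lemma aut_1 [simp]: "\<sigma> 1 = 1"
proof -
  have "\<sigma> 1 * \<sigma> 1 = \<sigma> 1" using aut_hom(2)[of 1 1] by simp
  moreover have "\<sigma> 1 \<noteq> 0" using aut_eq_iff[of 1 0] by simp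
  ultimately show ?thesis by simp
qed

lemma aut_minus: "x \<in> qbar \<Longrightarrow> \<sigma> (- x) = - \<sigma> x"
  using aut_hom(1)[of x "- x"] qbar_minus[of x] by (simp add: add_eq_0_iff)

lemma aut_diff: "x \<in> qbar \<Longrightarrow> y \<in> qbar \<Longrightarrow> \<sigma> (x - y) = \<sigma> x - \<sigma> y"
  using aut_hom(1)[of x "- y"] qbar_minus[of y] aut_minus by simp

lemma aut_power: "x \<in> qbar \<Longrightarrow> \<sigma> (x ^ k) = \<sigma> x ^ k"
  by (induction k) (simp_all add: aut_hom qbar_power)

lemma aut_divide: "x \<in> qbar \<Longrightarrow> y \<in> qbar \<Longrightarrow> \<sigma> (x / y) = \<sigma> x / \<sigma> y"
proof (cases "y = 0")
  case False
  assume xy: "x \<in> qbar" "y \<in> qbar"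
  then have "\<sigma> (x / y) * \<sigma> y = \<sigma> x" using aut_hom(2)[of "x / y" y] False by (simp add: qbar_divide)
  moreover have "\<sigma> y \<noteq> 0" using aut_eq_iff[of y 0] xy False by simp
  ultimately show ?thesis by (simp add: field_simps)
qed simp

lemma aut_sum: "(\<And>i. i \<in> A \<Longrightarrow> f i \<in> qbar) \<Longrightarrow> \<sigma> (sum f A) = (\<Sum>i\<in>A. \<sigma> (f i))"
  by (induction A rule: infinite_finite_induct) (simp_all add: aut_hom qbar_sum)

lemma aut_of_nat [simp]: "\<sigma> (of_nat k) = of_nat k"
proof (induction k)
  case (Suc k)
  then show ?case using aut_hom(1)[of 1 "of_nat k"] qbar_rat[of "of_nat k"] by simp
qed simp

lemma aut_of_int [simp]: "\<sigma> (of_int k) = of_int k"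
proof (cases k)
  case (neg n)
  then have "\<sigma> (of_int k) = \<sigma> (- of_nat (Suc n))" by (simp only: of_int_minus of_int_of_nat_eq)
  also have "\<dots> = - \<sigma> (of_nat (Suc n))"
    using qbar_rat[of "of_nat (Suc n)"] by (intro aut_minus) (simp only: of_rat_of_nat_eq)
  also have "\<dots> = of_int k" by (simp only: neg of_int_minus of_int_of_nat_eq aut_of_nat)
  finally show ?thesis .
qed simp

lemma aut_of_rat [simp]: "\<sigma> (of_rat r) = of_rat r"
proof (cases r)
  case (Fract a b)
  then show ?thesis
    using aut_divide[of "of_int a" "of_int b"] qbar_rat[of "of_int a"] qbar_rat[of "of_int b"] by (simp add: of_rat_rat)
qed

lemma fixes_root_unity: "\<sigma> (root_unity m ^ k) = root_unity m ^ k" if "0 < m"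
proof -
  have "root_unity m \<in> qbar" using root_unity_power_self[OF that] that by (rule qbar_root_unity)
  moreover have "\<sigma> (root_unity m) = root_unity m" using \<sigma> by (simp add: galois_cyclotomic_def)
  ultimately show ?thesis by (simp add: aut_power)
qed

lemma fps_act_nth [simp]: "fps_nth (fps_act s F) l = s (fps_nth F l)"
  by (simp add: fps_act_def)

lemma fps_act_qbar: "F \<in> qbar_fps \<Longrightarrow> fps_act \<sigma> F \<in> qbar_fps"
  by (simp add: qbar_fps_def aut_qbar)

lemma fps_act_mult: "F \<in> qbar_fps \<Longrightarrow> G \<in> qbar_fps \<Longrightarrow> fps_act \<sigma> (F * G) = fps_act \<sigma> F * fps_act \<sigma> G"
  by (simp add: fps_eq_iff fps_mult_nth aut_sum aut_hom qbar_mult qbar_fps_nth)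

lemma fps_act_power: "F \<in> qbar_fps \<Longrightarrow> fps_act \<sigma> (F ^ k) = fps_act \<sigma> F ^ k"
proof (induction k)
  case 0
  show ?case by (simp add: fps_eq_iff)
next
  case (Suc k)
  then show ?case by (simp add: fps_act_mult qbar_fps_power)
qed

text \<open>The binomial coefficients are rational, so only the powers of c are moved.\<close>

lemma fps_act_kummer_series:
  assumes "0 < P" "c \<in> qbar"
  shows "fps_act \<sigma> (kummer_series P c) = kummer_series P (\<sigma> c)"
proof (rule fps_ext)
  fix l
  obtain r where "(1 / of_nat P :: complex) gchoose (l div P) = of_rat r"
    using gchoose_inverse_of_nat_rational by blast
  then show "fps_nth (fps_act \<sigma> (kummer_series P c)) l = fps_nth (kummer_series P (\<sigma> c)) l"
    using assms by (simp add: kummer_series_nth aut_hom aut_power aut_minus qbar_rat qbar_power qbar_minus)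
qed

lemma fps_act_inverse: "F \<in> qbar_fps \<Longrightarrow> fps_act \<sigma>' (fps_act \<sigma> F) = F"
  by (simp add: fps_eq_iff aut_inverse qbar_fps_nth)

lemma coeff_kummer_cover:
  "poly.coeff (poly.coeff (kummer_cover P 1 c) i) j
    = (if j = 0 then of_int ((if i = P then 1 else 0) - (if i = 0 then 1 else 0)) else 0)
      + (if i = 0 \<and> j = 1 then c else 0)"
  by (auto simp: kummer_cover_def coeff_pCons one_pCons split: nat.splits)

text \<open>A conjugated path on the cover with parameter \<sigma> c is evaluated through the
  original path on the conjugated cover; this identifies the latter as the one with parameter
  c.\<close>

lemma conjugate_kummer_cover:
  assumes "c \<in> qbar"
  shows "map_poly (map_poly \<sigma>') (kummer_cover P 1 (\<sigma> c)) = kummer_cover P 1 c"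
proof -
  have z: "\<sigma>' 0 = 0" using aut_inverse(2)[of 0] by simp
  have q: "poly.coeff (poly.coeff (kummer_cover P 1 c) i) j \<in> qbar" for i j
    unfolding coeff_kummer_cover using assms qbar_rat[of "of_int k" for k]
    by (intro qbar_add) (auto simp: simp del: of_int_diff)
  have e: "poly.coeff (poly.coeff (kummer_cover P 1 (\<sigma> c)) i) j
      = \<sigma> (poly.coeff (poly.coeff (kummer_cover P 1 c) i) j)" for i j
    unfolding coeff_kummer_cover by (auto simp del: of_int_diff)
  have "poly.coeff (poly.coeff (map_poly (map_poly \<sigma>') (kummer_cover P 1 (\<sigma> c))) i) j
      = poly.coeff (poly.coeff (kummer_cover P 1 c) i) j" for i j
  proof -
    have "poly.coeff (poly.coeff (map_poly (map_poly \<sigma>') (kummer_cover P 1 (\<sigma> c))) i) j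
        = \<sigma>' (poly.coeff (poly.coeff (kummer_cover P 1 (\<sigma> c)) i) j)"
      using z by (simp add: coeff_map_poly)
    then show ?thesis by (simp only: e aut_inverse(2)[OF q])
  qed
  then show ?thesis by (simp add: poly_eq_iff)
qed

end

section \<open>The measures \<open>K(\<xi>\<^sub>m\<^sup>j)(\<sigma>)\<close> and roots of \<open>1 - c \<xi>\<^sub>m\<^sup>j\<close>\<close>

text \<open>The degrees of the covers of V_0 and of V_n differ by the factor p^n, so the common
  series is its own pullback in the sense of \<open>is_lift\<close>. The substitution on the right
  there has constant term 0 and keeps the value at the endpoint.\<close>

lemma lift_of_path_beta_nth_0:
  fixes m j n N :: nat and c :: complex
  defines "P \<equiv> CARD('p::prime_card) ^ N" and "Q \<equiv> CARD('p) ^ n"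
  assumes c: "c ^ Q = 1" and j: "0 < j" "j < m" and m: "\<not> CARD('p) dvd m"
    and lift: "is_lift CARD('p) n u (path_beta TYPE('p) m j) \<beta>"
  shows "fps_nth (\<beta> (kummer_cover P 1 c) (kummer_series P c)) 0
    = (1 - c * root_unity m ^ residue_mod m j Q) powr (1 / of_nat P)"
proof -
  have p: "prime CARD('p)" by (rule prime_card)
  have pos: "0 < P" "0 < Q" using p by (auto simp: P_def Q_def prime_gt_0_nat)
  let ?g = "kummer_cover P Q 1" and ?f = "kummer_cover P 1 c" and ?\<eta> = "kummer_series P c"
  have g: "?g \<in> covers CARD('p) 0" using kummer_cover_in_covers[OF p, of P N Q n 1 0] P_def Q_def by simp
  have f: "?f \<in> covers CARD('p) n"
    using kummer_cover_in_covers[OF p, of P N 1 0 c n] c by (simp add: P_def Q_def)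
  have cq: "c \<in> qbar" using c pos by (auto intro: qbar_root_unity)
  have \<eta>: "?\<eta> \<in> fibre Tangent01 ?g" "?\<eta> \<in> fibre Tangent01 ?f"
    using pos cq c by (auto intro!: kummer_series_in_fibre)
  have "degree ?g = CARD('p) ^ n * degree ?f"
    using pos degree_kummer_cover[of P Q 1] degree_kummer_cover[of P 1 c] by (simp add: Q_def)
  then have "?\<eta> oo fps_X ^ degree ?g = ?\<eta> oo fps_X ^ (CARD('p) ^ n * degree ?f)" by simp
  then have "\<beta> ?f ?\<eta> = path_beta TYPE('p) m j ?g ?\<eta>
      oo ((fps_const u + fps_X) ^ (CARD('p) ^ n) - fps_const (u ^ (CARD('p) ^ n)))"
    using lift g f \<eta> unfolding is_lift_def by blast
  then show ?thesis
    using path_beta_kummer_series[OF P_def[THEN meta_eq_to_obj_eq] Q_def[THEN meta_eq_to_obj_eq] c j m] by (simp only: fps_compose_nth_0)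
qed

context kummer_fibre
begin

lemma foldr_acts:
  assumes "\<And>k. k \<in> set ks \<Longrightarrow> acts (h k) (w k)"
  shows "acts (foldr (\<lambda>k s. h k \<otimes>\<^bsub>pi1 p n\<^esub> s) ks \<one>\<^bsub>pi1 p n\<^esub>) (\<Prod>k\<leftarrow>ks. w k)"
  using assms by (induction ks) (auto intro: acts_one acts_mult)

text \<open>Among the indices below p^n exactly k belongs to the branch point 1/c, so only the power
  of \<open>loop_y p n k\<close> contributes a scalar.\<close>

lemma abelian_image_acts:
  fixes a :: "'p::prime_card zp"
  assumes "abelian_image_eq n \<gamma> a \<kappa>" and pC: "p = CARD('p)"
    and k: "k < p ^ n" "c * root_unity (p ^ n) ^ k = 1"
  shows "acts \<gamma> (root_unity P ^ nat (zp_mod (\<kappa> k) N))"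
proof -
  let ?w = "\<lambda>l. (if l = k then root_unity P else 1) ^ nat (zp_mod (\<kappa> l) N)"
  obtain d where d: "d \<in> pi1_closure p n (derived (pi1 p n) (carrier (pi1 p n)))"
    and \<gamma>: "\<gamma> = padic_power n (loop_x p n) a \<otimes>\<^bsub>pi1 p n\<^esub>
             foldr (\<lambda>k s. padic_power n (loop_y p n k) (\<kappa> k) \<otimes>\<^bsub>pi1 p n\<^esub> s) [0..<p ^ n] \<one>\<^bsub>pi1 p n\<^esub> \<otimes>\<^bsub>pi1 p n\<^esub> d"
    using assms unfolding abelian_image_eq_def Let_def by auto
  have y: "acts (loop_y p n l) (if l = k then root_unity P else 1)" if "l < p ^ n" for l
  proof (cases "l = k")
    case True
    then show ?thesis using loop_y_acts_at_branch_point k by simp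
  next
    case False
    have "c * root_unity (p ^ n) ^ l \<noteq> 1"
    proof
      assume "c * root_unity (p ^ n) ^ l = 1"
      then have "c * root_unity (p ^ n) ^ l = c * root_unity (p ^ n) ^ k" using k by simp
      moreover have "c \<noteq> 0" using norm_c by auto
      ultimately have "[l = k] (mod p ^ n)"
        using root_unity_power_eq_iff[of "p ^ n"] p by (simp add: prime_gt_0_nat)
      then show False using False that k by (simp add: cong_def)
    qed
    then show ?thesis using loop_y_acts_elsewhere False by simp
  qed
  have "acts \<gamma> (1 ^ nat (zp_mod a N) * (\<Prod>l\<leftarrow>[0..<p ^ n]. ?w l) * 1)"
    unfolding \<gamma>
    by (intro acts_mult acts_padic_power loop_x_acts foldr_acts pi1_closure_derived_acts d pC y) auto
  moreover have "(\<Prod>l\<leftarrow>[0..<p ^ n]. ?w l) = ?w k"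
  proof -
    have "(\<Prod>l\<leftarrow>[0..<p ^ n]. ?w l) = (\<Prod>l\<in>{0..<p ^ n}. ?w l)"
      by (subst prod.distinct_set_conv_list[symmetric]) auto
    also have "\<dots> = (\<Prod>l\<in>{k}. ?w l)"
      by (rule prod.mono_neutral_right) (use k in auto)
    finally show ?thesis by simp
  qed
  ultimately show ?thesis by simp
qed

end

text \<open>Let \<eta> and \<eta>' be the standard points of the covers with parameters \<sigma> c
  and c. The conjugated path takes \<eta> to y = \<sigma>(\<beta>(\<eta>')), and the inverse of
  \<beta> takes y to \<xi> \<eta>, with \<xi> the scalar given by the coefficient at k. Hence y =
  \<xi> \<beta>(\<eta>), and the constant terms are compared.\<close>

lemma (in galois_automorphism) is_K_kummer:
  fixes j n N k :: nat and c :: complex and \<nu> :: "'p::prime_card zp set \<Rightarrow> 'p zp"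
  defines "P \<equiv> CARD('p) ^ N" and "Q \<equiv> CARD('p) ^ n"
  assumes K: "is_K m j \<sigma> \<nu>" and m: "\<not> CARD('p) dvd m" and j: "0 < j" "j < m"
    and c: "c ^ Q = 1" and k: "k < Q" "\<sigma> c * root_unity Q ^ k = 1"
  shows "root_unity P ^ nat (zp_mod (\<nu> (zp_ball n k)) N)
      * (1 - \<sigma> c * root_unity m ^ residue_mod m j Q) powr (1 / of_nat P)
    = \<sigma> ((1 - c * root_unity m ^ residue_mod m j Q) powr (1 / of_nat P))"
proof -
  let ?p = "CARD('p)"
  define u where "u = root_unity m ^ residue_mod m j Q"
  have p: "prime ?p" by (rule prime_card)
  have pos: "0 < P" "0 < Q" using p by (auto simp: P_def Q_def prime_gt_0_nat)
  have cq: "c \<in> qbar" using c pos by (auto intro: qbar_root_unity)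
  have sc: "\<sigma> c ^ Q = 1" using c cq by (simp flip: aut_power)
  interpret A: kummer_fibre ?p n N "\<sigma> c" by standard (use p sc Q_def in auto)
  interpret B: kummer_fibre ?p n N c by standard (use p c Q_def in auto)
  have AP: "A.P = P" by (simp add: A.P_def P_def)
  have Af: "A.f = kummer_cover P 1 (\<sigma> c)" by (simp add: A.f_def AP)
  have Bf: "B.f = kummer_cover P 1 c" by (simp add: B.f_def AP)
  obtain \<beta> a where lift: "is_lift ?p n u (path_beta TYPE('p) m j) \<beta>"
    and ab: "abelian_image_eq n
             (path_comp ?p n Tangent01 (path_inverse ?p n Tangent01 (At u) \<beta>)
                (galois_act ?p n Tangent01 \<sigma> \<beta>)) a (\<lambda>k. \<nu> (zp_ball n k))"
    using K unfolding is_K_def Let_def u_def Q_def by blast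
  have \<beta>: "\<beta> \<in> etale_paths ?p n Tangent01 (At u)" using lift by (simp add: is_lift_def)
  let ?\<eta> = "kummer_series P (\<sigma> c)" and ?\<eta>' = "kummer_series P c"
  let ?\<xi> = "root_unity P ^ nat (zp_mod (\<nu> (zp_ball n k)) N)"
  have \<eta>: "?\<eta> \<in> fibre Tangent01 A.f" "?\<eta>' \<in> fibre Tangent01 B.f"
    using A.kummer_series_fibre B.kummer_series_fibre by (simp_all add: AP)
  define y where "y = fps_act \<sigma> (\<beta> B.f ?\<eta>')"
  have act: "galois_act ?p n Tangent01 \<sigma> \<beta> A.f ?\<eta> = y"
  proof -
    have "fps_act \<sigma>' ?\<eta> = ?\<eta>'"
      using fps_act_inverse[of ?\<eta>'] cq pos by (simp add: fps_act_kummer_series kummer_series_qbar)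
    moreover have "map_poly (map_poly \<sigma>') A.f = B.f"
      unfolding Af Bf by (rule conjugate_kummer_cover[OF cq])
    ultimately show ?thesis
      using A.f_covers \<eta> by (simp add: galois_act_def Let_def y_def \<sigma>'_def)
  qed
  \<comment> \<open>Since \<sigma> fixes the endpoint u, conjugating the equation of the cover at u
    gives an equation at the same point.\<close>
  have yf: "y \<in> fibre (At u) A.f"
  proof -
    have "\<beta> B.f ?\<eta>' \<in> fibre (At u) B.f"
      by (rule etale_pathsD(3)[OF \<beta> B.f_covers \<eta>(2)])
    then have z: "\<beta> B.f ?\<eta>' \<in> qbar_fps" "1 - \<beta> B.f ?\<eta>' ^ P = fps_const c * (fps_const u + fps_X)"
      using pos by (simp_all add: Bf fibre_kummer_cover coordinate_def)
    have uq: "u \<in> qbar" "\<sigma> u = u"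
    proof -
      have "root_unity m \<in> qbar" using root_unity_power_self[of m] j by (intro qbar_root_unity[of _ m]) auto
      then show "u \<in> qbar" unfolding u_def by (rule qbar_power)
      show "\<sigma> u = u" unfolding u_def using j by (intro fixes_root_unity) simp
    qed
    have "y ^ P = fps_act \<sigma> (1 - fps_const c * (fps_const u + fps_X))"
    proof -
      have "\<beta> B.f ?\<eta>' ^ P = 1 - fps_const c * (fps_const u + fps_X)"
        using z(2) by (metis add.commute diff_add_cancel diff_diff_eq2)
      then show ?thesis unfolding y_def fps_act_power[OF z(1), symmetric] by simp
    qed
    also have "\<dots> = 1 - fps_const (\<sigma> c) * (fps_const u + fps_X)"
      using cq uq by (auto simp: fps_eq_iff aut_diff aut_hom qbar_mult fps_X_def aut_minus)
    finally have "1 - y ^ P = fps_const (\<sigma> c) * (fps_const u + fps_X)" by simp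
    moreover have "y \<in> qbar_fps" unfolding y_def by (rule fps_act_qbar[OF z(1)])
    ultimately show ?thesis using pos by (simp add: Af fibre_kummer_cover coordinate_def)
  qed
  have "A.acts (path_comp ?p n Tangent01 (path_inverse ?p n Tangent01 (At u) \<beta>)
                (galois_act ?p n Tangent01 \<sigma> \<beta>)) (root_unity A.P ^ nat (zp_mod (\<nu> (zp_ball n k)) N))"
    by (rule A.abelian_image_acts[OF ab refl]) (use k Q_def in auto)
  from A.acts_apply[OF this \<eta>(1)] have "path_inverse ?p n Tangent01 (At u) \<beta> A.f y = fps_const ?\<xi> * ?\<eta>"
    using A.f_covers \<eta>(1) by (simp add: path_comp_def compose_def act AP)
  then have "inv_into (fibre Tangent01 A.f) (\<beta> A.f) y = fps_const ?\<xi> * ?\<eta>"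
    using A.f_covers yf by (simp add: path_inverse_def)
  moreover have "\<beta> A.f (inv_into (fibre Tangent01 A.f) (\<beta> A.f) y) = y"
    using etale_pathsD(2)[OF \<beta> A.f_covers] yf by (auto simp: bij_betw_def f_inv_into_f)
  ultimately have "\<beta> A.f (fps_const ?\<xi> * ?\<eta>) = y" by simp
  moreover have "?\<xi> ^ A.P = 1"
    using root_unity_power_self[OF pos(1)] unfolding AP by (metis mult.commute power_mult power_one)
  ultimately have "y = fps_const ?\<xi> * \<beta> A.f ?\<eta>"
    using A.path_scalar[OF \<beta> _ \<eta>(1)] by simp
  then have "fps_nth y 0 = ?\<xi> * fps_nth (\<beta> A.f ?\<eta>) 0" by simp
  then show ?thesis
    unfolding y_def Af Bf fps_act_nth
    using lift_of_path_beta_nth_0[OF _ j m lift, of "\<sigma> c" N] lift_of_path_beta_nth_0[OF _ j m lift, of c N] c sc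
    by (simp add: P_def Q_def)
qed

section \<open>Arithmetic of the residues, and arguments of the endpoint values\<close>

section \<open>The measure \<open>\<mu>(i/m)\<close>\<close>

context
  fixes q m i :: nat
  assumes cop: "coprime q m" and i: "0 < i" "i < m"
begin

lemma residue_mod_pos: "0 < residue_mod m i (q ^ n)"
proof (rule gr0I)
  assume 0: "residue_mod m i (q ^ n) = 0"
  have "[q ^ n * residue_mod m i (q ^ n) = i] (mod m)"
    using cop i by (intro residue_mod_props) auto
  then show False using i by (simp add: 0 cong_def)
qed

lemma mu_digit_eq:
  "int (q * residue_mod m i (q ^ Suc \<alpha>)) = int (residue_mod m i (q ^ \<alpha>)) + mu_digit q m i \<alpha> * int m"
proof -
  let ?r = "residue_mod m i (q ^ Suc \<alpha>)" and ?s = "residue_mod m i (q ^ \<alpha>)"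
  have "[q ^ Suc \<alpha> * ?r = i] (mod m)" "[q ^ \<alpha> * ?s = i] (mod m)"
    using cop i by (intro residue_mod_props; simp)+
  then have "[q ^ \<alpha> * (q * ?r) = q ^ \<alpha> * ?s] (mod m)"
    using cong_sym cong_trans by (metis mult.assoc power_Suc2)
  then have "[q * ?r = ?s] (mod m)"
    using cop by (simp add: cong_mult_lcancel_nat)
  then have "int m dvd int (q * ?r) - int ?s"
    by (simp flip: cong_int_iff add: cong_iff_dvd_diff)
  then obtain k where "int (q * ?r) - int ?s = int m * k" by (rule dvdE)
  then have k: "int (q * ?r) = int ?s + k * int m" by (simp add: algebra_simps)
  have "mu_digit q m i \<alpha> = k"
    unfolding mu_digit_def
  proof (rule the_equality[of "\<lambda>k. int (q * ?r) = int ?s + k * int m"])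
    show "k' = k" if "int (q * ?r) = int ?s + k' * int m" for k'
    proof -
      have "k' * int m = k * int m" using that k by linarith
      then show ?thesis using i by simp
    qed
  qed (rule k)
  then show ?thesis using k by simp
qed

text \<open>With r_\<alpha> the residues, the digits satisfy m k_\<alpha> q^\<alpha> =
  q^(\<alpha>+1) r_(\<alpha>+1) - q^\<alpha> r_\<alpha>, so their sum telescopes; the terms (q - 1)
  q^\<alpha> add up to q^n - 1.\<close>

lemma sum_mu_digit:
  "int m * (\<Sum>\<alpha><n. (int q - 1 - mu_digit q m i \<alpha>) * int q ^ \<alpha>)
    = int m * (int q ^ n - 1) - (int (q ^ n * residue_mod m i (q ^ n)) - int i)"
proof (induction n)
  case 0
  have "residue_mod m i 1 = i" using i by (intro residue_mod_eqI) auto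
  then show ?case by simp
next
  case (Suc n)
  let ?d = "mu_digit q m i n" and ?r = "int (residue_mod m i (q ^ n))" and ?s = "int (residue_mod m i (q ^ Suc n))"
  have e: "int q * ?s = ?r + ?d * int m" using mu_digit_eq[of n] by simp
  have "int m * (\<Sum>\<alpha><Suc n. (int q - 1 - mu_digit q m i \<alpha>) * int q ^ \<alpha>)
      = int m * (int q ^ n - 1) - (int q ^ n * ?r - int i) + int m * ((int q - 1 - ?d) * int q ^ n)"
    using Suc by (simp add: ring_distribs)
  also have "\<dots> = int m * (int q ^ Suc n - 1) - (int q ^ n * (?r + ?d * int m) - int i)"
    by (simp add: algebra_simps)
  also have "int q ^ n * (?r + ?d * int m) = int q ^ Suc n * ?s"
    unfolding e[symmetric] by (simp add: algebra_simps)
  finally show ?case by simp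
qed

text \<open>\<open>numer n k / (m q\<^sup>n)\<close> is the fractional part of \<open>k / q\<^sup>n + [i q\<^sup>-\<^sup>n]\<^sub>m / m\<close>.\<close>

definition "numer n k = (k * m + q ^ n * residue_mod m i (q ^ n)) mod (m * q ^ n)"

text \<open>The numerator is congruent to i modulo m, so the fractional part x is never 0 and 1 -
  exp(2 pi i x) never vanishes.\<close>

lemma numer_pos_less:
  assumes "0 < q"
  shows "0 < numer n k" "numer n k < m * q ^ n"
proof -
  show "numer n k < m * q ^ n" using assms i by (simp add: numer_def)
  have "numer n k mod m = (k * m + q ^ n * residue_mod m i (q ^ n)) mod m"
    unfolding numer_def by (rule mod_mod_cancel) simp
  also have "\<dots> = i"
  proof -
    have "[q ^ n * residue_mod m i (q ^ n) = i] (mod m)"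
      using cop i by (intro residue_mod_props) auto
    then show ?thesis using i by (simp add: cong_def)
  qed
  finally show "0 < numer n k" using i by (metis gr0I mod_0)
qed

text \<open>The correction \<open>mu_delta\<close> is minus the integer part of k/q^n +
  [i q^(-n)]_m/m: the threshold in its definition is where this sum reaches 1.\<close>

lemma numer_eq:
  assumes "k < q ^ n"
  shows "int (numer n k) = int (k * m) + int (q ^ n * residue_mod m i (q ^ n)) + mu_delta q m i n k * int (m * q ^ n)"
proof -
  let ?Q = "q ^ n" and ?r = "residue_mod m i (q ^ n)"
  let ?\<Sigma> = "\<Sum>\<alpha><n. (int q - 1 - mu_digit q m i \<alpha>) * int q ^ \<alpha>"
  define t where "t = k * m + ?Q * ?r"
  have rm: "?r < m" using cop i by (intro residue_mod_props) auto
  have s: "int m * ?\<Sigma> = int m * (int ?Q - 1) - (int (?Q * ?r) - int i)"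
    using sum_mu_digit[of n] by simp
  have delta: "int k \<ge> 1 + ?\<Sigma> \<longleftrightarrow> m * ?Q \<le> t"
  proof -
    have "1 + ?\<Sigma> \<le> int k \<longleftrightarrow> int m * (1 + ?\<Sigma>) \<le> int m * int k"
      using i by simp
    also have "int m * (1 + ?\<Sigma>) = int m * int ?Q - int (?Q * ?r) + int i"
      using s by (simp add: algebra_simps)
    also have "\<dots> \<le> int m * int k \<longleftrightarrow> int (m * ?Q) + int i \<le> int t"
      by (simp add: t_def algebra_simps)
    \<comment> \<open>The extra i may be dropped: t is congruent to i modulo m and 0 < i < m, so t
      can reach the multiple m q^n of m only by exceeding it by at least i.\<close>
    also have "\<dots> \<longleftrightarrow> int (m * ?Q) \<le> int t"
    proof -
      have "int t = int m * (int k + int ?Q - 1 - ?\<Sigma>) + int i"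
        using s by (simp add: t_def algebra_simps)
      then obtain z where z: "int t = int m * z + int i" by blast
      have "int m * int ?Q \<le> int m * z + int i \<Longrightarrow> int ?Q \<le> z"
      proof (rule ccontr)
        assume "int m * int ?Q \<le> int m * z + int i" "\<not> int ?Q \<le> z"
        then have "int m * (z + 1) \<le> int m * int ?Q" by (intro mult_left_mono) auto
        then show False using \<open>int m * int ?Q \<le> int m * z + int i\<close> i by (simp add: algebra_simps)
      qed
      moreover have "int ?Q \<le> z \<Longrightarrow> int m * int ?Q \<le> int m * z"
        by (intro mult_left_mono) auto
      ultimately show ?thesis unfolding z by auto
    qed
    finally show ?thesis by (simp only: of_nat_le_iff)
  qed
  \<comment> \<open>Both summands of t are at most m q^n, the first one strictly below, so the
    reduction subtracts at most one multiple.\<close>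
  have "t < 2 * (m * ?Q)"
  proof -
    have "k * m < ?Q * m" using assms i by simp
    moreover have "?Q * ?r \<le> ?Q * m" using rm by simp
    ultimately show ?thesis unfolding t_def mult.commute[of m ?Q] by linarith
  qed
  then have "int (t mod (m * ?Q)) = int t + (if m * ?Q \<le> t then - 1 else 0) * int (m * ?Q)"
    by (auto simp: le_mod_geq)
  then show ?thesis
    unfolding numer_def mu_delta_def delta t_def[symmetric] by (simp add: t_def)
qed

end

section \<open>Arguments of \<open>1 - exp (2 \<pi> i x)\<close>\<close>

text \<open>By the half angle formulas 1 - exp(2 pi i x) = 2 sin(pi x) exp(i (pi x - pi/2)), and for
  0 < x < 1 this argument is within the principal range.\<close>

lemma powr_one_minus_cis:
  assumes "0 < x" "x < 1"
  shows "(1 - cis (2 * pi * x)) powr z = exp (z * Complex (ln (2 * sin (pi * x))) (pi * x - pi / 2))"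
proof -
  let ?L = "Complex (ln (2 * sin (pi * x))) (pi * x - pi / 2)"
  have s: "sin (pi * x) > 0" using assms by (intro sin_gt_zero) auto
  have "exp ?L = of_real (2 * sin (pi * x)) * cis (pi * x - pi / 2)"
    using s by (simp add: exp_eq_polar)
  also have "\<dots> = 1 - cis (2 * pi * x)"
    using sin_double[of "pi * x"] cos_double_sin[of "pi * x"]
    by (simp add: complex_eq_iff cos_diff sin_diff power2_eq_square mult_ac)
  finally have e: "exp ?L = 1 - cis (2 * pi * x)" .
  have "Ln (1 - cis (2 * pi * x)) = ?L"
  proof (rule Ln_unique[OF e])
    have "0 < pi * x" "pi * x < pi" using assms by simp_all
    then show "- pi < Im ?L" "Im ?L \<le> pi"
      using pi_gt_zero unfolding complex.sel by linarith+
  qed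
  moreover have "1 - cis (2 * pi * x) \<noteq> 0" using e by (metis exp_not_eq_zero)
  ultimately show ?thesis by (simp add: powr_def)
qed

text \<open>With \<open>w = exp (2 \<pi> i x)\<close>, the arguments of \<open>1 - w\<close> and of its conjugate differ by \<open>\<pi> (2 x - 1)\<close>.\<close>

lemma conjugate_root_relation:
  assumes "0 < A" "A < m * Q" "0 < P" "w = cis (2 * pi * (real A / real (m * Q)))"
  shows "((1 - cnj w) powr (1 / of_nat P)) ^ (2 * m) * root_unity (P * Q) ^ (2 * A)
    = ((1 - w) powr (1 / of_nat P)) ^ (2 * m) * root_unity (P * Q) ^ (m * Q)"
proof -
  have mQ: "0 < m" "0 < Q" using assms(2) by (auto intro: gr0I)
  define x where "x = real A / real (m * Q)"
  have x: "0 < x" "x < 1" using assms mQ by (auto simp: x_def field_simps simp flip: of_nat_mult)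
  have "cnj w = cis (2 * pi * (1 - x))"
  proof -
    have "cis (2 * pi * (1 - x)) = cis (2 * pi) * cis (- (2 * pi * x))"
      by (simp add: cis_mult algebra_simps)
    then show ?thesis by (simp add: assms(4) x_def cis_cnj)
  qed
  moreover have "sin (pi * (1 - x)) = sin (pi * x)" by (simp add: right_diff_distrib sin_diff)
  ultimately have B: "(1 - cnj w) powr z = exp (z * Complex (ln (2 * sin (pi * x))) (- (pi * x - pi / 2)))" for z
    using powr_one_minus_cis[of "1 - x" z] x by (simp add: algebra_simps)
  have C: "(1 - w) powr z = exp (z * Complex (ln (2 * sin (pi * x))) (pi * x - pi / 2))" for z
    using powr_one_minus_cis[of x z] x by (simp add: assms(4) x_def)
  have r: "root_unity (P * Q) ^ k = exp (Complex 0 (2 * pi * real k / real (P * Q)))" for k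
    by (simp add: root_unity_power_cis cis_conv_exp complex_eq_iff flip: Complex_eq)
       (simp add: exp_eq_polar)
  \<comment> \<open>The exponents on both sides are equal as complex numbers, so no period of exp
    enters. The power 2 m clears the denominators, as 2 m Q (x - 1/2) = 2 A - m Q.\<close>
  show ?thesis
    unfolding B C r exp_of_nat_mult[symmetric] exp_add[symmetric]
    using mQ assms(3)
    by (intro arg_cong[of _ _ exp]) (simp add: complex_eq_iff x_def field_simps Re_divide Im_divide)
qed

section \<open>The cyclotomic character, and the combined value on one residue class\<close>

section \<open>The cyclotomic character\<close>

lemma root_unity_powersE:
  assumes "z ^ r = 1" "0 < r"
  obtains k where "z = root_unity r ^ k"
proof -
  have "z \<in> {exp (2 * of_real pi * \<i> * of_nat j / of_nat r) | j. j < r}"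
    using complex_roots_unity[of r] assms by auto
  then obtain j where "z = exp (2 * of_real pi * \<i> * of_nat j / of_nat r)" by blast
  then have "z = root_unity r ^ j"
    by (simp add: root_unity_def flip: exp_of_nat_mult) (simp add: mult_ac)
  then show ?thesis by (rule that)
qed

lemma zp_eq_if_root_unity_powers_eq:
  fixes x y :: "'p::prime_card zp"
  assumes "\<And>n. root_unity (CARD('p) ^ n) ^ nat (zp_mod x n) = root_unity (CARD('p) ^ n) ^ nat (zp_mod y n)"
  shows "x = y"
proof (rule zp_eqI)
  fix n
  have "[nat (zp_mod x n) = nat (zp_mod y n)] (mod (CARD('p) ^ n))"
    using assms[of n] root_unity_power_eq_iff[of "CARD('p) ^ n"] by simp
  then have "[int (nat (zp_mod x n)) = int (nat (zp_mod y n))] (mod (int CARD('p) ^ n))"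
    by (simp only: cong_int_iff of_nat_power[symmetric])
  then show "zp_mod x n = zp_mod y n"
    using zp_mod_bounds[of x n] zp_mod_bounds[of y n] by (simp add: cong_def zp_mod_mod)
qed

context galois_automorphism
begin

lemma root_unity_qbar: "0 < r \<Longrightarrow> root_unity r \<in> qbar"
  using root_unity_power_self by (rule qbar_root_unity)

text \<open>The exponents by which \<sigma> acts on roots of unity of order p^n are compatible in n
  and form a p-adic integer; its residues can be recovered from the action, so it is the unique
  candidate.\<close>

lemma cyclotomic_char:
  "\<sigma> (root_unity (CARD('p::prime_card) ^ n))
    = root_unity (CARD('p) ^ n) ^ nat (zp_mod (cyclotomic_char \<sigma> :: 'p zp) n)"
proof -
  let ?q = "CARD('p)" and ?z = "\<lambda>n. root_unity (CARD('p) ^ n)"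
  have "\<exists>k. \<sigma> (?z n) = ?z n ^ k" for n
  proof -
    have "\<sigma> (?z n) ^ (?q ^ n) = 1"
      using root_unity_power_self[of "?q ^ n"] root_unity_qbar[of "?q ^ n"] by (simp flip: aut_power)
    then show ?thesis by (rule root_unity_powersE) auto
  qed
  then obtain a where a: "\<And>n. \<sigma> (?z n) = ?z n ^ a n" by metis
  have z: "?z (Suc n) ^ ?q = ?z n" for n
    using root_unity_mult_power[of ?q "?q ^ n"] by (simp add: mult.commute)
  have "int (a (Suc n)) mod int ?q ^ n = int (a n) mod int ?q ^ n" for n
  proof -
    have "\<sigma> (?z n) = ?z n ^ a (Suc n)"
      using a[of "Suc n"] z[of n] root_unity_qbar[of "?q ^ Suc n"]
      by (metis aut_power mult.commute power_mult zero_less_card_finite zero_less_power)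
    then have "[a (Suc n) = a n] (mod (?q ^ n))"
      using a[of n] root_unity_power_eq_iff[of "?q ^ n"] by (simp add: cong_sym_eq)
    then show ?thesis by (metis cong_def cong_int_iff of_nat_power)
  qed
  then obtain X :: "'p zp" where X: "\<And>n. zp_mod X n = int (a n) mod int ?q ^ n"
    by (rule zp_of_compatible) blast
  have ok: "\<sigma> (?z n) = ?z n ^ nat (zp_mod X n)" for n
  proof -
    have "nat (zp_mod X n) = a n mod ?q ^ n"
      unfolding X by (simp add: nat_mod_distrib nat_power_eq)
    then show ?thesis
      using a[of n] root_unity_power_eq_iff[of "?q ^ n" "a n" "a n mod ?q ^ n"] by simp
  qed
  have "cyclotomic_char \<sigma> = X"
    unfolding cyclotomic_char_def
  proof (rule the_equality)
    show "\<forall>n. \<sigma> (?z n) = ?z n ^ nat (zp_mod X n)" using ok by blast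
    fix c :: "'p zp" assume "\<forall>n. \<sigma> (?z n) = ?z n ^ nat (zp_mod c n)"
    then show "c = X" using ok by (intro zp_eq_if_root_unity_powers_eq) metis
  qed
  then show ?thesis using ok by simp
qed

lemma inverse_galois: "galois_automorphism m \<sigma>'"
proof
  have "\<sigma>' (x + y) = \<sigma>' x + \<sigma>' y" "\<sigma>' (x * y) = \<sigma>' x * \<sigma>' y" if "x \<in> qbar" "y \<in> qbar" for x y
  proof -
    have "\<sigma>' (\<sigma> (\<sigma>' x + \<sigma>' y)) = \<sigma>' x + \<sigma>' y" "\<sigma>' (\<sigma> (\<sigma>' x * \<sigma>' y)) = \<sigma>' x * \<sigma>' y"
      using that aut_qbar by (simp_all add: aut_inverse qbar_add qbar_mult)
    then show "\<sigma>' (x + y) = \<sigma>' x + \<sigma>' y" "\<sigma>' (x * y) = \<sigma>' x * \<sigma>' y"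
      using that aut_qbar by (simp_all add: aut_hom aut_inverse)
  qed
  moreover have "bij_betw \<sigma>' qbar qbar"
    unfolding \<sigma>'_def by (rule bij_betw_inv_into[OF aut_bij])
  moreover have "\<sigma>' (root_unity m) = root_unity m"
  proof -
    have "root_unity m \<in> qbar"
    proof (cases "m = 0")
      case True
      then show ?thesis by (simp add: root_unity_def)
    qed (simp add: root_unity_qbar)
    moreover have "\<sigma> (root_unity m) = root_unity m" using \<sigma> by (simp add: galois_cyclotomic_def)
    ultimately show ?thesis using aut_inverse(2) by metis
  qed
  ultimately show "\<sigma>' \<in> galois_cyclotomic m" by (simp add: galois_cyclotomic_def)
qed

text \<open>The inverse is the character of the inverse automorphism. It makes multiplication by the
  character a permutation of the residue classes.\<close>

lemma cyclotomic_char_unit: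
  obtains y :: "'p::prime_card zp" where "cyclotomic_char \<sigma> * y = 1"
proof -
  interpret inv: galois_automorphism m \<sigma>' by (rule inverse_galois)
  let ?x = "cyclotomic_char \<sigma> :: 'p zp" and ?y = "cyclotomic_char \<sigma>' :: 'p zp"
  have "?x * ?y = 1"
  proof (rule zp_eq_if_root_unity_powers_eq)
    fix n
    let ?z = "root_unity (CARD('p) ^ n)"
    have q: "?z \<in> qbar" by (rule root_unity_qbar) simp
    have "?z = \<sigma>' (\<sigma> ?z)" using q by (simp add: aut_inverse)
    also have "\<dots> = ?z ^ (nat (zp_mod ?x n) * nat (zp_mod ?y n))"
      unfolding cyclotomic_char[where 'p = 'p, of n] inv.aut_power[OF q] inv.cyclotomic_char[where 'p = 'p, of n]
      by (simp add: mult.commute flip: power_mult)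
    also have "\<dots> = ?z ^ nat (zp_mod (?x * ?y) n)"
    proof -
      have "nat (zp_mod (?x * ?y) n) = (nat (zp_mod ?x n) * nat (zp_mod ?y n)) mod CARD('p) ^ n"
        using zp_mod_bounds(1)[of ?x n] zp_mod_bounds(1)[of ?y n]
        by (simp add: zp_mod_simps nat_mod_distrib nat_mult_distrib nat_power_eq)
      then show ?thesis by (simp add: root_unity_power_eq_iff cong_def)
    qed
    finally have "?z ^ nat (zp_mod (?x * ?y) n) = ?z ^ 1" by simp
    also have "\<dots> = ?z ^ nat (zp_mod (1 :: 'p zp) n)"
    proof -
      have e: "nat (zp_mod (1 :: 'p zp) n) = 1 mod CARD('p) ^ n"
        by (simp add: zp_mod_simps nat_mod_distrib nat_power_eq)
      have pos: "0 < CARD('p) ^ n" by simp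
      show ?thesis unfolding e root_unity_power_eq_iff[OF pos] by (simp only: cong_def mod_mod_trivial)
    qed
    finally show "?z ^ nat (zp_mod (?x * ?y) n) = ?z ^ nat (zp_mod (1 :: 'p zp) n)" .
  qed
  then show ?thesis by (rule that)
qed

end

section \<open>The values of \<open>K(\<xi>\<^sub>m\<^sup>-\<^sup>i)(\<sigma>) + \<iota>(K(\<xi>\<^sub>m\<^sup>i)(\<sigma>))\<close>\<close>

context galois_automorphism
begin

text \<open>
  Raising to the power \<open>2 m\<close> removes signs and \<open>m\<close>-th roots of unity, so that only roots of unity
  of \<open>p\<close>-power order remain, on which \<open>\<sigma>\<close> acts through the cyclotomic character. The exponents are
  arranged so that no subtraction occurs.
\<close>

lemma conjugate_exponent_congruence:
  fixes K_pos K_neg :: "'p::prime_card zp set \<Rightarrow> 'p zp" and i n N k k' :: nat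
  defines "P \<equiv> CARD('p) ^ N" and "Q \<equiv> CARD('p) ^ n"
  defines "\<kappa>n \<equiv> nat (zp_mod (K_neg (zp_ball n k)) N)"
    and "\<kappa>p \<equiv> nat (zp_mod (K_pos (zp_ball n ((Q - k) mod Q))) N)"
    and "X \<equiv> nat (zp_mod (cyclotomic_char \<sigma> :: 'p zp) (N + n))"
    and "A \<equiv> numer CARD('p) m i n"
  assumes m: "\<not> CARD('p) dvd m" and i: "0 < i" "i < m"
    and K: "is_K m i \<sigma> K_pos" "is_K m (m - i) \<sigma> K_neg"
    and k: "k' < Q" "k = (nat (zp_mod (cyclotomic_char \<sigma> :: 'p zp) n) * k') mod Q"
  shows "[2 * m * \<kappa>n * Q + 2 * A k' * X + m * Q = 2 * m * \<kappa>p * Q + m * Q * X + 2 * A k] (mod (P * Q))"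
proof -
  let ?p = "CARD('p)"
  have p: "prime ?p" by (rule prime_card)
  have cop: "coprime ?p m" by (rule prime_imp_coprime[OF p m])
  have pos: "0 < P" "0 < Q" "0 < m" using p i by (auto simp: P_def Q_def prime_gt_0_nat)
  define r where "r = residue_mod m i Q"
  define u where "u = root_unity m ^ r"
  define w where "w = (\<lambda>k. root_unity Q ^ k * u)"
  define B where "B = (\<lambda>z :: complex. (1 - z) powr (1 / of_nat P))"
  define \<zeta> where "\<zeta> = root_unity (P * Q)"
  have kQ: "k < Q" using k pos by simp
  have cnj: "cnj (root_unity s ^ l) * root_unity s ^ l = 1" for s l
    by (simp add: root_unity_power_cis cis_cnj cis_mult)
  have \<zeta>q: "\<zeta> \<in> qbar" unfolding \<zeta>_def using pos by (intro root_unity_qbar) simp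
  have \<xi>q: "root_unity Q ^ l \<in> qbar" "cnj (root_unity Q ^ l) \<in> qbar" for l
  proof -
    show "root_unity Q ^ l \<in> qbar" using root_unity_qbar[OF pos(2)] by (rule qbar_power)
    then show "cnj (root_unity Q ^ l) \<in> qbar" by (simp only: qbar_def mem_Collect_eq algebraic_cnj_iff)
  qed
  have \<xi>1: "(root_unity Q ^ l) ^ Q = 1" "(cnj (root_unity Q ^ l)) ^ Q = 1" for l
  proof -
    show *: "(root_unity Q ^ l) ^ Q = 1"
      using root_unity_power_self[OF pos(2)] by (metis mult.commute power_mult power_one)
    then have "cnj ((root_unity Q ^ l) ^ Q) = 1" by simp
    then show "(cnj (root_unity Q ^ l)) ^ Q = 1" by (simp only: complex_cnj_power)
  qed
  have s1: "\<sigma> (root_unity Q ^ k') = root_unity Q ^ k"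
  proof -
    let ?x = "nat (zp_mod (cyclotomic_char \<sigma> :: 'p zp) n)"
    have "\<sigma> (root_unity Q) = root_unity Q ^ ?x"
      unfolding Q_def by (rule cyclotomic_char)
    then have "\<sigma> (root_unity Q ^ k') = root_unity Q ^ (?x * k')"
      by (simp only: aut_power[OF root_unity_qbar[OF pos(2)]] power_mult)
    also have "\<dots> = root_unity Q ^ k"
      unfolding root_unity_power_eq_iff[OF pos(2)] k(2) by (simp only: cong_def mod_mod_trivial)
    finally show ?thesis .
  qed
  have s2: "\<sigma> (cnj (root_unity Q ^ k')) * root_unity Q ^ k = 1"
    using aut_hom(2)[OF \<xi>q(2) \<xi>q(1), of k' k'] unfolding cnj s1 by simp
  then have s3: "\<sigma> (cnj (root_unity Q ^ k')) = cnj (root_unity Q ^ k)"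
    using cnj[of Q k] by (metis mult_right_cancel mult_zero_right zero_neq_one)
  \<comment> \<open>For \<open>K_pos\<close> the parameter c is the root with exponent k', whose
    image has exponent k; the index inverting \<sigma> c is therefore -k, reduced so that k = 0
    gives 0.\<close>
  have s4: "\<sigma> (root_unity Q ^ k') * root_unity Q ^ ((Q - k) mod Q) = 1"
  proof -
    have "root_unity Q ^ ((Q - k) mod Q) = root_unity Q ^ (Q - k)"
      using root_unity_power_eq_iff[OF pos(2)] by (simp add: cong_def)
    then have "\<sigma> (root_unity Q ^ k') * root_unity Q ^ ((Q - k) mod Q) = root_unity Q ^ (k + (Q - k))"
      by (simp add: s1 power_add)
    then show ?thesis using kQ root_unity_power_self[OF pos(2)] by simp
  qed
  have r: "0 < r" "r < m" "[Q * r = i] (mod m)"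
    using residue_mod_pos[OF cop i, of n] residue_mod_props[of Q m i] cop pos by (auto simp: r_def Q_def)
  \<comment> \<open>The residues belonging to i and m - i are r and m - r, so the two endpoints are
    complex conjugates.\<close>
  have um: "root_unity m ^ residue_mod m (m - i) Q = cnj u"
  proof -
    have "residue_mod m (m - i) Q = m - r"
    proof (rule residue_mod_eqI)
      have "[Q * (m - r) + Q * r = (m - i) + i] (mod m)"
      proof -
        have "Q * (m - r) + Q * r = Q * m" using r by (simp flip: distrib_left)
        then show ?thesis using i by (simp add: cong_def)
      qed
      moreover have "[(m - i) + i = (m - i) + Q * r] (mod m)"
        using r(3) by (intro cong_add) (auto simp: cong_sym_eq)
      ultimately have "[Q * (m - r) + Q * r = (m - i) + Q * r] (mod m)" by (rule cong_trans)
      then show "[Q * (m - r) = m - i] (mod m)" by (simp add: cong_add_rcancel_nat)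
    qed (use cop r pos in \<open>auto simp: Q_def\<close>)
    moreover have "root_unity m ^ (m - r) * u = 1"
      using r root_unity_power_self[OF pos(3)] by (simp add: u_def flip: power_add)
    ultimately show ?thesis
      using cnj[of m r] unfolding u_def by (metis mult_right_cancel mult_zero_right zero_neq_one)
  qed
  have pK: "root_unity P ^ \<kappa>p * B (w k) = \<sigma> (B (w k'))"
  proof -
    have "(Q - k) mod Q < Q" using pos by simp
    then have "root_unity P ^ \<kappa>p * (1 - \<sigma> (root_unity Q ^ k') * root_unity m ^ residue_mod m i Q) powr (1 / of_nat P)
        = \<sigma> ((1 - root_unity Q ^ k' * root_unity m ^ residue_mod m i Q) powr (1 / of_nat P))"
      using \<xi>1(1)[of k'] s4 unfolding \<kappa>p_def P_def Q_def by (intro is_K_kummer[OF K(1) m i])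
    then show ?thesis unfolding B_def w_def u_def r_def s1 .
  qed
  have nK: "root_unity P ^ \<kappa>n * B (cnj (w k)) = \<sigma> (B (cnj (w k')))"
  proof -
    have "0 < m - i" "m - i < m" using i by auto
    then have "root_unity P ^ \<kappa>n * (1 - \<sigma> (cnj (root_unity Q ^ k')) * root_unity m ^ residue_mod m (m - i) Q) powr (1 / of_nat P)
        = \<sigma> ((1 - cnj (root_unity Q ^ k') * root_unity m ^ residue_mod m (m - i) Q) powr (1 / of_nat P))"
      using \<xi>1(2)[of k'] s2 kQ unfolding \<kappa>n_def P_def Q_def by (intro is_K_kummer[OF K(2) m])
    then show ?thesis unfolding B_def w_def s3 um complex_cnj_mult .
  qed
  have w: "w l = cis (2 * pi * (real (A l) / real (m * Q)))" for l
  proof -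
    have "w l = cis (2 * pi * real (l * m + Q * r) / real (m * Q))"
      using pos by (simp add: w_def u_def root_unity_power_cis cis_mult field_simps)
    also have "\<dots> = root_unity (m * Q) ^ (l * m + Q * r)" by (simp only: root_unity_power_cis)
    also have "\<dots> = root_unity (m * Q) ^ A l"
      using pos by (simp add: root_unity_power_eq_iff A_def numer_def[OF cop i] r_def Q_def cong_def)
    finally show ?thesis by (simp only: root_unity_power_cis times_divide_eq_right)
  qed
  have A: "0 < A l" "A l < m * Q" for l
    using numer_pos_less[OF cop i, of n l] p by (simp_all add: A_def Q_def prime_gt_0_nat)
  have rel: "B (cnj (w l)) ^ (2 * m) * \<zeta> ^ (2 * A l) = B (w l) ^ (2 * m) * \<zeta> ^ (m * Q)" for l
    unfolding B_def \<zeta>_def by (rule conjugate_root_relation[OF A pos(1) w])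
  have w1: "1 - w l \<noteq> 0" for l
  proof -
    have "root_unity (m * Q) ^ A l \<noteq> root_unity (m * Q) ^ 0"
      using pos A[of l] root_unity_power_eq_iff[of "m * Q" "A l" 0] by (simp add: cong_def)
    then show ?thesis unfolding w by (simp add: root_unity_power_cis)
  qed
  have uq: "u \<in> qbar" unfolding u_def using root_unity_qbar[OF pos(3)] by (rule qbar_power)
  have wq: "w l \<in> qbar" "cnj (w l) \<in> qbar" for l
  proof -
    show "w l \<in> qbar" unfolding w_def using \<xi>q(1)[of l] uq by (rule qbar_mult)
    then show "cnj (w l) \<in> qbar" by (simp add: qbar_def)
  qed
  \<comment> \<open>The principal roots must be algebraic, because \<sigma> is known to be
    multiplicative on \<open>qbar\<close> only.\<close>
  have Bq: "B (w l) \<in> qbar" "B (cnj (w l)) \<in> qbar" for l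
  proof -
    have "1 - cnj (w l) \<noteq> 0" using w1[of l] by (metis complex_cnj_cancel_iff complex_cnj_diff complex_cnj_one eq_iff_diff_eq_0)
    then have "B (w l) ^ P = 1 - w l" "B (cnj (w l)) ^ P = 1 - cnj (w l)"
      unfolding B_def using powr_inverse_of_nat_power w1[of l] pos by blast+
    then have "B (w l) ^ P \<in> qbar" "B (cnj (w l)) ^ P \<in> qbar"
      using qbar_diff[OF qbar_1 wq(1)] qbar_diff[OF qbar_1 wq(2)] by (simp_all only:)
    then show "B (w l) \<in> qbar" "B (cnj (w l)) \<in> qbar"
      using pos(1) qbar_root by blast+
  qed
  have \<sigma>\<zeta>: "\<sigma> (\<zeta> ^ l) = \<zeta> ^ (X * l)" for l
  proof -
    have "\<sigma> \<zeta> = \<zeta> ^ X"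
      unfolding X_def \<zeta>_def P_def Q_def power_add[symmetric] by (rule cyclotomic_char)
    then show ?thesis by (simp only: aut_power[OF \<zeta>q] power_mult)
  qed
  have P\<zeta>: "root_unity P ^ l = \<zeta> ^ (Q * l)" for l
    unfolding \<zeta>_def power_mult root_unity_mult_power[OF pos(2), of P] ..
  define b where "b = B (w k) ^ (2 * m)"
  have b0: "b \<noteq> 0" using w1[of k] by (simp add: b_def B_def)
  have \<sigma>B: "\<sigma> (z ^ (2 * m) * \<zeta> ^ l) = \<zeta> ^ (Q * \<kappa> * (2 * m)) * z' ^ (2 * m) * \<zeta> ^ (X * l)"
    if "z \<in> qbar" "root_unity P ^ \<kappa> * z' = \<sigma> z" for z z' \<kappa> l
  proof -
    have "\<sigma> (z ^ (2 * m) * \<zeta> ^ l) = \<sigma> z ^ (2 * m) * \<zeta> ^ (X * l)"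
      by (simp only: aut_hom(2)[OF qbar_power[OF that(1)] qbar_power[OF \<zeta>q]] aut_power[OF that(1)] \<sigma>\<zeta>)
    also have "\<sigma> z ^ (2 * m) = (\<zeta> ^ (Q * \<kappa>)) ^ (2 * m) * z' ^ (2 * m)"
      by (simp only: that(2)[symmetric] P\<zeta> power_mult_distrib)
    also have "(\<zeta> ^ (Q * \<kappa>)) ^ (2 * m) = \<zeta> ^ (Q * \<kappa> * (2 * m))" by (rule power_mult[symmetric])
    finally show ?thesis .
  qed
  \<comment> \<open>The relation \<open>rel\<close> at k' is transported by \<sigma> and combined
    with \<open>rel\<close> at k; the nonzero factor b then cancels, and only powers of
    \<open>\<zeta>\<close> remain.\<close>
  have "\<zeta> ^ (Q * \<kappa>n * (2 * m)) * B (cnj (w k)) ^ (2 * m) * \<zeta> ^ (X * (2 * A k'))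
      = \<sigma> (B (cnj (w k')) ^ (2 * m) * \<zeta> ^ (2 * A k'))"
    by (rule \<sigma>B[OF Bq(2) nK, symmetric])
  also have "\<dots> = \<sigma> (B (w k') ^ (2 * m) * \<zeta> ^ (m * Q))" by (simp only: rel)
  also have "\<dots> = \<zeta> ^ (Q * \<kappa>p * (2 * m)) * b * \<zeta> ^ (X * (m * Q))"
    unfolding b_def by (rule \<sigma>B[OF Bq(1) pK])
  finally have e: "\<zeta> ^ (Q * \<kappa>n * (2 * m)) * B (cnj (w k)) ^ (2 * m) * \<zeta> ^ (X * (2 * A k'))
      = \<zeta> ^ (Q * \<kappa>p * (2 * m)) * b * \<zeta> ^ (X * (m * Q))" .
  have "\<zeta> ^ (Q * \<kappa>n * (2 * m)) * \<zeta> ^ (X * (2 * A k')) * \<zeta> ^ (m * Q) * b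
      = \<zeta> ^ (Q * \<kappa>n * (2 * m)) * \<zeta> ^ (X * (2 * A k')) * (B (cnj (w k)) ^ (2 * m) * \<zeta> ^ (2 * A k))"
    unfolding rel b_def by (simp only: mult_ac)
  also have "\<dots> = \<zeta> ^ (Q * \<kappa>p * (2 * m)) * \<zeta> ^ (X * (m * Q)) * \<zeta> ^ (2 * A k) * b"
    using arg_cong[OF e, of "\<lambda>z. z * \<zeta> ^ (2 * A k)"] by (simp only: mult_ac)
  finally have "\<zeta> ^ (Q * \<kappa>n * (2 * m)) * \<zeta> ^ (X * (2 * A k')) * \<zeta> ^ (m * Q)
      = \<zeta> ^ (Q * \<kappa>p * (2 * m)) * \<zeta> ^ (X * (m * Q)) * \<zeta> ^ (2 * A k)"
    using b0 by simp
  then have "\<zeta> ^ (2 * m * \<kappa>n * Q + 2 * A k' * X + m * Q) = \<zeta> ^ (2 * m * \<kappa>p * Q + m * Q * X + 2 * A k)"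
    by (simp only: power_add mult_ac)
  then show ?thesis
    unfolding \<zeta>_def using pos by (subst (asm) root_unity_power_eq_iff) auto
qed

text \<open>Here C k = 2 m Q (x - 1/2) for the fractional part x at k. The congruence holds modulo
  p^(N + n) for every N, so it is an equality of p-adic integers.\<close>

lemma K_difference:
  fixes K_pos K_neg :: "'p::prime_card zp set \<Rightarrow> 'p zp" and i n k k' :: nat
  defines "Q \<equiv> CARD('p) ^ n" and "C \<equiv> (\<lambda>k. 2 * int (numer CARD('p) m i n k) - int (m * CARD('p) ^ n))"
  assumes m: "\<not> CARD('p) dvd m" and i: "0 < i" "i < m"
    and K: "is_K m i \<sigma> K_pos" "is_K m (m - i) \<sigma> K_neg"
    and k: "k' < Q" "k = (nat (zp_mod (cyclotomic_char \<sigma> :: 'p zp) n) * k') mod Q"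
  shows "of_nat (2 * m * Q) * (K_neg (zp_ball n k) - K_pos (zp_ball n ((Q - k) mod Q)))
    = of_int (C k) - cyclotomic_char \<sigma> * of_int (C k')"
proof -
  let ?q = "int CARD('p)" and ?X = "cyclotomic_char \<sigma> :: 'p zp"
  let ?a = "K_neg (zp_ball n k)" and ?b = "K_pos (zp_ball n ((Q - k) mod Q))"
  define Z where "Z = of_nat (2 * m * Q) * (?a - ?b) - (of_int (C k) - ?X * of_int (C k'))"
  \<comment> \<open>The coefficients enter through their residues modulo p^N; the factor Q = p^n
    raises the precision to p^(N + n).\<close>
  have low: "?q ^ N * ?q ^ n dvd int Q * (zp_mod x (N + n) - zp_mod x N)" for x :: "'p zp" and N
  proof -
    have "?q ^ N dvd zp_mod x (N + n) - zp_mod x N"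
      using zp_mod_mod_le[of N "N + n" x] zp_mod_mod[of x N] by (metis le_add1 mod_eq_dvd_iff)
    then show ?thesis by (simp add: Q_def mult.commute)
  qed
  have "zp_mod Z (N + n) = 0" for N
  proof -
    let ?A = "zp_mod ?a N" and ?B = "zp_mod ?b N" and ?x = "zp_mod ?X (N + n)"
    let ?n = "\<lambda>k. int (numer CARD('p) m i n k)"
    let ?M = "?q ^ N * ?q ^ n"
    have M: "?q ^ (N + n) = ?M" by (simp add: power_add)
    have "[int (2 * m * nat ?A * Q + 2 * numer CARD('p) m i n k' * nat ?x + m * Q)
        = int (2 * m * nat ?B * Q + m * Q * nat ?x + 2 * numer CARD('p) m i n k)] (mod int (CARD('p) ^ N * Q))"
      unfolding cong_int_iff Q_def by (rule conjugate_exponent_congruence[OF m i K k[unfolded Q_def]])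
    then have c1: "?M dvd (2 * int m * ?A * int Q + 2 * ?n k' * ?x + int m * int Q)
        - (2 * int m * ?B * int Q + int m * int Q * ?x + 2 * ?n k)"
      by (simp only: cong_iff_dvd_diff of_nat_add of_nat_mult of_nat_power of_nat_numeral Q_def
          nat_0_le[OF zp_mod_bounds(1)])
    have c2: "?M dvd (2 * int m) * (int Q * (zp_mod ?a (N + n) - ?A)) - (2 * int m) * (int Q * (zp_mod ?b (N + n) - ?B))"
      by (intro dvd_diff dvd_mult low)
    have c: "?M dvd (2 * int m * int Q) * (zp_mod ?a (N + n) - zp_mod ?b (N + n)) - (C k - ?x * C k')"
      using dvd_add[OF c1 c2] by (simp add: C_def Q_def algebra_simps)
    have "zp_mod Z (N + n) = ((2 * int m * int Q) * (zp_mod ?a (N + n) - zp_mod ?b (N + n)) - (C k - ?x * C k')) mod ?M"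
      unfolding Z_def zp_mod_simps zp_mod_of_nat zp_mod_of_int M by (simp add: mod_simps mult.assoc)
    then show ?thesis using c by (simp add: dvd_eq_mod_eq_0)
  qed
  then have "zp_mod Z N = 0" for N
    using zp_mod_mod_le[of N "N + n" Z] by simp
  then have "Z = 0" by (intro zp_eqI) (simp add: zp_mod_simps)
  then show ?thesis by (simp add: Z_def)
qed

end

section \<open>From residue classes to compact open sets\<close>

section \<open>Measures\<close>

definition level_balls :: "nat \<Rightarrow> 'p::prime_card zp set \<Rightarrow> nat set" where
  "level_balls n U = {k. k < CARD('p) ^ n \<and> (zp_ball n k :: 'p zp set) \<subseteq> U}"

lemma nat_zp_mod_less: "nat (zp_mod x n) < CARD('p) ^ n" for x :: "'p::prime_card zp"
  using zp_mod_bounds[of x n] by (simp add: nat_less_iff)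

lemma finite_level_balls: "finite (level_balls n (U :: 'p::prime_card zp set))"
  by (rule finite_subset[of _ "{..<CARD('p) ^ n}"]) (auto simp: level_balls_def)

lemma mem_zp_ball: "x \<in> zp_ball n k \<longleftrightarrow> zp_mod x n = int k mod int CARD('p) ^ n" for x :: "'p::prime_card zp"
  by (simp add: zp_ball_def)

lemma of_nat_in_zp_ball: "(of_nat k :: 'p::prime_card zp) \<in> zp_ball n k"
  by (simp add: mem_zp_ball zp_mod_of_nat)

lemma zp_ball_subset_iff:
  fixes x :: "'p::prime_card zp"
  assumes "of_level n U" "x \<in> zp_ball n k"
  shows "zp_ball n k \<subseteq> U \<longleftrightarrow> x \<in> U"
proof
  show "zp_ball n k \<subseteq> U" if "x \<in> U"
  proof
    fix y :: "'p zp" assume "y \<in> zp_ball n k"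
    then have "zp_mod x n = zp_mod y n" using assms(2) by (simp add: mem_zp_ball)
    then show "y \<in> U" using assms(1) that unfolding of_level_def by blast
  qed
qed (use assms(2) in blast)

lemma compact_open_zp_balls:
  "compact_open (\<Union>k\<in>F. zp_ball n k :: 'p::prime_card zp set)"
  unfolding compact_open_def of_level_def by (intro exI[of _ n]) (auto simp: mem_zp_ball)

lemma zp_measure_empty: "zp_measure \<nu> \<Longrightarrow> \<nu> {} = 0"
proof -
  assume "zp_measure \<nu>"
  moreover have "compact_open {}" by (simp add: compact_open_def of_level_def)
  ultimately have "\<nu> ({} \<union> {}) = \<nu> {} + \<nu> {}" unfolding zp_measure_def by blast
  then show ?thesis by simp
qed

lemma zp_measure_eq_sum:
  fixes U :: "'p::prime_card zp set"
  assumes \<nu>: "zp_measure \<nu>" and U: "of_level n U"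
  shows "\<nu> U = (\<Sum>k\<in>level_balls n U. \<nu> (zp_ball n k))"
proof -
  have add: "\<nu> (\<Union>k\<in>F. zp_ball n k) = (\<Sum>k\<in>F. \<nu> (zp_ball n k))"
    if "finite F" "F \<subseteq> {..<CARD('p) ^ n}" for F
    using that
  proof (induction F)
    case empty
    then show ?case using zp_measure_empty[OF \<nu>] by simp
  next
    case (insert k F)
    have "zp_ball n k \<inter> (\<Union>k\<in>F. zp_ball n k :: 'p zp set) = {}"
    proof -
      have "k = l" if "x \<in> zp_ball n k" "x \<in> zp_ball n l" "l \<in> F" for l and x :: "'p zp"
      proof -
        have "int k mod int CARD('p) ^ n = int l mod int CARD('p) ^ n"
          using that by (simp add: mem_zp_ball)
        moreover have "int k < int CARD('p) ^ n" "int l < int CARD('p) ^ n"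
          using insert.prems that(3) by (auto simp flip: of_nat_power)
        ultimately show ?thesis by simp
      qed
      then show ?thesis using insert.hyps by blast
    qed
    moreover have "compact_open (zp_ball n k :: 'p zp set)"
      using compact_open_zp_balls[of n "{k}"] by simp
    ultimately have "\<nu> (zp_ball n k \<union> (\<Union>k\<in>F. zp_ball n k)) = \<nu> (zp_ball n k) + \<nu> (\<Union>k\<in>F. zp_ball n k)"
      using \<nu> compact_open_zp_balls unfolding zp_measure_def by blast
    then show ?case using insert by simp
  qed
  have "U = (\<Union>k\<in>level_balls n U. zp_ball n k)"
  proof (intro equalityI subsetI)
    fix x assume x: "x \<in> U"
    let ?k = "nat (zp_mod x n)"
    have "int ?k = zp_mod x n" using zp_mod_bounds[of x n] by simp
    then have "x \<in> zp_ball n ?k" by (simp add: mem_zp_ball zp_mod_mod)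
    moreover have "?k < CARD('p) ^ n" by (rule nat_zp_mod_less)
    ultimately show "x \<in> (\<Union>k\<in>level_balls n U. zp_ball n k)"
      using zp_ball_subset_iff[OF U] x by (auto simp: level_balls_def)
  qed (auto simp: level_balls_def)
  then have "\<nu> U = \<nu> (\<Union>k\<in>level_balls n U. zp_ball n k)" by simp
  also have "\<dots> = (\<Sum>k\<in>level_balls n U. \<nu> (zp_ball n k))"
    by (rule add[OF finite_level_balls]) (auto simp: level_balls_def)
  finally show ?thesis .
qed

lemma uminus_image_eq: "uminus ` U = {x. - x \<in> U}" for U :: "'a::group_add set"
proof (intro equalityI subsetI)
  fix x assume "x \<in> {x. - x \<in> U}"
  then show "x \<in> uminus ` U" by (intro image_eqI[of x uminus "- x"]) auto
qed auto

lemma zp_measure_iota: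
  fixes \<nu> :: "'p::prime_card zp set \<Rightarrow> 'b::ab_group_add"
  assumes "zp_measure \<nu>"
  shows "zp_measure (iota \<nu>)"
proof -
  have co: "compact_open (uminus ` U)" if U: "compact_open U" for U :: "'p zp set"
  proof -
    obtain n where "of_level n U" using U by (auto simp: compact_open_def)
    then have "of_level n (uminus ` U)"
      unfolding of_level_def uminus_image_eq mem_Collect_eq by (simp add: zp_mod_simps)
    then show ?thesis by (auto simp: compact_open_def)
  qed
  show ?thesis
    unfolding zp_measure_def
  proof (intro allI impI)
    fix U V :: "'p zp set" assume UV: "compact_open U" "compact_open V" "U \<inter> V = {}"
    have "uminus ` U \<inter> uminus ` V = {}" using UV(3) by auto
    then have "\<nu> (uminus ` U \<union> uminus ` V) = \<nu> (uminus ` U) + \<nu> (uminus ` V)"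
      using assms co UV(1,2) unfolding zp_measure_def by blast
    then show "iota \<nu> (U \<union> V) = iota \<nu> U + iota \<nu> V" by (simp add: iota_def image_Un)
  qed
qed

text \<open>The outer reduction matters for k = 0 only, where p^n has to become 0.\<close>

lemma uminus_zp_ball:
  assumes "k < CARD('p) ^ n"
  shows "uminus ` zp_ball n k = (zp_ball n ((CARD('p) ^ n - k) mod CARD('p) ^ n) :: 'p::prime_card zp set)"
proof -
  let ?M = "int CARD('p) ^ n"
  have e: "int ((CARD('p) ^ n - k) mod CARD('p) ^ n) mod ?M = (- int k) mod ?M"
    using assms by (simp add: of_nat_mod of_nat_diff less_imp_le)
  have iff: "zp_mod (- x) n = int k mod ?M \<longleftrightarrow> zp_mod x n = (- int k) mod ?M" for x :: "'p zp"
  proof -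
    have "zp_mod (- x) n = int k mod ?M \<longleftrightarrow> ?M dvd - zp_mod x n - int k"
      by (simp add: zp_mod_simps mod_eq_dvd_iff)
    also have "\<dots> \<longleftrightarrow> ?M dvd zp_mod x n - (- int k)"
    proof -
      have "- zp_mod x n - int k = - (zp_mod x n - (- int k))" by simp
      then show ?thesis by (simp only: dvd_minus_iff)
    qed
    also have "\<dots> \<longleftrightarrow> zp_mod x n mod ?M = (- int k) mod ?M"
      by (simp only: mod_eq_dvd_iff)
    finally show ?thesis by (simp only: zp_mod_mod)
  qed
  show ?thesis
    by (rule Set.set_eqI) (simp only: uminus_image_eq mem_Collect_eq mem_zp_ball e iff)
qed

text \<open>Consequently U and its preimage have the same least level, which is where
  \<open>measure_from_balls\<close> evaluates both of them.\<close>

lemma of_level_preimage_unit: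
  fixes x y :: "'p::prime_card zp"
  assumes xy: "x * y = 1"
  shows "of_level n {z. x * z \<in> U} \<longleftrightarrow> of_level n U"
proof
  have mult: "zp_mod (c * a) n = zp_mod (c * b) n" if "zp_mod a n = zp_mod b n" for a b c :: "'p zp"
    using that by (simp add: zp_mod_simps)
  show "of_level n {z. x * z \<in> U}" if "of_level n U"
    using that mult unfolding of_level_def by (metis mem_Collect_eq)
  have inv: "x * (y * a) = a" for a using xy by (simp only: mult.assoc[symmetric] mult_1_left)
  show "of_level n U" if U: "of_level n {z. x * z \<in> U}"
    unfolding of_level_def
  proof (intro allI impI)
    fix a b :: "'p zp" assume "zp_mod a n = zp_mod b n"
    then have "zp_mod (y * a) n = zp_mod (y * b) n" by (rule mult)
    then have "y * a \<in> {z. x * z \<in> U} \<longleftrightarrow> y * b \<in> {z. x * z \<in> U}"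
      using U unfolding of_level_def by blast
    then show "a \<in> U \<longleftrightarrow> b \<in> U" by (simp add: inv)
  qed
qed

text \<open>Multiplication by a unit permutes the classes modulo p^n, with the inverse y undoing it;
  this reindexes sums over U by the classes in the preimage.\<close>

lemma bij_betw_level_balls_preimage_unit:
  fixes x y :: "'p::prime_card zp"
  assumes xy: "x * y = 1" and U: "of_level n U"
  shows "bij_betw (\<lambda>k. (nat (zp_mod x n) * k) mod CARD('p) ^ n) (level_balls n {z. x * z \<in> U}) (level_balls n U)"
proof -
  let ?M = "CARD('p) ^ n" and ?V = "{z. x * z \<in> U}"
  let ?T = "\<lambda>k. (nat (zp_mod x n) * k) mod ?M"
  have M: "0 < ?M" by simp
  have V: "of_level n ?V" using U xy by (simp add: of_level_preimage_unit)
  have ball: "x * of_nat k \<in> zp_ball n (?T k)" for k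
  proof -
    have "int (?T k) = (zp_mod x n * int k) mod int CARD('p) ^ n"
      by (simp only: of_nat_mod of_nat_mult of_nat_power nat_0_le[OF zp_mod_bounds(1)])
    then show ?thesis
      by (simp only: mem_zp_ball zp_mod_simps(3) zp_mod_of_nat mod_mult_right_eq mod_mod_trivial)
  qed
  have V_iff: "k \<in> level_balls n ?V \<longleftrightarrow> k < ?M \<and> ?T k \<in> level_balls n U" for k
  proof -
    have "zp_ball n k \<subseteq> ?V \<longleftrightarrow> zp_ball n (?T k) \<subseteq> U"
      unfolding zp_ball_subset_iff[OF V of_nat_in_zp_ball] zp_ball_subset_iff[OF U ball] mem_Collect_eq ..
    moreover have "?T k < ?M" using M by (rule mod_less_divisor)
    ultimately show ?thesis unfolding level_balls_def mem_Collect_eq by blast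
  qed
  have inv: "y * (x * a) = a" "x * (y * a) = a" for a
    using xy by (simp_all only: mult.assoc[symmetric] mult_1_left mult.commute[of y x])
  have small: "k = l" if "k < ?M" "l < ?M" "zp_mod (of_nat k :: 'p zp) n = zp_mod (of_nat l :: 'p zp) n" for k l
  proof -
    have "int k < int CARD('p) ^ n" "int l < int CARD('p) ^ n"
      using that by (simp_all flip: of_nat_power)
    then show ?thesis using that(3) by (simp add: zp_mod_of_nat)
  qed
  show ?thesis
  proof (rule bij_betw_imageI)
    show "inj_on ?T (level_balls n ?V)"
    proof (rule inj_onI)
      fix k l assume k: "k \<in> level_balls n ?V" "l \<in> level_balls n ?V" "?T k = ?T l"
      then have "zp_mod (x * of_nat k) n = zp_mod (x * of_nat l) n"
        using ball[of k] ball[of l] by (simp add: mem_zp_ball)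
      then have "zp_mod (y * (x * of_nat k)) n = zp_mod (y * (x * of_nat l)) n"
        by (simp add: zp_mod_simps(3)[of y])
      then show "k = l" using small k V_iff by (simp add: inv)
    qed
    show "?T ` level_balls n ?V = level_balls n U"
    proof (intro equalityI subsetI)
      fix k assume k: "k \<in> level_balls n U"
      then have kM: "k < ?M" by (simp add: level_balls_def)
      let ?l = "nat (zp_mod (y * of_nat k) n)"
      have l: "int ?l = zp_mod (y * of_nat k) n" using zp_mod_bounds(1)[of "y * of_nat k" n] by simp
      have lM: "?l < ?M" by (rule nat_zp_mod_less)
      have "zp_mod (of_nat ?l :: 'p zp) n = zp_mod (y * of_nat k) n"
        by (simp only: zp_mod_of_nat l zp_mod_mod)
      then have "zp_mod (x * of_nat ?l) n = zp_mod (x * (y * of_nat k)) n"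
        by (simp only: zp_mod_simps(3)[of x])
      then have "zp_mod (of_nat (?T ?l) :: 'p zp) n = zp_mod (of_nat k :: 'p zp) n"
        using ball[of ?l] of_nat_in_zp_ball[of "?T ?l" n] by (simp only: inv mem_zp_ball)
      then have "?T ?l = k" using small[of "?T ?l" k] kM M by simp
      then show "k \<in> ?T ` level_balls n ?V" using V_iff[of ?l] k lM by (metis imageI)
    qed (use V_iff in auto)
  qed
qed

lemma zp_to_qp_simps:
  "zp_to_qp (x + y) = zp_to_qp x + zp_to_qp y" "zp_to_qp (x - y) = zp_to_qp x - zp_to_qp y"
  "zp_to_qp (x * y) = zp_to_qp x * zp_to_qp y" "zp_to_qp 1 = 1" "zp_to_qp 0 = 0"
  "zp_to_qp (of_nat k :: 'p zp) = of_nat k" "zp_to_qp (of_int l :: 'p zp) = of_int l"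
  for x y :: "'p::prime_card zp"
proof -
  show n: "zp_to_qp (of_nat k :: 'p zp) = of_nat k" for k by (simp add: Fract_of_nat_eq)
  show "zp_to_qp (of_int l :: 'p zp) = of_int l"
  proof (cases l)
    case (neg k)
    have "zp_to_qp (- of_nat (Suc k) :: 'p zp) = - zp_to_qp (of_nat (Suc k))" by (simp only: minus_fract)
    then show ?thesis by (simp only: neg n of_int_minus of_int_of_nat_eq)
  qed (simp add: n)
qed (simp_all add: One_fract_def Zero_fract_def)

lemma zp_to_qp_sum: "zp_to_qp (sum f A :: 'p::prime_card zp) = (\<Sum>k\<in>A. zp_to_qp (f k))"
  by (induction A rule: infinite_finite_induct) (simp_all add: zp_to_qp_simps)

text \<open>Because k < p^k, the residue of k modulo p^k is k itself.\<close>

lemma qp_of_nat_nonzero: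
  assumes "0 < k"
  shows "(of_nat k :: 'p::prime_card zp fract) \<noteq> 0"
proof
  assume "(of_nat k :: 'p zp fract) = 0"
  then have "(of_nat k :: 'p zp) = 0"
    by (simp add: Fract_of_nat_eq[symmetric] Zero_fract_def eq_fract)
  then have "zp_mod (of_nat k :: 'p zp) k = 0" by (simp add: zp_mod_simps)
  moreover have "k < CARD('p) ^ k"
    using prime_gt_1_nat[OF prime_card[where 'a = 'p]] by (intro power_gt_expt) auto
  then have "int k < int CARD('p) ^ k" by (simp flip: of_nat_power)
  ultimately show False using assms by (simp add: zp_mod_of_nat)
qed

theorem theorem3p5:
  fixes m i :: nat and \<sigma> :: "complex \<Rightarrow> complex"
    and K_pos K_neg :: "'p::prime_card zp set \<Rightarrow> 'p zp"
  assumes "0 < m" and "\<not> CARD('p) dvd m" and "0 < i" and "i < m"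
    and "\<sigma> \<in> galois_cyclotomic m"
    and "is_K m i \<sigma> K_pos" and "is_K m (m - i) \<sigma> K_neg"
  shows "\<forall>U. compact_open U \<longrightarrow>
    zp_to_qp (K_neg U + iota K_pos U)
      = regularize (cyclotomic_char \<sigma>) E1 U + regularize (cyclotomic_char \<sigma>) (mu m i) U"
proof (intro allI impI)
  fix U :: "'p zp set" assume "compact_open U"
  interpret galois_automorphism m \<sigma> by standard (rule assms)
  let ?p = "CARD('p)" and ?X = "cyclotomic_char \<sigma> :: 'p zp"
  have cop: "coprime ?p m" by (rule prime_imp_coprime[OF prime_card assms(2)])
  obtain y :: "'p zp" where y: "?X * y = 1" by (rule cyclotomic_char_unit)
  define n where "n = (LEAST n. of_level n U)"
  have U: "of_level n U"
    using \<open>compact_open U\<close> unfolding n_def compact_open_def by (rule LeastI_ex)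
  let ?V = "{x. ?X * x \<in> U}"
  have V: "of_level n ?V" using of_level_preimage_unit[OF y] U by blast
  \<comment> \<open>All values of \<open>E1\<close> and \<open>mu\<close> that occur are then sums
    over classes of the same level n.\<close>
  have nV: "(LEAST n. of_level n ?V) = n" unfolding n_def of_level_preimage_unit[OF y] ..
  define Q where "Q = ?p ^ n"
  define T where "T = (\<lambda>k. (nat (zp_mod ?X n) * k) mod Q)"
  define C where "C = (\<lambda>k. 2 * int (numer ?p m i n k) - int (m * Q))"
  define e :: "nat \<Rightarrow> 'p zp fract" where "e = (\<lambda>k. (of_nat k / of_nat Q - 1 / 2)
      + (of_nat (residue_mod m i Q) / of_nat m + of_int (mu_delta ?p m i n k)))"
  have Q0: "0 < Q" by (simp add: Q_def)
  have nz: "(of_nat m :: 'p zp fract) \<noteq> 0" "(of_nat Q :: 'p zp fract) \<noteq> 0" "(2 :: 'p zp fract) \<noteq> 0"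
    using qp_of_nat_nonzero[of m] qp_of_nat_nonzero[of Q] qp_of_nat_nonzero[of 2] assms(1) Q0 by simp_all
  have E: "E1 U + mu m i U = (\<Sum>k\<in>level_balls n U. e k)"
    "E1 ?V + mu m i ?V = (\<Sum>k\<in>level_balls n ?V. e k)"
    unfolding E1_def mu_def measure_from_balls_def nV n_def[symmetric] Let_def level_balls_def[symmetric]
      e_def Q_def by (simp_all only: sum.distrib)
  \<comment> \<open>The three terms k/Q, [i/Q]_m/m and the integer correction add up to the
    fractional part x, so the value of the two measures together is x - 1/2.\<close>
  have eC: "e k = of_int (C k) / of_nat (2 * m * Q)" if "k < Q" for k
  proof -
    have Ck: "C k = 2 * (int (k * m) + int (Q * residue_mod m i Q) + mu_delta ?p m i n k * int (m * Q)) - int (m * Q)"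
      using numer_eq[OF cop assms(3,4), of k n] that unfolding C_def Q_def by simp
    have "(of_int (C k) :: 'p zp fract) = 2 * (of_nat k * of_nat m + of_nat Q * of_nat (residue_mod m i Q)
        + of_int (mu_delta ?p m i n k) * (of_nat m * of_nat Q)) - of_nat m * of_nat Q"
      unfolding Ck by simp
    then show ?thesis using nz by (simp add: e_def field_simps)
  qed
  define D where "D = (\<lambda>U. K_neg U + iota K_pos U)"
  have "zp_measure K_pos" "zp_measure K_neg" using assms(6,7) by (simp_all add: is_K_def)
  then have "zp_measure D"
    using zp_measure_iota[of K_pos] by (simp add: D_def zp_measure_def)
  \<comment> \<open>Division by 2 m Q in the field of p-adic numbers turns the integral identity
    into the regularized form, with k the source class and T k its image.\<close>
  have D: "zp_to_qp (D (zp_ball n (T k))) = e (T k) - zp_to_qp ?X * e k" if "k < Q" for k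
  proof -
    have TQ: "T k < Q" using Q0 by (simp add: T_def)
    have "D (zp_ball n (T k)) = K_neg (zp_ball n (T k)) - K_pos (zp_ball n ((Q - T k) mod Q))"
      using TQ by (simp add: D_def iota_def uminus_zp_ball Q_def)
    moreover have "of_nat (2 * m * Q) * (K_neg (zp_ball n (T k)) - K_pos (zp_ball n ((Q - T k) mod Q)))
        = of_int (C (T k)) - ?X * of_int (C k)"
      unfolding C_def Q_def
      by (rule K_difference[OF assms(2,3,4,6,7)]) (use that in \<open>auto simp: T_def Q_def\<close>)
    ultimately have "zp_to_qp (of_nat (2 * m * Q) * D (zp_ball n (T k))) = zp_to_qp (of_int (C (T k)) - ?X * of_int (C k))"
      by simp
    then have eq: "of_nat (2 * m * Q) * zp_to_qp (D (zp_ball n (T k))) = of_int (C (T k)) - zp_to_qp ?X * of_int (C k)"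
      by (simp only: zp_to_qp_simps)
    have "(of_nat (2 * m * Q) :: 'p zp fract) \<noteq> 0" using nz by simp
    then have "zp_to_qp (D (zp_ball n (T k))) = (of_int (C (T k)) - zp_to_qp ?X * of_int (C k)) / of_nat (2 * m * Q)"
      unfolding eq[symmetric] by (rule nonzero_mult_div_cancel_left[symmetric])
    then show ?thesis by (simp only: eC[OF TQ] eC[OF that] diff_divide_distrib times_divide_eq_right)
  qed
  have bij: "bij_betw T (level_balls n ?V) (level_balls n U)"
    unfolding T_def Q_def by (rule bij_betw_level_balls_preimage_unit[OF y U])
  have "zp_to_qp (D U) = (\<Sum>k\<in>level_balls n U. zp_to_qp (D (zp_ball n k)))"
    unfolding zp_measure_eq_sum[OF \<open>zp_measure D\<close> U] zp_to_qp_sum ..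
  \<comment> \<open>The classes of U are reindexed by those of the preimage; the first summand then
    returns to U, and the second is the value of \<open>comp_inverse\<close>.\<close>
  also have "\<dots> = (\<Sum>k\<in>level_balls n ?V. zp_to_qp (D (zp_ball n (T k))))"
    by (rule sum.reindex_bij_betw[OF bij, symmetric])
  also have "\<dots> = (\<Sum>k\<in>level_balls n ?V. e (T k) - zp_to_qp ?X * e k)"
    by (intro sum.cong D refl) (simp add: level_balls_def Q_def)
  also have "\<dots> = (\<Sum>k\<in>level_balls n ?V. e (T k)) - zp_to_qp ?X * (\<Sum>k\<in>level_balls n ?V. e k)"
    by (simp only: sum_subtractf sum_distrib_left)
  also have "(\<Sum>k\<in>level_balls n ?V. e (T k)) = (\<Sum>k\<in>level_balls n U. e k)"
    by (rule sum.reindex_bij_betw[OF bij])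
  finally show "zp_to_qp (K_neg U + iota K_pos U) = regularize ?X E1 U + regularize ?X (mu m i) U"
    unfolding E[symmetric] D_def regularize_def comp_inverse_def by (simp add: algebra_simps)
qed

end
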